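(* Let $n\ge 2$, let $\Omega\subset\mathbb{R}^n$ be a bounded, smooth, uniformly convex domain, and let $u$ be a smooth convex function in $\Omega$ with $u=0$ on $\partial\Omega$ and $\lambda\le\det D^2u\le\Lambda$ in $\Omega$, where $0<\lambda\le\Lambda$ are constants. Let $V\subset\subset\Omega$. Suppose that a function $v$ solves $U^{ij}v_{ij}=0$ in $S_u(0,R)\setminus\{0\}\subset V$ and satisfies $$|v(x)|=\begin{cases} o\bigl(r^{\frac{2-n}{2}}\bigr) & \text{if } n\ge 3,\\ o(|\log r|) & \text{if } n=2,\end{cases}\qquad\text{on }\partial S_u(0,r)\text{ as } r\to 0.$$ Then $v$ has a removable singularity at $0$.
   Context: $U=(U^{ij})=(\det D^2u)(D^2u)^{-1}$ is the cofactor matrix of $D^2u$; repeated indices are summed. The section of $u$ with center $x_0$ and height $t>0$ is $$S_u(x_0,t)=\{x\in\overline\Omega: u(x)<u(x_0)+\nabla u(x_0)\cdot(x-x_0)+t\}.$$ That $v$ has a removable singularity at $0$ means that $v$ coincides on $S_u(0,R)\setminus\{0\}$ with a solution of $U^{ij}\tilde v_{ij}=0$ in all of $S_u(0,R)$. *)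

theory Defs
  imports "HOL-Analysis.Analysis"
begin

text \<open>The functions below are total; all differential notions are only used on open sets
  (or at interior points), where the Frechet derivative is unique.\<close>

primrec Ck_on :: "nat \<Rightarrow> ('a::real_normed_vector \<Rightarrow> 'b::real_normed_vector) \<Rightarrow> 'a set \<Rightarrow> bool" where
  "Ck_on 0 f S \<longleftrightarrow> continuous_on S f"
| "Ck_on (Suc k) f S \<longleftrightarrow>
     (\<forall>x\<in>S. f differentiable (at x)) \<and>
     (\<forall>h. Ck_on k (\<lambda>x. frechet_derivative f (at x) h) S)"

definition smooth_on :: "('a::real_normed_vector \<Rightarrow> 'b::real_normed_vector) \<Rightarrow> 'a set \<Rightarrow> bool" where
  "smooth_on f S \<longleftrightarrow> (\<forall>k. Ck_on k f S)"

definition partial :: "'n::finite \<Rightarrow> (real^'n \<Rightarrow> real) \<Rightarrow> real^'n \<Rightarrow> real" where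
  "partial i f x = frechet_derivative f (at x) (axis i 1)"

definition gradient :: "(real^'n::finite \<Rightarrow> real) \<Rightarrow> real^'n \<Rightarrow> real^'n" where
  "gradient f x = (\<chi> i. partial i f x)"

definition hessian :: "(real^'n::finite \<Rightarrow> real) \<Rightarrow> real^'n \<Rightarrow> real^'n^'n" where
  "hessian f x = (\<chi> i j. partial i (partial j f) x)"

definition cofactor_hessian :: "(real^'n::finite \<Rightarrow> real) \<Rightarrow> real^'n \<Rightarrow> real^'n^'n" where
  "cofactor_hessian u x = det (hessian u x) *\<^sub>R matrix_inv (hessian u x)"

text \<open>Classical solutions of the linearized Monge-Ampere equation
  \<open>U\<^sup>i\<^sup>j v\<^sub>i\<^sub>j = 0\<close> in the open set \<open>S\<close>.\<close>

definition solves_linearized_MA ::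
    "(real^'n::finite \<Rightarrow> real) \<Rightarrow> (real^'n \<Rightarrow> real) \<Rightarrow> (real^'n) set \<Rightarrow> bool" where
  "solves_linearized_MA u v S \<longleftrightarrow>
     Ck_on 2 v S \<and>
     (\<forall>x\<in>S. (\<Sum>i\<in>UNIV. \<Sum>j\<in>UNIV. cofactor_hessian u x $ i $ j * hessian v x $ i $ j) = 0)"

definition MA_section ::
    "(real^'n::finite) set \<Rightarrow> (real^'n \<Rightarrow> real) \<Rightarrow> real^'n \<Rightarrow> real \<Rightarrow> (real^'n) set" where
  "MA_section \<Omega> u x0 t = {x \<in> closure \<Omega>. u x < u x0 + gradient u x0 \<bullet> (x - x0) + t}"

definition local_defining_function ::
    "(real^'n::finite) set \<Rightarrow> real^'n \<Rightarrow> (real^'n) set \<Rightarrow> (real^'n \<Rightarrow> real) \<Rightarrow> bool" where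
  "local_defining_function \<Omega> p W \<rho> \<longleftrightarrow>
     open W \<and> p \<in> W \<and> smooth_on \<rho> W \<and> (\<forall>x\<in>W. gradient \<rho> x \<noteq> 0) \<and>
     \<Omega> \<inter> W = {x\<in>W. \<rho> x < 0}"

definition smooth_domain :: "(real^'n::finite) set \<Rightarrow> bool" where
  "smooth_domain \<Omega> \<longleftrightarrow>
     open \<Omega> \<and> connected \<Omega> \<and> \<Omega> \<noteq> {} \<and>
     (\<forall>p\<in>frontier \<Omega>. \<exists>W \<rho>. local_defining_function \<Omega> p W \<rho>)"

text \<open>Principal curvatures are the eigenvalues of the Weingarten map \<open>\<tau> \<mapsto> D\<nu>(p) \<tau>\<close> on the
  tangent space, where \<open>\<nu> = \<nabla>\<rho> / |\<nabla>\<rho>|\<close> extends the outward unit normal. On tangent vectors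
  \<open>D\<nu>(p)\<close> does not depend on the choice of \<open>\<rho>\<close>. The sign is such that spheres bounding balls
  have positive curvature.\<close>

definition principal_curvature :: "(real^'n::finite) set \<Rightarrow> real^'n \<Rightarrow> real \<Rightarrow> bool" where
  "principal_curvature \<Omega> p \<kappa> \<longleftrightarrow>
     (\<exists>W \<rho> \<tau>. local_defining_function \<Omega> p W \<rho> \<and> \<tau> \<noteq> 0 \<and> \<tau> \<bullet> gradient \<rho> p = 0 \<and>
        frechet_derivative (\<lambda>x. gradient \<rho> x /\<^sub>R norm (gradient \<rho> x)) (at p) \<tau> = \<kappa> *\<^sub>R \<tau>)"

definition uniformly_convex :: "(real^'n::finite) set \<Rightarrow> bool" where
  "uniformly_convex \<Omega> \<longleftrightarrow>
     convex \<Omega> \<and>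
     (\<exists>\<kappa>0>0. \<forall>p\<in>frontier \<Omega>. \<forall>\<kappa>. principal_curvature \<Omega> p \<kappa> \<longrightarrow> \<kappa>0 \<le> \<kappa>)"

definition compactly_contained :: "'a::topological_space set \<Rightarrow> 'a set \<Rightarrow> bool" where
  "compactly_contained V \<Omega> \<longleftrightarrow> compact (closure V) \<and> closure V \<subseteq> \<Omega>"

text \<open>\<open>|v(x)| = o(g(r))\<close> on \<open>\<partial>S\<^sub>u(0,r)\<close> as \<open>r \<rightarrow> 0\<close>, uniformly in \<open>x\<close>;
  \<open>S r\<close> stands for the section of height \<open>r\<close>.\<close>

definition small_o_on_boundaries ::
    "('a::topological_space \<Rightarrow> real) \<Rightarrow> (real \<Rightarrow> 'a set) \<Rightarrow> (real \<Rightarrow> real) \<Rightarrow> bool" where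
  "small_o_on_boundaries v S g \<longleftrightarrow>
     (\<forall>c>0. \<forall>\<^sub>F r in at_right 0. \<forall>x\<in>frontier (S r). \<bar>v x\<bar> \<le> c * \<bar>g r\<bar>)"

definition removable_singularity_at_0 ::
    "(real^'n::finite \<Rightarrow> real) \<Rightarrow> (real^'n \<Rightarrow> real) \<Rightarrow> (real^'n) set \<Rightarrow> bool" where
  "removable_singularity_at_0 u v S \<longleftrightarrow>
     (\<exists>w. solves_linearized_MA u w S \<and> (\<forall>x\<in>S - {0}. v x = w x))"

end

theory Submission
  imports Defs "HOL-Probability.Probability"
begin

text \<open>Near \<open>0\<close> the equation \<open>U\<^sup>i\<^sup>jv\<^sub>i\<^sub>j = 0\<close> is uniformly elliptic with smooth coefficients, and \<open>u\<close> minus its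
  tangent plane is comparable to \<open>|x|\<^sup>2\<close>, so the growth condition reads \<open>v = o(|x|\<^sup>2\<^sup>-\<^sup>n)\<close>, or \<open>v = o(|log |x||)\<close>
  if \<open>n = 2\<close>. With cutoffs around the puncture this makes \<open>v\<close> a weak solution across \<open>0\<close>: the integral of \<open>v\<close>
  times \<open>\<partial>\<^sub>i\<partial>\<^sub>j(U\<^sup>i\<^sup>j\<psi>)\<close> vanishes for every test function \<open>\<psi>\<close>. For \<open>n = 2\<close> this first holds if \<open>\<psi>(0) = 0\<close>; the
  remaining multiple of \<open>\<psi>(0)\<close> is excluded by testing with \<open>log(q + \<tau>\<^sup>2)/log \<tau>\<^sup>2\<close>, where \<open>q\<close> is the quadratic form
  of \<open>D\<^sup>2u(0)\<close>. Test functions \<open>e\<^sup>-\<^sup>i\<^sup>x\<^sup>\<xi>s(x,\<xi>)\<close> whose amplitudes invert the operator up to order \<open>|\<xi>|\<^sup>-\<^sup>N\<close> then show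
  that a localization of \<open>v\<close> has a rapidly decreasing Fourier transform; hence \<open>v\<close> extends to a \<open>C\<^sup>2\<close>
  function, which solves the equation at \<open>0\<close> by continuity.\<close>

section \<open>Integration on Euclidean space\<close>

text \<open>The growth rate is the critical one: a fundamental solution, of size |x|^(2-n) or |log
  |x||, solves the equation off 0, so the little o has to exclude exactly a Dirac mass at 0. Near
  the point D^2u is smooth and positive definite, so all constants may depend on \<open>u\<close>;
  the height r of a section enters only through r ~ |x|^2, which turns the exponent (2-n)/2 into
  2-n. In dimension two a cutoff at scale \<epsilon> leaves an error o(|log \<epsilon>|), which need
  not tend to 0. Subtracting \<psi>(0) times a bump reduces the loss to one scalar, the integral
  against the bump. Since the weak solution is only known to be integrable, regularity is read off
  its Fourier transform: an amplitude divided by the principal symbol and inserted into the weak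
  equation returns the amplitude plus an error of one order less, and this can be repeated. Fourier
  inversion is used only at points other than 0, where v is continuous.\<close>

lemma
  fixes f :: "'n::finite \<Rightarrow> real \<Rightarrow> 'b::{real_normed_field,banach,second_countable_topology}"
  assumes f: "\<And>i. integrable lborel (f i)"
  shows integrable_lborel_prod: "integrable lborel (\<lambda>x::real^'n. \<Prod>i\<in>UNIV. f i (x$i))"
    and integral_lborel_prod:
      "(LINT x|lborel. (\<Prod>i\<in>UNIV. f i ((x::real^'n)$i))) = (\<Prod>i\<in>UNIV. \<integral>t. f i t \<partial>lborel)"
proof -
  interpret product_sigma_finite "\<lambda>_::real^'n. lborel :: real measure"
    by standard
  \<comment> \<open>The product measure is indexed by \<open>Basis\<close>, the factors
    \<open>f i\<close> by \<open>'n\<close>; \<open>idx\<close> recovers \<open>i\<close> from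
    \<open>axis i 1\<close>.\<close>
  define idx where "idx b = (SOME i. b = (axis i 1 :: real^'n))" for b
  have idx: "idx (axis i 1) = i" for i
    unfolding idx_def by (rule some_equality) (auto simp: axis_eq_axis)
  have B: "(Basis :: (real^'n) set) = range (\<lambda>i. axis i 1)"
    by (auto simp: Basis_vec_def)
  have inj: "inj (\<lambda>i. axis i 1 :: real^'n)"
    by (auto simp: inj_on_def axis_eq_axis)
  have reindex: "(\<Prod>b\<in>Basis. g b) = (\<Prod>i\<in>UNIV. g (axis i 1))" for g :: "real^'n \<Rightarrow> 'b"
    unfolding B by (subst prod.reindex[OF inj]) simp
  let ?T = "\<lambda>y::real^'n \<Rightarrow> real. \<Sum>b\<in>Basis. y b *\<^sub>R b"
  have comp: "?T y $ i = y (axis i 1)" for y i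
  proof -
    have "?T y $ i = ?T y \<bullet> axis i 1" by (simp add: inner_axis)
    also have "\<dots> = y (axis i 1)"
      by (rule inner_sum_left_Basis) (simp add: axis_in_Basis_iff)
    finally show ?thesis .
  qed
  have T[measurable]: "?T \<in> measurable (\<Pi>\<^sub>M b\<in>Basis. lborel) borel"
    by measurable
  have [measurable]: "f i \<in> borel_measurable borel" for i
    using borel_measurable_integrable[OF f[of i]] by simp
  have g[measurable]: "(\<lambda>x::real^'n. \<Prod>i\<in>UNIV. f i (x$i)) \<in> borel_measurable borel"
    by measurable
  have eq: "(\<Prod>i\<in>UNIV. f i (?T y $ i)) = (\<Prod>b\<in>Basis. f (idx b) (y b))" for y
    unfolding comp reindex by (simp add: idx)
  show "integrable lborel (\<lambda>x::real^'n. \<Prod>i\<in>UNIV. f i (x$i))"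
    unfolding lborel_eq[where 'a="real^'n"]
    by (subst integrable_distr_eq[OF T g], subst eq, rule product_integrable_prod)
       (auto simp: f)
  have "(LINT x|lborel. (\<Prod>i\<in>UNIV. f i ((x::real^'n)$i)))
      = (\<integral>y. (\<Prod>b\<in>Basis. f (idx b) (y b)) \<partial>(\<Pi>\<^sub>M b\<in>Basis. lborel))"
    unfolding lborel_eq[where 'a="real^'n"]
    by (subst integral_distr[OF T g], subst eq) simp
  also have "\<dots> = (\<Prod>b\<in>Basis. \<integral>t. f (idx b) t \<partial>lborel)"
    by (rule product_integral_prod) (auto simp: f)
  also have "\<dots> = (\<Prod>i\<in>UNIV. \<integral>t. f i t \<partial>lborel)"
    unfolding reindex by (simp add: idx)
  finally show "(LINT x|lborel. (\<Prod>i\<in>UNIV. f i ((x::real^'n)$i))) = (\<Prod>i\<in>UNIV. \<integral>t. f i t \<partial>lborel)" .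
qed

lemma
  fixes f :: "'a::euclidean_space \<Rightarrow> 'b::{banach, second_countable_topology}"
  assumes f: "integrable lborel f"
  shows integrable_lborel_translate: "integrable lborel (\<lambda>x. f (c + x))"
    and integral_lborel_translate: "(\<integral>x. f (c + x) \<partial>lborel) = (\<integral>x. f x \<partial>lborel)"
proof -
  have [measurable]: "f \<in> borel_measurable borel"
    using borel_measurable_integrable[OF f] by simp
  have T: "(+) c \<in> measurable lborel borel" by simp
  show "integrable lborel (\<lambda>x. f (c + x))"
    using f integrable_distr_eq[OF T, of f] by (simp add: lborel_distr_plus)
  show "(\<integral>x. f (c + x) \<partial>lborel) = (\<integral>x. f x \<partial>lborel)"
    using integral_distr[OF T, of f] by (simp add: lborel_distr_plus)
qed

lemma integrable_lborel_compact_support: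
  fixes f :: "'a::euclidean_space \<Rightarrow> 'b::{banach, second_countable_topology}"
  assumes "compact K" "continuous_on K f" "\<And>x. x \<notin> K \<Longrightarrow> f x = 0"
  shows "integrable lborel f"
proof -
  have "(\<lambda>x. indicator K x *\<^sub>R f x) = f"
    using assms(3) by (auto simp: fun_eq_iff indicator_def)
  then show ?thesis
    using borel_integrable_compact[OF assms(1,2)] by simp
qed

text \<open>Translation invariance makes the integral of every difference quotient vanish.\<close>

lemma integral_derivative_compact_support:
  fixes f :: "'a::euclidean_space \<Rightarrow> 'b::euclidean_space"
  assumes D: "open D" and K: "compact K" "K \<subseteq> D"
    and f0: "\<And>x. x \<notin> K \<Longrightarrow> f x = 0" and g0: "\<And>x. x \<notin> D \<Longrightarrow> g x = 0"
    and deriv: "\<And>x. x \<in> D \<Longrightarrow> (f has_derivative f' x) (at x)"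
    and g: "\<And>x. x \<in> D \<Longrightarrow> g x = f' x e" and cont: "continuous_on D g"
  shows "integrable lborel g" "(\<integral>x. g x \<partial>lborel) = 0"
proof -
  have derivK: "(f has_derivative (\<lambda>_. 0)) (at x)" if "x \<notin> K" for x
  proof (rule has_derivative_transform_within_open)
    show "((\<lambda>_. 0) has_derivative (\<lambda>_. 0)) (at x)" by simp
    show "open (- K)" using K(1) by (simp add: compact_imp_closed open_Compl)
  qed (use that f0 in auto)
  have gK: "g x = 0" if "x \<notin> K" for x
  proof (cases "x \<in> D")
    case True
    then show ?thesis
      using has_derivative_unique[OF derivK[OF that] deriv[OF True]] g by metis
  qed (use g0 in simp)
  \<comment> \<open>Along lines in direction \<open>e\<close> the function is differentiable
    everywhere: in \<open>D\<close> by hypothesis, off \<open>K\<close> because it vanishes near the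
    point.\<close>
  have dir: "((\<lambda>t. f (x + t *\<^sub>R e)) has_vector_derivative g (x + t *\<^sub>R e)) (at t)" for x t
  proof -
    obtain F where F: "(f has_derivative F) (at (x + t *\<^sub>R e))" "F e = g (x + t *\<^sub>R e)"
      using deriv[of "x + t *\<^sub>R e"] derivK[of "x + t *\<^sub>R e"] gK[of "x + t *\<^sub>R e"] g[of "x + t *\<^sub>R e"] K(2)
      by (cases "x + t *\<^sub>R e \<in> K") auto
    have "((\<lambda>t. x + t *\<^sub>R e) has_derivative (\<lambda>h. h *\<^sub>R e)) (at t)"
      by (auto intro!: derivative_eq_intros)
    from has_derivative_compose[OF this F(1)]
    have "((\<lambda>t. f (x + t *\<^sub>R e)) has_derivative (\<lambda>h. F (h *\<^sub>R e))) (at t)" .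
    moreover have "F (h *\<^sub>R e) = h *\<^sub>R g (x + t *\<^sub>R e)" for h
      using has_derivative_linear[OF F(1)] F(2) by (simp add: linear_cmul)
    ultimately show ?thesis by (simp add: has_vector_derivative_def)
  qed
  have contK: "continuous_on K g" using continuous_on_subset[OF cont K(2)] .
  have "bounded (g ` K)"
    by (rule compact_imp_bounded[OF compact_continuous_image[OF contK K(1)]])
  then obtain M where M: "M > 0" "\<And>x. x \<in> K \<Longrightarrow> norm (g x) \<le> M"
    unfolding bounded_pos by blast
  have Mg: "norm (g x) \<le> M" for x
    using M gK[of x] by (cases "x \<in> K") auto
  show int_g: "integrable lborel g"
    by (rule integrable_lborel_compact_support[OF K(1) contK gK])
  have "continuous_on K f"
    by (rule continuous_at_imp_continuous_on) (use K(2) deriv has_derivative_continuous in blast)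
  then have int_f: "integrable lborel f"
    using K(1) f0 by (intro integrable_lborel_compact_support[of K])
  have [measurable]: "f \<in> borel_measurable borel" "g \<in> borel_measurable borel"
    using borel_measurable_integrable[OF int_f] borel_measurable_integrable[OF int_g] by auto
  define q where "q n x = (real (Suc n)) *\<^sub>R (f (inverse (real (Suc n)) *\<^sub>R e + x) - f x)" for n x
  have q0: "(\<integral>x. q n x \<partial>lborel) = 0" for n
    unfolding q_def
    using integrable_lborel_translate[OF int_f] integral_lborel_translate[OF int_f] int_f
    by (simp add: Bochner_Integration.integral_diff del: of_nat_Suc)
  \<comment> \<open>All steps \<open>1 / (n + 1)\<close> are at most 1, so every difference quotient
    is supported in \<open>K\<close> minus the segment from 0 to \<open>e\<close>; the constant
    \<open>M\<close> on this compact set is the dominating function.\<close>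
  define K' where "K' = {x - y |x y. x \<in> K \<and> y \<in> (\<lambda>t. t *\<^sub>R e) ` {0..1::real}}"
  have "compact K'"
    unfolding K'_def by (intro compact_differences K compact_continuous_image) (auto intro!: continuous_intros)
  have q_le: "norm (q n x) \<le> indicator K' x * M" for n x
  proof -
    define t where "t = inverse (real (Suc n))"
    have t: "0 < t" "t \<le> 1" by (auto simp: t_def field_simps)
    have "\<exists>s\<in>{0<..<t}. norm (f (x + t *\<^sub>R e) - f (x + 0 *\<^sub>R e)) \<le> norm ((t - 0) *\<^sub>R g (x + s *\<^sub>R e))"
    proof (rule mvt_general[OF t(1)])
      show "((\<lambda>s. f (x + s *\<^sub>R e)) has_derivative (\<lambda>h. h *\<^sub>R g (x + s *\<^sub>R e))) (at s)" for s
        using dir[of x s] by (simp add: has_vector_derivative_def)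
      then show "continuous_on {0..t} (\<lambda>s. f (x + s *\<^sub>R e))"
        by (intro continuous_at_imp_continuous_on ballI) (rule has_derivative_continuous)
    qed
    then obtain s where s: "0 < s" "s < t" "norm (f (x + t *\<^sub>R e) - f x) \<le> t * norm (g (x + s *\<^sub>R e))"
      using t by auto
    have q: "q n x = inverse t *\<^sub>R (f (x + t *\<^sub>R e) - f x)"
      by (simp add: q_def t_def add.commute)
    have q_le: "norm (q n x) \<le> norm (g (x + s *\<^sub>R e))"
    proof -
      have "norm (q n x) = inverse t * norm (f (x + t *\<^sub>R e) - f x)" using t by (simp add: q)
      also have "\<dots> \<le> inverse t * (t * norm (g (x + s *\<^sub>R e)))"
        using s t by (intro mult_left_mono) auto
      also have "\<dots> = norm (g (x + s *\<^sub>R e))" using t by (simp add: mult.assoc[symmetric])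
      finally show ?thesis .
    qed
    show ?thesis
    proof (cases "x + s *\<^sub>R e \<in> K")
      case True
      moreover have "s *\<^sub>R e \<in> (\<lambda>t. t *\<^sub>R e) ` {0..1::real}" using s t by auto
      moreover have "x = (x + s *\<^sub>R e) - s *\<^sub>R e" by simp
      ultimately have "x \<in> K'" unfolding K'_def by blast
      then show ?thesis using q_le Mg[of "x + s *\<^sub>R e"] by simp
    next
      case False
      then have "norm (q n x) \<le> 0" using q_le gK by simp
      also have "0 \<le> indicator K' x * M" using M by simp
      finally show ?thesis .
    qed
  qed
  have lim: "(\<lambda>n. q n x) \<longlonglongrightarrow> g x" for x
  proof -
    have "((\<lambda>t. f (x + t *\<^sub>R e)) has_vector_derivative g x) (at 0)"
      using dir[of x 0] by simp
    then have "((\<lambda>t. inverse t *\<^sub>R (f (x + t *\<^sub>R e) - f x)) \<longlongrightarrow> g x) (at 0)"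
      unfolding has_vector_derivative_def has_derivative_iff_norm
    proof (elim conjE)
      assume *: "((\<lambda>t. norm (f (x + t *\<^sub>R e) - f (x + 0 *\<^sub>R e) - (t - 0) *\<^sub>R g x) / norm (t - 0)) \<longlongrightarrow> 0) (at 0)"
      have "norm (f (x + t *\<^sub>R e) - f (x + 0 *\<^sub>R e) - (t - 0) *\<^sub>R g x) / norm (t - 0)
          = norm (inverse t *\<^sub>R (f (x + t *\<^sub>R e) - f x) - g x)" if "t \<noteq> 0" for t
      proof -
        have "inverse t *\<^sub>R (f (x + t *\<^sub>R e) - f x) - g x = inverse t *\<^sub>R (f (x + t *\<^sub>R e) - f x - t *\<^sub>R g x)"
          using that by (simp add: scaleR_diff_right)
        then show ?thesis by (simp add: divide_inverse_commute)
      qed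
      then have "((\<lambda>t. norm (inverse t *\<^sub>R (f (x + t *\<^sub>R e) - f x) - g x)) \<longlongrightarrow> 0) (at 0)"
        by (intro Lim_transform_eventually[OF *]) (auto simp: eventually_at_filter)
      then show ?thesis
        by (rule LIM_zero_cancel[OF tendsto_norm_zero_cancel])
    qed
    moreover have "filterlim (\<lambda>n. inverse (real (Suc n))) (at 0) sequentially"
      unfolding filterlim_at by (intro conjI LIMSEQ_inverse_real_of_nat always_eventually) simp
    ultimately have "(\<lambda>n. inverse (inverse (real (Suc n))) *\<^sub>R (f (x + inverse (real (Suc n)) *\<^sub>R e) - f x)) \<longlonglongrightarrow> g x"
      by (rule filterlim_compose)
    then show ?thesis by (simp add: q_def add.commute del: of_nat_Suc)
  qed
  have "(\<lambda>n. \<integral>x. q n x \<partial>lborel) \<longlonglongrightarrow> (\<integral>x. g x \<partial>lborel)"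
  proof (rule integral_dominated_convergence[where w="\<lambda>x. indicator K' x * M"])
    show "integrable lborel (\<lambda>x. indicator K' x * M)"
      using borel_integrable_compact[OF \<open>compact K'\<close>, of "\<lambda>_. M"] by (simp add: continuous_on_const)
    show "q n \<in> borel_measurable lborel" for n
      unfolding q_def by measurable
    show "AE x in lborel. (\<lambda>n. q n x) \<longlonglongrightarrow> g x" by (rule AE_I2) (rule lim)
    show "AE x in lborel. norm (q n x) \<le> indicator K' x * M" for n by (rule AE_I2) (rule q_le)
  qed simp
  then show "(\<integral>x. g x \<partial>lborel) = 0"
    unfolding q0 by (simp add: LIMSEQ_const_iff)
qed

section \<open>Functions with partial derivatives\<close>

text \<open>A Frechet derivative recorded by its coordinates, not the mere existence of partial
  derivatives, so that product and chain rules hold. Indexing by coordinates lets second derivatives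
  be families of functions again.\<close>

definition has_partials :: "(real^'n \<Rightarrow> 'b::real_normed_vector) \<Rightarrow> ('n::finite \<Rightarrow> 'b) \<Rightarrow> real^'n \<Rightarrow> bool" where
  "has_partials f g x \<longleftrightarrow> (f has_derivative (\<lambda>h. \<Sum>l\<in>UNIV. (h$l) *\<^sub>R g l)) (at x)"

lemma has_partials_continuous: "has_partials f g x \<Longrightarrow> isCont f x"
  unfolding has_partials_def by (rule has_derivative_continuous)

lemma has_partials_const: "has_partials (\<lambda>_. c) (\<lambda>_. 0) x"
  unfolding has_partials_def by simp

lemma has_partials_component: "has_partials (\<lambda>x. x $ i) (\<lambda>l. if l = i then 1 else 0) x"
  unfolding has_partials_def by (auto intro!: bounded_linear_imp_has_derivative bounded_linear_vec_nth simp: if_distrib cong: if_cong)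

lemma has_partials_add:
  "has_partials f f1 x \<Longrightarrow> has_partials g g1 x \<Longrightarrow> has_partials (\<lambda>x. f x + g x) (\<lambda>l. f1 l + g1 l) x"
  unfolding has_partials_def
  by (auto intro!: derivative_eq_intros simp: scaleR_add_right sum.distrib)

lemma has_partials_minus:
  "has_partials f f1 x \<Longrightarrow> has_partials (\<lambda>x. - f x) (\<lambda>l. - f1 l) x"
  unfolding has_partials_def
  by (auto intro!: derivative_eq_intros simp: sum_negf)

lemma has_partials_diff:
  "has_partials f f1 x \<Longrightarrow> has_partials g g1 x \<Longrightarrow> has_partials (\<lambda>x. f x - g x) (\<lambda>l. f1 l - g1 l) x"
  unfolding has_partials_def
  by (auto intro!: derivative_eq_intros simp: scaleR_diff_right sum_subtractf)

lemma has_partials_sum: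
  "(\<And>i. i \<in> I \<Longrightarrow> has_partials (f i) (f1 i) x) \<Longrightarrow> has_partials (\<lambda>x. \<Sum>i\<in>I. f i x) (\<lambda>l. \<Sum>i\<in>I. f1 i l) x"
  unfolding has_partials_def scaleR_sum_right
  by (subst sum.swap) (auto intro!: derivative_intros)

lemma has_partials_bilinear:
  assumes "bounded_bilinear pr" "has_partials f f1 x" "has_partials g g1 x"
  shows "has_partials (\<lambda>x. pr (f x) (g x)) (\<lambda>l. pr (f x) (g1 l) + pr (f1 l) (g x)) x"
proof -
  interpret bounded_bilinear pr by fact
  show ?thesis
    using FDERIV[OF assms(2,3)[unfolded has_partials_def]]
    unfolding has_partials_def
    by (simp add: sum_left sum_right scaleR_left scaleR_right scaleR_add_right sum.distrib)
qed

lemmas has_partials_scaleR = has_partials_bilinear[OF bounded_bilinear_scaleR]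
lemmas has_partials_mult = has_partials_bilinear[OF bounded_bilinear_mult]

lemma has_partials_linear:
  assumes "bounded_linear L" "has_partials f f1 x"
  shows "has_partials (\<lambda>x. L (f x)) (\<lambda>l. L (f1 l)) x"
proof -
  interpret bounded_linear L by fact
  show ?thesis
    using bounded_linear.has_derivative[OF assms(1) assms(2)[unfolded has_partials_def]]
    unfolding has_partials_def by (simp add: sum scaleR)
qed

lemma has_partials_chain:
  fixes f :: "real^'n::finite \<Rightarrow> real"
  assumes "has_partials f f1 x" "(\<phi> has_vector_derivative d) (at (f x))"
  shows "has_partials (\<lambda>x. \<phi> (f x)) (\<lambda>l. f1 l *\<^sub>R d) x"
  using has_derivative_compose[OF assms(1)[unfolded has_partials_def] assms(2)[unfolded has_vector_derivative_def]]
  unfolding has_partials_def by (simp add: scaleR_sum_left)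

lemma has_partials_inverse:
  fixes f :: "real^'n::finite \<Rightarrow> real"
  assumes "has_partials f f1 x" "f x \<noteq> 0"
  shows "has_partials (\<lambda>x. inverse (f x)) (\<lambda>l. - (f1 l * (inverse (f x) * inverse (f x)))) x"
proof -
  have "(inverse has_vector_derivative (- (inverse (f x) * inverse (f x)))) (at (f x))"
    using DERIV_inverse[OF assms(2)] by (simp add: has_real_derivative_iff_has_vector_derivative power2_eq_square)
  from has_partials_chain[OF assms(1) this] show ?thesis by simp
qed

lemma has_partials_transform:
  assumes "has_partials f f1 x" "open S" "x \<in> S" "\<And>y. y \<in> S \<Longrightarrow> f y = g y"
  shows "has_partials g f1 x"
  using assms(1) unfolding has_partials_def
  by (rule has_derivative_transform_within_open[OF _ assms(2,3,4)])

lemma has_partials_apply: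
  assumes "has_partials f g x"
  shows "frechet_derivative f (at x) (axis l 1) = g l"
proof -
  have "frechet_derivative f (at x) = (\<lambda>h. \<Sum>l\<in>UNIV. (h$l) *\<^sub>R g l)"
    by (rule frechet_derivative_at[OF assms[unfolded has_partials_def], symmetric])
  then show ?thesis
    by (simp add: axis_def if_distrib[where f="\<lambda>c. c *\<^sub>R _"] cong: if_cong)
qed

lemma has_partials_unique:
  assumes "has_partials f g x" "has_partials f h x"
  shows "g l = h l"
  using has_partials_apply[OF assms(1)] has_partials_apply[OF assms(2)] by metis

lemma vec_axis_expansion: "(h::real^'n::finite) = (\<Sum>l\<in>UNIV. (h$l) *\<^sub>R axis l 1)"
  using basis_expansion[of h] by (simp add: scalar_mult_eq_scaleR)

lemma differentiable_has_partials:
  fixes f :: "real^'n::finite \<Rightarrow> 'b::real_normed_vector"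
  assumes "f differentiable (at x)"
  shows "has_partials f (\<lambda>l. frechet_derivative f (at x) (axis l 1)) x"
proof -
  let ?F = "frechet_derivative f (at x)"
  have F: "(f has_derivative ?F) (at x)" using assms frechet_derivative_works by blast
  then have lin: "linear ?F" by (rule has_derivative_linear)
  have "?F h = (\<Sum>l\<in>UNIV. (h$l) *\<^sub>R ?F (axis l 1))" for h
  proof -
    have "?F h = ?F (\<Sum>l\<in>UNIV. (h$l) *\<^sub>R axis l 1)"
      by (rule arg_cong[OF vec_axis_expansion])
    also have "\<dots> = (\<Sum>l\<in>UNIV. (h$l) *\<^sub>R ?F (axis l 1))"
      by (simp add: linear_sum[OF lin] linear_cmul[OF lin])
    finally show ?thesis .
  qed
  then show ?thesis
    unfolding has_partials_def by (intro has_derivative_eq_rhs[OF F] ext)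
qed

lemma has_partials_zero_outside:
  assumes "closed K" "\<And>x. x \<notin> K \<Longrightarrow> f x = 0" "x \<notin> K" "has_partials f g x"
  shows "g l = 0"
proof -
  have "has_partials f (\<lambda>_. 0) x"
    by (rule has_partials_transform[OF has_partials_const[of 0], of "- K"]) (use assms in auto)
  then show ?thesis using has_partials_unique[OF assms(4)] by metis
qed

lemma integral_partial_compact_support:
  fixes f :: "real^'n::finite \<Rightarrow> 'b::euclidean_space"
  assumes D: "open D" and K: "compact K" "K \<subseteq> D"
    and f0: "\<And>x. x \<notin> K \<Longrightarrow> f x = 0" and g0: "\<And>x. x \<notin> D \<Longrightarrow> g x = 0"
    and deriv: "\<And>x. x \<in> D \<Longrightarrow> has_partials f (f1 x) x"
    and g: "\<And>x. x \<in> D \<Longrightarrow> g x = f1 x l" and cont: "continuous_on D g"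
  shows "integrable lborel g" "(\<integral>x. g x \<partial>lborel) = 0"
proof -
  have der: "(f has_derivative (\<lambda>h. \<Sum>l\<in>UNIV. (h$l) *\<^sub>R f1 x l)) (at x)" if "x \<in> D" for x
    using deriv[OF that] by (simp add: has_partials_def)
  have *: "g x = (\<Sum>k\<in>UNIV. (axis l 1 $ k) *\<^sub>R f1 x k)" if "x \<in> D" for x
    using g[OF that] by (simp add: axis_def if_distrib[where f="\<lambda>c. c *\<^sub>R _"] cong: if_cong)
  show "integrable lborel g" "(\<integral>x. g x \<partial>lborel) = 0"
    by (rule integral_derivative_compact_support[OF D K f0 g0 der * cont]; assumption)+
qed

text \<open>In \<open>hasC2 D f f1 f2\<close> the function \<open>f2 l m\<close> is \<open>\<partial>\<^sub>m\<partial>\<^sub>lf\<close>, with the inner derivative first.\<close>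

definition hasC2 :: "(real^'n) set \<Rightarrow> (real^'n \<Rightarrow> 'b::real_normed_vector) \<Rightarrow> ('n::finite \<Rightarrow> real^'n \<Rightarrow> 'b)
    \<Rightarrow> ('n \<Rightarrow> 'n \<Rightarrow> real^'n \<Rightarrow> 'b) \<Rightarrow> bool" where
  "hasC2 D f f1 f2 \<longleftrightarrow>
     (\<forall>x\<in>D. has_partials f (\<lambda>l. f1 l x) x \<and> (\<forall>l. has_partials (f1 l) (\<lambda>m. f2 l m x) x)) \<and>
     (\<forall>l m. continuous_on D (f2 l m))"

lemma hasC2D:
  assumes "hasC2 D f f1 f2"
  shows "x \<in> D \<Longrightarrow> has_partials f (\<lambda>l. f1 l x) x"
    "x \<in> D \<Longrightarrow> has_partials (f1 l) (\<lambda>m. f2 l m x) x"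
    "continuous_on D f" "continuous_on D (f1 l)" "continuous_on D (f2 l m)"
  using assms by (auto simp: hasC2_def intro!: continuous_at_imp_continuous_on dest: has_partials_continuous)

lemma hasC2_subset: "hasC2 D f f1 f2 \<Longrightarrow> E \<subseteq> D \<Longrightarrow> hasC2 E f f1 f2"
  unfolding hasC2_def by (meson continuous_on_subset subsetD)

lemma hasC2_scaleR:
  assumes f: "hasC2 D f f1 f2" and g: "hasC2 D g g1 g2"
  shows "hasC2 D (\<lambda>x. f x *\<^sub>R g x) (\<lambda>l x. f x *\<^sub>R g1 l x + f1 l x *\<^sub>R g x)
    (\<lambda>l m x. f x *\<^sub>R g2 l m x + f1 m x *\<^sub>R g1 l x + (f1 l x *\<^sub>R g1 m x + f2 l m x *\<^sub>R g x))"
  unfolding hasC2_def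
  by (auto intro!: has_partials_scaleR has_partials_add continuous_intros hasC2D[OF f] hasC2D[OF g])

lemma hasC2_add:
  assumes f: "hasC2 D f f1 f2" and g: "hasC2 D g g1 g2"
  shows "hasC2 D (\<lambda>x. f x + g x) (\<lambda>l x. f1 l x + g1 l x) (\<lambda>l m x. f2 l m x + g2 l m x)"
  unfolding hasC2_def
  by (auto intro!: has_partials_add continuous_intros hasC2D[OF f] hasC2D[OF g])

lemma hasC2_chain:
  fixes f :: "real^'n::finite \<Rightarrow> real" and \<phi> :: "real \<Rightarrow> real"
  assumes f: "hasC2 D f f1 f2"
    and \<phi>: "\<And>x. x \<in> D \<Longrightarrow> (\<phi> has_real_derivative \<phi>1 (f x)) (at (f x))"
      "\<And>x. x \<in> D \<Longrightarrow> (\<phi>1 has_real_derivative \<phi>2 (f x)) (at (f x))"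
      "continuous_on (f ` D) \<phi>2"
  shows "hasC2 D (\<lambda>x. \<phi> (f x)) (\<lambda>l x. f1 l x * \<phi>1 (f x))
    (\<lambda>l m x. f1 l x * (f1 m x * \<phi>2 (f x)) + f2 l m x * \<phi>1 (f x))"
proof -
  have 1: "has_partials (\<lambda>x. \<phi> (f x)) (\<lambda>l. f1 l x * \<phi>1 (f x)) x"
    "has_partials (\<lambda>x. \<phi>1 (f x)) (\<lambda>l. f1 l x * \<phi>2 (f x)) x" if "x \<in> D" for x
    using has_partials_chain[OF hasC2D(1)[OF f that] has_real_derivative_iff_has_vector_derivative[THEN iffD1, OF \<phi>(1)[OF that]]]
      has_partials_chain[OF hasC2D(1)[OF f that] has_real_derivative_iff_has_vector_derivative[THEN iffD1, OF \<phi>(2)[OF that]]]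
    by simp_all
  have "continuous_on D (\<lambda>x. \<phi>2 (f x))"
    using continuous_on_compose2[OF \<phi>(3) hasC2D(3)[OF f]] by simp
  moreover have "continuous_on D (\<lambda>x. \<phi>1 (f x))"
    using 1(2) by (meson continuous_at_imp_continuous_on has_partials_continuous)
  ultimately show ?thesis
    unfolding hasC2_def
    by (auto intro!: 1 has_partials_mult hasC2D[OF f] continuous_intros)
qed

lemma hasC2_zero_outside:
  assumes "hasC2 D f f1 f2" "open D" "closed K" "\<And>x. x \<notin> K \<Longrightarrow> f x = 0" "x \<in> D" "x \<notin> K"
  shows "f1 l x = 0" "f2 l m x = 0"
proof -
  have *: "f1 l y = 0" if "y \<in> D - K" for y l
    using has_partials_zero_outside[OF assms(3,4) _ hasC2D(1)[OF assms(1)]] that by auto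
  then show "f1 l x = 0" using assms by auto
  have "has_partials (f1 l) (\<lambda>_. 0) x"
    by (rule has_partials_transform[OF has_partials_const[of 0], of "D - K"]) (use * assms in auto)
  then show "f2 l m x = 0"
    using has_partials_unique[OF hasC2D(2)[OF assms(1,5)]] by metis
qed

section \<open>Closure properties of \<open>Ck_on\<close> and \<open>smooth_on\<close>\<close>

lemma frechet_derivative_cong_open:
  assumes "open S" "x \<in> S" "\<And>y. y \<in> S \<Longrightarrow> f y = g y"
  shows "frechet_derivative f (at x) = frechet_derivative g (at x)"
    "f differentiable (at x) \<Longrightarrow> g differentiable (at x)"
proof -
  have "(f has_derivative F) (at x) \<longleftrightarrow> (g has_derivative F) (at x)" for F
    using has_derivative_transform_within_open[OF _ assms(1,2), of f F UNIV g]
      has_derivative_transform_within_open[OF _ assms(1,2), of g F UNIV f] assms(3) by auto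
  then show "frechet_derivative f (at x) = frechet_derivative g (at x)"
    "f differentiable (at x) \<Longrightarrow> g differentiable (at x)"
    by (simp_all add: frechet_derivative_def differentiable_def)
qed

lemma Ck_on_cong:
  assumes "open S" "\<And>x. x \<in> S \<Longrightarrow> f x = g x" "Ck_on k f S"
  shows "Ck_on k g S"
  using assms(2,3)
proof (induction k arbitrary: f g)
  case 0
  then show ?case using continuous_on_cong by force
next
  case (Suc k)
  have "frechet_derivative f (at x) h = frechet_derivative g (at x) h" if "x \<in> S" for x h
    using frechet_derivative_cong_open(1)[OF assms(1) that Suc.prems(1)] by simp
  moreover have "g differentiable (at x)" if "x \<in> S" for x
    using frechet_derivative_cong_open(2)[OF assms(1) that Suc.prems(1)] Suc.prems(2) that by auto
  ultimately show ?case
    using Suc.prems(2) Suc.IH[of "\<lambda>x. frechet_derivative f (at x) h" "\<lambda>x. frechet_derivative g (at x) h" for h]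
    by simp
qed

lemma Ck_on_subset: "Ck_on k f S \<Longrightarrow> T \<subseteq> S \<Longrightarrow> Ck_on k f T"
  by (induction k arbitrary: f) (auto intro: continuous_on_subset)

lemma Ck_on_Suc_imp: "Ck_on (Suc k) f S \<Longrightarrow> Ck_on k f S"
proof (induction k arbitrary: f)
  case 0
  then show ?case
    by (auto intro!: continuous_at_imp_continuous_on differentiable_imp_continuous_within)
next
  case (Suc k)
  then show ?case by simp
qed

text \<open>Differentiability is pointwise and continuity is local on open sets. This glues
  \<open>v\<close> off the puncture to its extension near the puncture.\<close>

lemma Ck_on_Un:
  assumes "open S" "open T" "Ck_on k f S" "Ck_on k f T"
  shows "Ck_on k f (S \<union> T)"
  using assms(3,4) by (induction k arbitrary: f) (auto intro: continuous_on_open_Un assms(1,2))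

lemma Ck_on_const: "Ck_on k (\<lambda>_. c) S"
  by (induction k arbitrary: c) (auto simp: frechet_derivative_const)

lemma Ck_on_linear:
  assumes "bounded_linear f" shows "Ck_on k f S"
proof (cases k)
  case 0
  then show ?thesis using assms by (simp add: linear_continuous_on)
next
  case (Suc j)
  have "(f has_derivative f) (at x)" for x
    using assms by (rule bounded_linear_imp_has_derivative)
  then have "f differentiable (at x)" "frechet_derivative f (at x) = f" for x
    using frechet_derivative_at[symmetric] by (auto simp: differentiable_def)
  then show ?thesis using Suc by (simp add: Ck_on_const)
qed

lemma Ck_on_add:
  assumes "open S" "Ck_on k f S" "Ck_on k g S"
  shows "Ck_on k (\<lambda>x. f x + g x) S"
  using assms(2,3)
proof (induction k arbitrary: f g)
  case 0
  then show ?case by (auto intro: continuous_intros)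
next
  case (Suc k)
  have der: "((\<lambda>x. f x + g x) has_derivative
      (\<lambda>h. frechet_derivative f (at x) h + frechet_derivative g (at x) h)) (at x)"
    if "x \<in> S" for x
    using Suc.prems that by (intro has_derivative_add iffD1[OF frechet_derivative_works]) auto
  note eq = frechet_derivative_at[OF der, symmetric]
  have "Ck_on k (\<lambda>x. frechet_derivative (\<lambda>x. f x + g x) (at x) h) S" for h
  proof (rule Ck_on_cong[OF assms(1)])
    show "Ck_on k (\<lambda>x. frechet_derivative f (at x) h + frechet_derivative g (at x) h) S"
      using Suc.prems by (intro Suc.IH) auto
  qed (simp add: eq)
  then show ?case using der by (auto simp: differentiable_def)
qed

lemma Ck_on_bilinear:
  assumes "bounded_bilinear pr" "open S" "Ck_on k f S" "Ck_on k g S"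
  shows "Ck_on k (\<lambda>x. pr (f x) (g x)) S"
  using assms(3,4)
proof (induction k arbitrary: f g)
  case 0
  then show ?case using bounded_bilinear.continuous_on[OF assms(1)] by auto
next
  case (Suc k)
  have der: "((\<lambda>x. pr (f x) (g x)) has_derivative
      (\<lambda>h. pr (f x) (frechet_derivative g (at x) h) + pr (frechet_derivative f (at x) h) (g x))) (at x)"
    if "x \<in> S" for x
    using Suc.prems that by (intro bounded_bilinear.FDERIV[OF assms(1)] iffD1[OF frechet_derivative_works]) auto
  note eq = frechet_derivative_at[OF der, symmetric]
  have "Ck_on k (\<lambda>x. frechet_derivative (\<lambda>x. pr (f x) (g x)) (at x) h) S" for h
  proof (rule Ck_on_cong[OF assms(2)])
    show "Ck_on k (\<lambda>x. pr (f x) (frechet_derivative g (at x) h) + pr (frechet_derivative f (at x) h) (g x)) S"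
      using Suc.prems Ck_on_Suc_imp[OF Suc.prems(1)] Ck_on_Suc_imp[OF Suc.prems(2)]
      by (intro Ck_on_add assms(2) Suc.IH) auto
  qed (simp add: eq)
  then show ?case using der by (auto simp: differentiable_def)
qed

lemma Ck_on_compose_linear:
  assumes "bounded_linear L" "open S" "Ck_on k f S"
  shows "Ck_on k (\<lambda>x. L (f x)) S"
proof -
  interpret bounded_linear L by fact
  \<comment> \<open>A linear map is a bilinear one whose first argument is the constant 1, so no
    separate induction is needed.\<close>
  have "bounded_bilinear (\<lambda>(c::real) y. c *\<^sub>R L y)"
    by (rule bounded_bilinear.comp[OF bounded_bilinear_scaleR bounded_linear_ident assms(1)])
  from Ck_on_bilinear[OF this assms(2) Ck_on_const[of _ 1] assms(3)] show ?thesis by simp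
qed

lemma smooth_on_Ck: "smooth_on f S \<Longrightarrow> Ck_on k f S"
  by (simp add: smooth_on_def)

lemma smooth_on_cong:
  "open S \<Longrightarrow> (\<And>x. x \<in> S \<Longrightarrow> f x = g x) \<Longrightarrow> smooth_on f S \<Longrightarrow> smooth_on g S"
  unfolding smooth_on_def using Ck_on_cong by blast

lemma smooth_on_subset: "smooth_on f S \<Longrightarrow> T \<subseteq> S \<Longrightarrow> smooth_on f T"
  unfolding smooth_on_def using Ck_on_subset by blast

lemma smooth_on_const: "smooth_on (\<lambda>_. c) S"
  by (simp add: smooth_on_def Ck_on_const)

lemma smooth_on_add: "open S \<Longrightarrow> smooth_on f S \<Longrightarrow> smooth_on g S \<Longrightarrow> smooth_on (\<lambda>x. f x + g x) S"
  by (simp add: smooth_on_def Ck_on_add)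

lemma smooth_on_mult:
  fixes f :: "'a::real_normed_vector \<Rightarrow> 'b::real_normed_algebra"
  shows "open S \<Longrightarrow> smooth_on f S \<Longrightarrow> smooth_on g S \<Longrightarrow> smooth_on (\<lambda>x. f x * g x) S"
  by (simp add: smooth_on_def Ck_on_bilinear[OF bounded_bilinear_mult])

lemma smooth_on_compose_linear: "bounded_linear L \<Longrightarrow> open S \<Longrightarrow> smooth_on f S \<Longrightarrow> smooth_on (\<lambda>x. L (f x)) S"
  by (simp add: smooth_on_def Ck_on_compose_linear)

lemma smooth_on_sum:
  "open S \<Longrightarrow> (\<And>i. i \<in> I \<Longrightarrow> smooth_on (f i) S) \<Longrightarrow> smooth_on (\<lambda>x. \<Sum>i\<in>I. f i x) S"
  by (induction I rule: infinite_finite_induct) (auto intro: smooth_on_add smooth_on_const)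

lemma smooth_on_prod:
  fixes f :: "'i \<Rightarrow> 'a::real_normed_vector \<Rightarrow> 'b::{real_normed_algebra,comm_ring_1}"
  shows "open S \<Longrightarrow> (\<And>i. i \<in> I \<Longrightarrow> smooth_on (f i) S) \<Longrightarrow> smooth_on (\<lambda>x. \<Prod>i\<in>I. f i x) S"
  by (induction I rule: infinite_finite_induct) (auto intro: smooth_on_mult smooth_on_const)

lemma smooth_on_frechet_derivative: "smooth_on f S \<Longrightarrow> smooth_on (\<lambda>x. frechet_derivative f (at x) h) S"
  unfolding smooth_on_def by (metis Ck_on.simps(2))

lemma smooth_on_differentiable: "smooth_on f S \<Longrightarrow> x \<in> S \<Longrightarrow> f differentiable (at x)"
  unfolding smooth_on_def by (metis Ck_on.simps(2))

lemma smooth_on_continuous: "smooth_on f S \<Longrightarrow> continuous_on S f"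
  unfolding smooth_on_def by (metis Ck_on.simps(1))

definition pd :: "'n::finite \<Rightarrow> (real^'n \<Rightarrow> 'b::real_normed_vector) \<Rightarrow> real^'n \<Rightarrow> 'b" where
  "pd l f x = frechet_derivative f (at x) (axis l 1)"

lemma partial_eq_pd: "partial i f = pd i f"
  by (auto simp: partial_def pd_def)

lemma pd_eq: "has_partials f g x \<Longrightarrow> pd l f x = g l"
  unfolding pd_def by (rule has_partials_apply)

lemma smooth_on_pd: "smooth_on f S \<Longrightarrow> smooth_on (pd l f) S"
  unfolding pd_def[abs_def] by (rule smooth_on_frechet_derivative)

lemma has_partials_pd:
  "f differentiable (at x) \<Longrightarrow> has_partials f (\<lambda>l. pd l f x) x"
  unfolding pd_def by (rule differentiable_has_partials)

lemma has_partials_smooth: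
  "smooth_on f S \<Longrightarrow> x \<in> S \<Longrightarrow> has_partials f (\<lambda>l. pd l f x) x"
  by (intro has_partials_pd smooth_on_differentiable)

lemma Ck_on_2_hasC2:
  assumes "Ck_on 2 f S"
  shows "hasC2 S f (\<lambda>l. pd l f) (\<lambda>l m. pd m (pd l f))"
proof -
  have *: "f differentiable (at x)" "pd l f differentiable (at x)" "continuous_on S (pd m (pd l f))" if "x \<in> S" for x l m
    using assms that by (simp_all add: numeral_2_eq_2 pd_def[abs_def])
  have "continuous_on S (pd m (pd l f))" for l m
    using *(3) by (cases "S = {}") auto
  then show ?thesis using * unfolding hasC2_def by (auto intro!: has_partials_pd)
qed

text \<open>\<open>Ck_on\<close> asks for derivatives in every direction \<open>h\<close>,
  \<open>hasC2\<close> only provides the coordinate ones; a directional derivative is a finite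
  linear combination of these.\<close>

lemma hasC2_Ck_on_2:
  assumes S: "open S" and f: "hasC2 S f f1 f2"
  shows "Ck_on 2 f S"
proof -
  have lin: "frechet_derivative g (at x) h = (\<Sum>l\<in>UNIV. (h$l) *\<^sub>R G l)"
    and diff: "g differentiable (at x)"
    if "has_partials g G x" for g :: "real^'a \<Rightarrow> 'b" and G x h
    using frechet_derivative_at[OF that[unfolded has_partials_def], symmetric] that
    by (auto simp: has_partials_def differentiable_def)
  have 1: "Ck_on 1 (f1 l) S" for l
    unfolding One_nat_def
  proof (simp, intro conjI allI ballI)
    show "f1 l differentiable (at x)" if "x \<in> S" for x
      using diff[OF hasC2D(2)[OF f that]] .
    show "continuous_on S (\<lambda>x. frechet_derivative (f1 l) (at x) h)" for h
      by (subst continuous_on_cong[OF refl lin[OF hasC2D(2)[OF f]]])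
        (auto intro!: continuous_intros hasC2D[OF f])
  qed
  have "Ck_on 1 (\<lambda>x. \<Sum>l\<in>UNIV. (h$l) *\<^sub>R f1 l x) S" for h :: "real^'a"
  proof -
    have "Ck_on 1 (\<lambda>x. \<Sum>l\<in>I. (h$l) *\<^sub>R f1 l x) S" if "finite I" for I
      using that
    proof induction
      case empty
      then show ?case by (simp only: sum.empty Ck_on_const)
    next
      case (insert l I)
      then show ?case
        unfolding sum.insert[OF insert.hyps]
        by (intro Ck_on_add S Ck_on_compose_linear[OF bounded_linear_scaleR_right S 1])
    qed
    then show ?thesis by simp
  qed
  then have "Ck_on 1 (\<lambda>x. frechet_derivative f (at x) h) S" for h
    by (rule Ck_on_cong[OF S, rotated]) (simp add: lin[OF hasC2D(1)[OF f]])
  then show ?thesis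
    using diff[OF hasC2D(1)[OF f]] by (simp add: numeral_2_eq_2)
qed

lemma smooth_on_hasC2:
  "smooth_on f S \<Longrightarrow> hasC2 S f (\<lambda>l. pd l f) (\<lambda>l m. pd m (pd l f))"
  by (intro Ck_on_2_hasC2 smooth_on_Ck)

section \<open>Uniform bounds on compact sets and a smooth bump function\<close>

lemma compact_norm_bound:
  fixes f :: "'a::metric_space \<Rightarrow> 'b::real_normed_vector"
  assumes "compact K" "continuous_on K f"
  obtains B where "B \<ge> 0" "\<And>x. x \<in> K \<Longrightarrow> norm (f x) \<le> B"
proof -
  have "bounded (f ` K)" using assms by (intro compact_imp_bounded compact_continuous_image)
  then obtain B where "B > 0" "\<And>x. x \<in> K \<Longrightarrow> norm (f x) \<le> B" unfolding bounded_pos by auto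
  then show ?thesis using that[of B] by simp
qed

lemma compact_family_norm_bound:
  fixes f :: "'i::finite \<Rightarrow> 'a::metric_space \<Rightarrow> 'b::real_normed_vector"
  assumes "compact K" "\<And>i. continuous_on K (f i)"
  obtains B where "B \<ge> 0" "\<And>i x. x \<in> K \<Longrightarrow> norm (f i x) \<le> B"
proof -
  have "\<exists>B\<ge>0. \<forall>x\<in>K. norm (f i x) \<le> B" for i
    using compact_norm_bound[OF assms(1) assms(2)[of i]] by metis
  then obtain B where B: "\<And>i. B i \<ge> 0" "\<And>i x. x \<in> K \<Longrightarrow> norm (f i x) \<le> B i" by metis
  have "norm (f i x) \<le> (\<Sum>i\<in>UNIV. B i)" if "x \<in> K" for i x
    using B(2)[OF that, of i] member_le_sum[of i UNIV B] B(1) by (meson UNIV_I finite_class.finite_UNIV order.trans)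
  then show ?thesis using that[of "\<Sum>i\<in>UNIV. B i"] B(1) by (simp add: sum_nonneg)
qed

text \<open>The functions \<open>t\<^sup>-\<^sup>m e\<^sup>-\<^sup>1\<^sup>/\<^sup>t\<close> for \<open>t > 0\<close>, extended by zero, are closed under differentiation up to
  linear combinations.\<close>

definition flat :: "nat \<Rightarrow> real \<Rightarrow> real" where
  "flat m t = (if t > 0 then inverse t ^ m * exp (- inverse t) else 0)"

lemma flat_tendsto_0: "(flat m \<longlongrightarrow> 0) (at 0)"
proof -
  have "((\<lambda>t. (inverse t) ^ m / exp (inverse t)) \<longlongrightarrow> 0) (at_right (0::real))"
    by (rule filterlim_compose[OF tendsto_power_div_exp_0 filterlim_inverse_at_top_right])
  then have "(flat m \<longlongrightarrow> 0) (at_right 0)"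
    by (rule Lim_transform_eventually)
      (auto simp: flat_def exp_minus field_simps eventually_at_right_less intro: eventually_at_rightI[of 0 1])
  moreover have "(flat m \<longlongrightarrow> 0) (at_left 0)"
    by (rule Lim_transform_eventually[OF tendsto_const])
      (auto simp: flat_def intro: eventually_at_leftI[of "-1" 0])
  ultimately show ?thesis by (simp add: filterlim_split_at)
qed

lemma flat_has_derivative:
  "(flat m has_real_derivative (flat (m + 2) t - real m * flat (m + 1) t)) (at t)"
proof -
  consider "t < 0" | "t = 0" | "t > 0" by linarith
  then show ?thesis
  proof cases
    case 1
    have "((\<lambda>_. 0) has_real_derivative 0) (at t)" by simp
    then have "(flat m has_real_derivative 0) (at t)"
      by (rule has_field_derivative_transform_within_open[of _ _ _ "{..<0}"]) (use 1 in \<open>auto simp: flat_def\<close>)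
    then show ?thesis using 1 by (simp add: flat_def)
  next
    case 2
    \<comment> \<open>At 0 the difference quotient of \<open>flat m\<close> is exactly
      \<open>flat (m + 1)\<close>, whose limit is already known.\<close>
    have "(flat m has_real_derivative 0) (at 0)"
      unfolding has_field_derivative_iff
    proof (rule Lim_transform_eventually[OF flat_tendsto_0[of "m + 1"]])
      show "\<forall>\<^sub>F y in at 0. flat (m + 1) y = (flat m y - flat m 0) / (y - 0)"
        by (auto simp: eventually_at_filter flat_def divide_inverse)
    qed
    then show ?thesis using 2 by (simp add: flat_def)
  next
    case 3
    have "((\<lambda>t. inverse t ^ m * exp (- inverse t)) has_real_derivative
        (inverse t ^ m * (exp (- inverse t) * (inverse t * inverse t))
         + (real m * inverse t ^ (m - 1) * (- (inverse t * inverse t))) * exp (- inverse t))) (at t)"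
      using 3 by (auto intro!: derivative_eq_intros)
    moreover have "inverse t ^ m * (exp (- inverse t) * (inverse t * inverse t))
         + (real m * inverse t ^ (m - 1) * (- (inverse t * inverse t))) * exp (- inverse t)
      = flat (m + 2) t - real m * flat (m + 1) t"
      using 3 by (cases m) (simp_all add: flat_def algebra_simps)
    ultimately have "((\<lambda>t. inverse t ^ m * exp (- inverse t)) has_real_derivative (flat (m + 2) t - real m * flat (m + 1) t)) (at t)"
      by simp
    then show ?thesis
      by (rule has_field_derivative_transform_within_open[of _ _ _ "{0<..}"]) (use 3 in \<open>auto simp: flat_def\<close>)
  qed
qed

text \<open>Differentiation replaces \<open>flat m\<close> by the orders \<open>m + 1\<close> and
  \<open>m + 2\<close>, times a linear factor, so the induction on \<open>k\<close> runs over all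
  \<open>m\<close> at once.\<close>

lemma Ck_on_flat: "Ck_on k (\<lambda>x::'a::euclidean_space. flat m (r - x \<bullet> x)) UNIV"
proof (induction k arbitrary: m)
  case 0
  have "isCont (flat m) t" for t using flat_has_derivative[of m t] by (rule DERIV_isCont)
  then have "continuous_on UNIV (flat m)" by (simp add: continuous_at_imp_continuous_on)
  then have "continuous_on UNIV (\<lambda>x::'a. flat m (r - x \<bullet> x))"
    by (rule continuous_on_compose2) (auto intro!: continuous_intros)
  then show ?case by simp
next
  case (Suc k)
  let ?d = "\<lambda>t. flat (m + 2) t - real m * flat (m + 1) t"
  have der: "((\<lambda>x. flat m (r - x \<bullet> x)) has_derivative (\<lambda>h. (- 2 * (x \<bullet> h)) * ?d (r - x \<bullet> x))) (at x)" for x :: 'a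
  proof -
    have "((\<lambda>x. r - x \<bullet> x) has_derivative (\<lambda>h. - 2 * (x \<bullet> h))) (at x)"
      by (auto intro!: derivative_eq_intros simp: inner_commute)
    from has_derivative_compose[OF this flat_has_derivative[of m "r - x \<bullet> x", unfolded has_field_derivative_def]]
    show ?thesis by (simp add: mult.commute)
  qed
  have "Ck_on k (\<lambda>x::'a. (- 2 * (x \<bullet> h)) * ?d (r - x \<bullet> x)) UNIV" for h
  proof -
    have "Ck_on k (\<lambda>x. flat (m + 2) (r - x \<bullet> x) + (- real m) *\<^sub>R flat (m + 1) (r - x \<bullet> x)) (UNIV :: 'a set)"
      by (intro Ck_on_add Ck_on_compose_linear[OF bounded_linear_scaleR_right] Suc.IH) auto
    moreover have "Ck_on k (\<lambda>x::'a. (- 2) *\<^sub>R (x \<bullet> h)) UNIV"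
      by (intro Ck_on_compose_linear[OF bounded_linear_scaleR_right] Ck_on_linear bounded_linear_inner_left) auto
    ultimately show ?thesis
      using Ck_on_bilinear[OF bounded_bilinear_mult open_UNIV] by fastforce
  qed
  then have "Ck_on k (\<lambda>x. frechet_derivative (\<lambda>x::'a. flat m (r - x \<bullet> x)) (at x) h) UNIV" for h
    using frechet_derivative_at[OF der, symmetric] by simp
  then show ?case using der by (auto simp: differentiable_def)
qed

text \<open>Positivity on the whole open ball matters: the localized function is later divided by
  this cutoff.\<close>

lemma smooth_bump:
  assumes "\<rho> > 0"
  obtains \<eta> :: "'a::euclidean_space \<Rightarrow> real" where "smooth_on \<eta> UNIV"
    "\<And>x. x \<in> ball 0 \<rho> \<Longrightarrow> \<eta> x > 0" "\<And>x. x \<notin> ball 0 \<rho> \<Longrightarrow> \<eta> x = 0"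
proof
  let ?\<eta> = "\<lambda>x::'a. flat 0 (\<rho>\<^sup>2 - x \<bullet> x)"
  show "smooth_on ?\<eta> UNIV" by (simp add: smooth_on_def Ck_on_flat)
  have *: "x \<bullet> x < \<rho>\<^sup>2 \<longleftrightarrow> x \<in> ball 0 \<rho>" for x :: 'a
    using assms by (simp add: power2_norm_eq_inner[symmetric] abs_le_square_iff[symmetric] not_le[symmetric])
  show "?\<eta> x > 0" if "x \<in> ball 0 \<rho>" for x using that *[of x] by (simp add: flat_def)
  show "?\<eta> x = 0" if "x \<notin> ball 0 \<rho>" for x using that *[of x] by (simp add: flat_def)
qed

section \<open>Fourier inversion\<close>

lemma norm_cart_mult_le: "(1 + (x$i)\<^sup>2) \<le> 1 + (norm (x::real^'n::finite))\<^sup>2"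
  using component_le_norm_cart[of x i] by (simp add: abs_le_square_iff[symmetric] power_mono)

lemma integrable_inverse_one_plus_square: "integrable lborel (\<lambda>t::real. inverse (1 + t\<^sup>2))"
  using integrable_inverse_1_plus_square by (simp add: set_integrable_def)

text \<open>One factor is spent on each coordinate: the product of the kernels
  \<open>inverse (1 + (x$i)\<^sup>2)\<close> is a majorant that Fubini integrates, in place of polar
  coordinates.\<close>

lemma integrable_inverse_norm_power:
  "integrable lborel (\<lambda>x::real^'n::finite. inverse ((1 + (norm x)\<^sup>2) ^ CARD('n)))"
proof (rule Bochner_Integration.integrable_bound)
  show "integrable lborel (\<lambda>x::real^'n. \<Prod>i\<in>UNIV. inverse (1 + (x$i)\<^sup>2))"
    by (rule integrable_lborel_prod) (rule integrable_inverse_one_plus_square)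
  show "(\<lambda>x::real^'n. inverse ((1 + (norm x)\<^sup>2) ^ CARD('n))) \<in> borel_measurable lborel"
    by measurable
  have "inverse ((1 + (norm x)\<^sup>2) ^ CARD('n)) \<le> (\<Prod>i\<in>UNIV. inverse (1 + (x$i)\<^sup>2))" for x :: "real^'n"
  proof -
    have "inverse ((1 + (norm x)\<^sup>2) ^ CARD('n)) = (\<Prod>i\<in>(UNIV::'n set). inverse (1 + (norm x)\<^sup>2))"
      by (simp add: power_inverse)
    also have "\<dots> \<le> (\<Prod>i\<in>UNIV. inverse (1 + (x$i)\<^sup>2))"
      by (intro prod_mono conjI le_imp_inverse_le norm_cart_mult_le) (auto intro: add_pos_nonneg add_nonneg_nonneg)
    finally show ?thesis .
  qed
  then show "AE x in lborel. norm (inverse ((1 + (norm x)\<^sup>2) ^ CARD('n))) \<le> norm (\<Prod>i\<in>UNIV. inverse (1 + ((x::real^'n)$i)\<^sup>2))"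
    by (auto simp: prod_nonneg abs_prod add_nonneg_nonneg)
qed

text \<open>The inverse Fourier integral without normalization; the missing factor is the
  \<open>(2 * pi) ^ CARD('n)\<close> of \<open>fourier_inversion\<close>.\<close>

definition fint :: "(real^'n::finite \<Rightarrow> complex) \<Rightarrow> real^'n \<Rightarrow> complex" where
  "fint F y = (LINT \<xi>|lborel. F \<xi> * cis (y \<bullet> \<xi>))"

lemma fint_integrable: "integrable lborel F \<Longrightarrow> integrable lborel (\<lambda>\<xi>. F \<xi> * cis (y \<bullet> \<xi>))"
proof -
  assume F: "integrable lborel F"
  have [measurable]: "F \<in> borel_measurable borel" using borel_measurable_integrable[OF F] by simp
  have [measurable]: "(\<lambda>\<xi>. cis (y \<bullet> \<xi>)) \<in> borel_measurable borel"
    by (intro borel_measurable_continuous_onI continuous_intros)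
  show ?thesis
    by (rule Bochner_Integration.integrable_bound[OF F]) (auto simp: norm_mult)
qed

lemma cis_linear_bound: "norm (cis t - 1 - \<i> * t) \<le> t\<^sup>2 / 2"
proof -
  have "norm (exp (\<i> * of_real t) - (\<Sum>k\<le>1. (\<i> * of_real t) ^ k / fact k)) \<le> \<bar>t\<bar> ^ Suc 1 / fact (Suc 1)"
    using iexp_approx1[of t 1] by simp
  moreover have "(\<Sum>k\<le>1. (\<i> * complex_of_real t) ^ k / fact k) = 1 + \<i> * t" by simp
  moreover have "\<bar>t\<bar> ^ Suc 1 / fact (Suc 1) = t\<^sup>2 / 2" by (simp add: numeral_2_eq_2)
  ultimately show ?thesis by (simp only: cis_conv_exp diff_diff_eq)
qed

text \<open>Differentiation under the integral sign costs one power of \<open>\<xi>\<close>; the second moment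
  controls the Taylor remainder of the exponential.\<close>

lemma fint_has_partials:
  fixes F :: "real^'n::finite \<Rightarrow> complex"
  assumes F: "integrable lborel F" and F2: "integrable lborel (\<lambda>\<xi>. F \<xi> * (norm \<xi>)\<^sup>2)"
  shows "integrable lborel (\<lambda>\<xi>. F \<xi> * (\<i> * (\<xi>$l)))"
    "has_partials (fint F) (\<lambda>l. fint (\<lambda>\<xi>. F \<xi> * (\<i> * (\<xi>$l))) y) y"
proof -
  have [measurable]: "F \<in> borel_measurable borel" using borel_measurable_integrable[OF F] by simp
  have int1: "integrable lborel (\<lambda>\<xi>. F \<xi> * (\<i> * (\<xi>$l)))" for l
  proof (rule Bochner_Integration.integrable_bound)
    show "integrable lborel (\<lambda>\<xi>. norm (F \<xi>) + norm (F \<xi> * (norm \<xi>)\<^sup>2))" using F F2 by simp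
    have "norm (F \<xi> * (\<i> * (\<xi>$l))) \<le> norm (norm (F \<xi>) + norm (F \<xi> * (norm \<xi>)\<^sup>2))" for \<xi>
    proof -
      have "\<bar>\<xi>$l\<bar> \<le> norm \<xi>" by (rule component_le_norm_cart)
      also have "\<dots> \<le> 1 + (norm \<xi>)\<^sup>2"
        using sum_squares_bound[of "norm \<xi>" 1] zero_le_power2[of "norm \<xi>"] norm_ge_zero[of \<xi>]
        unfolding power_one mult_1_right by linarith
      finally have "norm (F \<xi>) * \<bar>\<xi>$l\<bar> \<le> norm (F \<xi>) * (1 + (norm \<xi>)\<^sup>2)" by (intro mult_left_mono) auto
      then show ?thesis by (simp add: norm_mult distrib_left norm_power)
    qed
    then show "AE \<xi> in lborel. norm (F \<xi> * (\<i> * (\<xi>$l))) \<le> norm (norm (F \<xi>) + norm (F \<xi> * (norm \<xi>)\<^sup>2))" by simp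
  qed measurable
  then show "integrable lborel (\<lambda>\<xi>. F \<xi> * (\<i> * (\<xi>$l)))" .
  define M where "M = (LINT \<xi>|lborel. norm (F \<xi> * (norm \<xi>)\<^sup>2))"
  define L where "L h = (\<Sum>l\<in>UNIV. (h$l) *\<^sub>R fint (\<lambda>\<xi>. F \<xi> * (\<i> * (\<xi>$l))) y)" for h :: "real^'n"
  have Lh: "L h = (LINT \<xi>|lborel. F \<xi> * (\<i> * (h \<bullet> \<xi>)) * cis (y \<bullet> \<xi>))"
    and Lint: "integrable lborel (\<lambda>\<xi>. F \<xi> * (\<i> * (h \<bullet> \<xi>)) * cis (y \<bullet> \<xi>))" for h
  proof -
    have eq: "F \<xi> * (\<i> * (h \<bullet> \<xi>)) * cis (y \<bullet> \<xi>) = (\<Sum>l\<in>UNIV. (h$l) *\<^sub>R (F \<xi> * (\<i> * (\<xi>$l)) * cis (y \<bullet> \<xi>)))" for \<xi>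
      by (simp add: inner_vec_def sum_distrib_left sum_distrib_right scaleR_conv_of_real mult_ac)
    show "integrable lborel (\<lambda>\<xi>. F \<xi> * (\<i> * (h \<bullet> \<xi>)) * cis (y \<bullet> \<xi>))"
      unfolding eq by (intro Bochner_Integration.integrable_sum integrable_scaleR_right fint_integrable int1)
    show "L h = (LINT \<xi>|lborel. F \<xi> * (\<i> * (h \<bullet> \<xi>)) * cis (y \<bullet> \<xi>))"
      unfolding eq L_def fint_def
      by (subst Bochner_Integration.integral_sum) (auto intro!: fint_integrable int1 integrable_scaleR_right)
  qed
  have bound: "norm (fint F z - fint F y - L (z - y)) \<le> M * (norm (z - y))\<^sup>2" for z
  proof -
    have e: "fint F z - fint F y - L (z - y)
      = (LINT \<xi>|lborel. F \<xi> * cis (z \<bullet> \<xi>) - F \<xi> * cis (y \<bullet> \<xi>) - F \<xi> * (\<i> * ((z - y) \<bullet> \<xi>)) * cis (y \<bullet> \<xi>))"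
      unfolding Lh unfolding fint_def
      using fint_integrable[OF F] Lint by (simp only: Bochner_Integration.integral_diff Bochner_Integration.integrable_diff)
    have "norm (fint F z - fint F y - L (z - y)) \<le> (LINT \<xi>|lborel. norm (F \<xi> * cis (z \<bullet> \<xi>) - F \<xi> * cis (y \<bullet> \<xi>) - F \<xi> * (\<i> * ((z - y) \<bullet> \<xi>)) * cis (y \<bullet> \<xi>)))"
      unfolding e by (rule integral_norm_bound)
    also have "\<dots> \<le> (LINT \<xi>|lborel. norm (F \<xi> * (norm \<xi>)\<^sup>2) * (norm (z - y))\<^sup>2)"
    proof (rule integral_mono)
      show "integrable lborel (\<lambda>\<xi>. norm (F \<xi> * cis (z \<bullet> \<xi>) - F \<xi> * cis (y \<bullet> \<xi>) - F \<xi> * (\<i> * ((z - y) \<bullet> \<xi>)) * cis (y \<bullet> \<xi>)))"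
        by (intro integrable_norm Bochner_Integration.integrable_diff fint_integrable[OF F] Lint)
      show "integrable lborel (\<lambda>\<xi>. norm (F \<xi> * (norm \<xi>)\<^sup>2) * (norm (z - y))\<^sup>2)"
        using F2 by (intro integrable_mult_left integrable_norm)
      fix \<xi> :: "real^'n"
      have "cis (z \<bullet> \<xi>) = cis (y \<bullet> \<xi>) * cis ((z - y) \<bullet> \<xi>)"
        by (simp add: cis_mult inner_diff_left)
      then have "F \<xi> * cis (z \<bullet> \<xi>) - F \<xi> * cis (y \<bullet> \<xi>) - F \<xi> * (\<i> * ((z - y) \<bullet> \<xi>)) * cis (y \<bullet> \<xi>)
        = F \<xi> * cis (y \<bullet> \<xi>) * (cis ((z - y) \<bullet> \<xi>) - 1 - \<i> * ((z - y) \<bullet> \<xi>))" by (simp add: algebra_simps)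
      then have "norm (F \<xi> * cis (z \<bullet> \<xi>) - F \<xi> * cis (y \<bullet> \<xi>) - F \<xi> * (\<i> * ((z - y) \<bullet> \<xi>)) * cis (y \<bullet> \<xi>))
        = norm (F \<xi>) * norm (cis ((z - y) \<bullet> \<xi>) - 1 - \<i> * ((z - y) \<bullet> \<xi>))" by (simp add: norm_mult)
      also have "\<dots> \<le> norm (F \<xi>) * (((z - y) \<bullet> \<xi>)\<^sup>2 / 2)"
        by (intro mult_left_mono cis_linear_bound) auto
      also have "\<dots> \<le> norm (F \<xi>) * (norm (z - y) * norm \<xi>)\<^sup>2"
      proof (intro mult_left_mono)
        have "((z - y) \<bullet> \<xi>)\<^sup>2 \<le> (norm (z - y) * norm \<xi>)\<^sup>2"
          using Cauchy_Schwarz_ineq2[of "z - y" \<xi>] by (metis abs_le_square_iff abs_mult abs_norm_cancel)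
        then show "((z - y) \<bullet> \<xi>)\<^sup>2 / 2 \<le> (norm (z - y) * norm \<xi>)\<^sup>2"
          using zero_le_power2[of "(z - y) \<bullet> \<xi>"] by linarith
      qed auto
      finally show "norm (F \<xi> * cis (z \<bullet> \<xi>) - F \<xi> * cis (y \<bullet> \<xi>) - F \<xi> * (\<i> * ((z - y) \<bullet> \<xi>)) * cis (y \<bullet> \<xi>))
        \<le> norm (F \<xi> * (norm \<xi>)\<^sup>2) * (norm (z - y))\<^sup>2"
        by (simp add: norm_mult norm_power power_mult_distrib mult_ac)
    qed
    finally show ?thesis by (simp add: M_def)
  qed
  have "M \<ge> 0" unfolding M_def by (intro integral_nonneg_AE) auto
  have lin: "bounded_linear L"
    unfolding L_def[abs_def]
    by (intro bounded_linear_sum bounded_linear_scaleR_left[THEN bounded_linear_compose] bounded_linear_vec_nth)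
  show "has_partials (fint F) (\<lambda>l. fint (\<lambda>\<xi>. F \<xi> * (\<i> * (\<xi>$l))) y) y"
    unfolding has_partials_def L_def[symmetric]
  proof (rule has_derivativeI_sandwich[of 1])
    show "(\<lambda>z. M * norm (z - y)) \<midarrow>y\<rightarrow> 0"
      by (auto intro!: tendsto_eq_intros)
    fix z assume "z \<noteq> y"
    then show "norm (fint F z - fint F y - L (z - y)) / norm (z - y) \<le> M * norm (z - y)"
      using bound[of z] by (simp add: divide_le_eq power2_eq_square mult.assoc)
  qed (use lin in auto)
qed

text \<open>The weight is of order four. Two powers of \<xi> pay for the second derivatives; two
  more allow \<open>fint_has_partials\<close> to be applied to these once again, and
  differentiability gives their continuity.\<close>

lemma fint_hasC2:
  fixes F :: "real^'n::finite \<Rightarrow> complex"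
  assumes [measurable]: "F \<in> borel_measurable borel"
    and F: "integrable lborel (\<lambda>\<xi>. F \<xi> * (1 + (norm \<xi>)\<^sup>2)\<^sup>2)"
  shows "\<exists>f1 f2. hasC2 UNIV (fint F) f1 f2"
proof -
  have int: "integrable lborel G" if [measurable]: "G \<in> borel_measurable borel"
    and "\<And>\<xi>. norm (G \<xi>) \<le> norm (F \<xi>) * (1 + (norm \<xi>)\<^sup>2)\<^sup>2" for G :: "real^'n \<Rightarrow> complex"
  proof (rule Bochner_Integration.integrable_bound[OF F])
    have "(1 + (norm \<xi>)\<^sup>2)\<^sup>2 = \<bar>(1 + (norm \<xi>)\<^sup>2)\<^sup>2\<bar>" for \<xi> :: "real^'n" by simp
    then have "norm (G \<xi>) \<le> norm (F \<xi> * (1 + (norm \<xi>)\<^sup>2)\<^sup>2)" for \<xi>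
      using that(2)[of \<xi>] by (metis norm_mult norm_of_real of_real_1 of_real_add of_real_power)
    then show "AE \<xi> in lborel. norm (G \<xi>) \<le> norm (F \<xi> * (1 + (norm \<xi>)\<^sup>2)\<^sup>2)" by simp
  qed simp
  have c: "\<bar>\<xi>$l\<bar> \<le> norm \<xi>" for \<xi> :: "real^'n" and l by (rule component_le_norm_cart)
  have ineq: "r \<le> 1 + r\<^sup>2" "1 \<le> 1 + r\<^sup>2" "r\<^sup>2 \<le> 1 + r\<^sup>2" if "r \<ge> 0" for r :: real
    using sum_squares_bound[of r 1] zero_le_power2[of r] that by (simp_all)
  have prodb: "u * w \<le> (1 + r\<^sup>2)\<^sup>2" if "0 \<le> u" "u \<le> 1 + r\<^sup>2" "0 \<le> w" "w \<le> 1 + r\<^sup>2" for u w r :: real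
    using mult_mono[OF that(2,4)] that by (simp add: power2_eq_square)
  have b0: "1 \<le> (1 + r\<^sup>2)\<^sup>2" "r\<^sup>2 \<le> (1 + r\<^sup>2)\<^sup>2" "r * r\<^sup>2 \<le> (1 + r\<^sup>2)\<^sup>2" "r * r * r\<^sup>2 \<le> (1 + r\<^sup>2)\<^sup>2" "r \<le> (1 + r\<^sup>2)\<^sup>2" "r * r \<le> (1 + r\<^sup>2)\<^sup>2" 
    if "r \<ge> 0" for r :: real
    using prodb[of 1 r 1] prodb[of "r\<^sup>2" r 1] prodb[of r r "r\<^sup>2"] prodb[of "r\<^sup>2" r "r\<^sup>2"] prodb[of r r 1] ineq[OF that] that
    by (simp_all add: power2_eq_square)
  have bnd: "norm (F \<xi>) * u \<le> norm (F \<xi>) * (1 + (norm \<xi>)\<^sup>2)\<^sup>2" if "u \<le> (1 + (norm \<xi>)\<^sup>2)\<^sup>2" for u \<xi>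
    using that by (rule mult_left_mono) simp
  define F1 where "F1 l \<xi> = F \<xi> * (\<i> * (\<xi>$l))" for l \<xi>
  define F2 where "F2 l m \<xi> = F1 l \<xi> * (\<i> * (\<xi>$m))" for l m \<xi>
  have [measurable]: "F1 l \<in> borel_measurable borel" "F2 l m \<in> borel_measurable borel" for l m
    unfolding F1_def[abs_def] F2_def[abs_def] by measurable
  have c2: "\<bar>\<xi>$l\<bar> * \<bar>\<xi>$m\<bar> \<le> norm \<xi> * norm \<xi>" for \<xi> :: "real^'n" and l m by (intro mult_mono c) auto
  have i: "integrable lborel F" "integrable lborel (\<lambda>\<xi>. F \<xi> * (norm \<xi>)\<^sup>2)"
    "integrable lborel (F1 l)" "integrable lborel (\<lambda>\<xi>. F1 l \<xi> * (norm \<xi>)\<^sup>2)"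
    "integrable lborel (F2 l m)" "integrable lborel (\<lambda>\<xi>. F2 l m \<xi> * (norm \<xi>)\<^sup>2)" for l m
  proof -
    show "integrable lborel F" by (rule int) (use bnd[OF b0(1)[OF norm_ge_zero]] in auto)
    show "integrable lborel (\<lambda>\<xi>. F \<xi> * (norm \<xi>)\<^sup>2)"
      by (rule int) (use bnd[OF b0(2)[OF norm_ge_zero]] in \<open>auto simp: norm_mult norm_power\<close>)
    show "integrable lborel (F1 l)"
      by (rule int) (auto simp: F1_def norm_mult intro!: bnd order.trans[OF c b0(5)])
    show "integrable lborel (\<lambda>\<xi>. F1 l \<xi> * (norm \<xi>)\<^sup>2)"
      by (rule int) (auto simp: F1_def norm_mult norm_power mult.assoc intro!: bnd order.trans[OF mult_right_mono[OF c] b0(3)])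
    show "integrable lborel (F2 l m)"
      by (rule int) (auto simp: F1_def F2_def norm_mult norm_power mult.assoc intro!: bnd order.trans[OF c2 b0(6)])
    show "integrable lborel (\<lambda>\<xi>. F2 l m \<xi> * (norm \<xi>)\<^sup>2)"
    proof (rule int)
      show "norm (F2 l m \<xi> * (norm \<xi>)\<^sup>2) \<le> norm (F \<xi>) * (1 + (norm \<xi>)\<^sup>2)\<^sup>2" for \<xi>
      proof -
        have "\<bar>\<xi>$l\<bar> * \<bar>\<xi>$m\<bar> * (norm \<xi>)\<^sup>2 \<le> (1 + (norm \<xi>)\<^sup>2)\<^sup>2"
          by (rule order.trans[OF mult_right_mono[OF c2] b0(4)]) auto
        from bnd[OF this] show ?thesis by (simp add: F1_def F2_def norm_mult norm_power mult.assoc)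
      qed
    qed measurable
  qed
  have "hasC2 UNIV (fint F) (\<lambda>l. fint (F1 l)) (\<lambda>l m. fint (F2 l m))"
    unfolding hasC2_def
  proof (intro conjI ballI allI)
    show "has_partials (fint F) (\<lambda>l. fint (F1 l) x) x" for x
      using fint_has_partials(2)[OF i(1,2)] by (simp add: F1_def[abs_def])
    show "has_partials (fint (F1 l)) (\<lambda>m. fint (F2 l m) x) x" for x l
      using fint_has_partials(2)[OF i(3,4)] by (simp add: F2_def[abs_def])
    show "continuous_on UNIV (fint (F2 l m))" for l m
      by (intro continuous_at_imp_continuous_on ballI has_partials_continuous[OF fint_has_partials(2)[OF i(5,6)]])
  qed
  then show ?thesis by blast
qed

section \<open>Gaussian kernels and the inversion formula\<close>

lemma measurable_cis [measurable]: "cis \<in> borel_measurable borel"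
  by (intro borel_measurable_continuous_onI continuous_intros)

lemma std_normal_integral:
  "integrable lborel std_normal_density" "(LINT t|lborel. std_normal_density t) = 1"
  by (rule integrable_normal_density integral_normal_density, simp)+

text \<open>A rescaling of the characteristic function of the standard normal law.\<close>

lemma std_normal_fourier:
  assumes "k > 0"
  shows "integrable lborel (\<lambda>t. std_normal_density (t / k) *\<^sub>R cis (z * t))"
    "(LINT t|lborel. std_normal_density (t / k) *\<^sub>R cis (z * t)) = of_real (k * exp (- (k * z)\<^sup>2 / 2))"
proof -
  define f where "f x = std_normal_density x *\<^sub>R cis (k * z * x)" for x
  have fint: "integrable lborel f"
    unfolding f_def
    by (rule Bochner_Integration.integrable_bound[OF std_normal_integral(1)]) (auto simp: norm_mult)
  have "char std_normal_distribution (k * z) = (LINT x|lborel. f x)"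
    unfolding char_def f_def by (subst integral_density) (auto simp: cis_conv_exp)
  then have f: "(LINT x|lborel. f x) = exp (- (k * z)\<^sup>2 / 2)"
    by (simp add: char_std_normal_distribution)
  have eq: "f (0 + inverse k * t) = std_normal_density (t / k) *\<^sub>R cis (z * t)" for t
  proof -
    have "k * z * (inverse k * t) = z * t" using assms by simp
    then show ?thesis unfolding f_def by (simp only: add_0 divide_inverse_commute)
  qed
  show "integrable lborel (\<lambda>t. std_normal_density (t / k) *\<^sub>R cis (z * t))"
    using lborel_integrable_real_affine[OF fint, of "inverse k" 0] assms unfolding eq by simp
  have "of_real (exp (- (k * z)\<^sup>2 / 2)) = inverse k *\<^sub>R (LINT t|lborel. std_normal_density (t / k) *\<^sub>R cis (z * t))"
    using lborel_integral_real_affine[of "inverse k" f 0] assms f unfolding eq by simp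
  from arg_cong[OF this, of "\<lambda>c. k *\<^sub>R c"]
  show "(LINT t|lborel. std_normal_density (t / k) *\<^sub>R cis (z * t)) = of_real (k * exp (- (k * z)\<^sup>2 / 2))"
    using assms by (simp add: scaleR_conv_of_real)
qed

text \<open>The centred Gaussian density with standard deviation \<open>1 / k\<close> in each
  coordinate. The product form suits Fubini; \<open>gauss_eq\<close> shows that it is
  radial.\<close>

definition gauss :: "real \<Rightarrow> real^'n::finite \<Rightarrow> real" where
  "gauss k z = (\<Prod>i\<in>UNIV. k * std_normal_density (k * z$i))"

lemma gauss_nonneg: "k > 0 \<Longrightarrow> gauss k z \<ge> 0"
  by (auto simp: gauss_def intro!: prod_nonneg)

lemma gauss_eq: "gauss k (z::real^'n::finite) = (k / sqrt (2 * pi)) ^ CARD('n) * exp (- k\<^sup>2 * (norm z)\<^sup>2 / 2)"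
proof -
  have "gauss k z = (\<Prod>i\<in>(UNIV::'n set). (k / sqrt (2 * pi)) * exp (- (k * z$i)\<^sup>2 / 2))"
    by (simp add: gauss_def std_normal_density_def)
  also have "\<dots> = (k / sqrt (2 * pi)) ^ CARD('n) * exp (\<Sum>i\<in>(UNIV::'n set). - (k * z$i)\<^sup>2 / 2)"
    by (simp only: prod.distrib prod_constant exp_sum[OF finite_class.finite_UNIV])
  also have "(\<Sum>i\<in>(UNIV::'n set). - (k * z$i)\<^sup>2 / 2) = - k\<^sup>2 * (norm z)\<^sup>2 / 2"
  proof -
    have "(norm z)\<^sup>2 = (\<Sum>i\<in>UNIV. (z$i)\<^sup>2)"
      unfolding power2_norm_eq_inner inner_vec_def by (simp add: power2_eq_square)
    then show ?thesis by (simp add: sum_distrib_left sum_divide_distrib sum_negf power_mult_distrib)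
  qed
  finally show ?thesis .
qed

lemma gauss_integral:
  assumes "k > 0"
  shows "integrable lborel (\<lambda>x. gauss k (y - x :: real^'n::finite))" "(LINT x|lborel. gauss k (y - x :: real^'n)) = 1"
proof -
  have 1: "integrable lborel (\<lambda>t. k * std_normal_density (k * (c - t)))" for c
    using lborel_integrable_real_affine[OF std_normal_integral(1), of "- k" "k * c"] assms
    by (simp add: right_diff_distrib)
  have 2: "(LINT t|lborel. k * std_normal_density (k * (c - t))) = 1" for c
    using lborel_integral_real_affine[of "- k" std_normal_density "k * c"] assms std_normal_integral(2)
    by (simp add: right_diff_distrib)
  show "integrable lborel (\<lambda>x. gauss k (y - x :: real^'n))"
    unfolding gauss_def using integrable_lborel_prod[of "\<lambda>i t. k * std_normal_density (k * (y$i - t))"] 1 by simp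
  show "(LINT x|lborel. gauss k (y - x :: real^'n)) = 1"
    unfolding gauss_def using integral_lborel_prod[of "\<lambda>i t. k * std_normal_density (k * (y$i - t))"] 1 2 by simp
qed

text \<open>The expression is the ratio of \<open>gauss (Suc m)\<close> to \<open>gauss 1\<close> at
  distance sqrt(2d) from the centre.\<close>

lemma power_exp_square_tendsto_0:
  assumes "d > 0"
  shows "(\<lambda>m. real (Suc m) ^ n * exp (- ((real (Suc m))\<^sup>2 - 1) * d)) \<longlonglongrightarrow> 0"
proof (rule tendsto_sandwich[OF _ _ tendsto_const])
  have "filterlim (\<lambda>m. d * real (Suc m)) at_top sequentially"
    using assms by (intro filterlim_tendsto_pos_mult_at_top[OF tendsto_const] filterlim_compose[OF filterlim_real_sequentially filterlim_Suc])
  from filterlim_compose[OF tendsto_power_div_exp_0 this, of n]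
  have "(\<lambda>m. (d * real (Suc m)) ^ n / exp (d * real (Suc m))) \<longlonglongrightarrow> 0" .
  from tendsto_mult_left[OF this, of "exp d / d ^ n"]
  show "(\<lambda>m. exp d / d ^ n * ((d * real (Suc m)) ^ n / exp (d * real (Suc m)))) \<longlonglongrightarrow> 0" by simp
  have "real (Suc m) ^ n * exp (- ((real (Suc m))\<^sup>2 - 1) * d) \<le> exp d / d ^ n * ((d * real (Suc m)) ^ n / exp (d * real (Suc m)))" for m
  proof -
    define r where "r = real (Suc m)"
    have r: "r \<ge> 1" by (simp add: r_def)
    then have "r * 1 \<le> r * r" by (intro mult_left_mono) auto
    then have "(r - 1) * d \<le> (r\<^sup>2 - 1) * d"
      using assms by (intro mult_right_mono) (auto simp: power2_eq_square)
    then have "- (r\<^sup>2 - 1) * d \<le> d - d * r" by (simp add: algebra_simps)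
    then have "r ^ n * exp (- (r\<^sup>2 - 1) * d) \<le> r ^ n * exp (d - d * r)"
      using r by (intro mult_left_mono) auto
    also have "\<dots> = exp d / d ^ n * ((d * r) ^ n / exp (d * r))"
      using assms by (simp add: exp_diff power_mult_distrib)
    finally show ?thesis by (simp only: r_def)
  qed
  then show "\<forall>\<^sub>F m in sequentially. real (Suc m) ^ n * exp (- ((real (Suc m))\<^sup>2 - 1) * d)
      \<le> exp d / d ^ n * ((d * real (Suc m)) ^ n / exp (d * real (Suc m)))" by (intro always_eventually allI)
qed auto

text \<open>The function to which this is applied may be unbounded near the puncture, so away from
  \<open>y\<close> no supremum bound is available. There \<open>gauss (Suc m)\<close> is at most
  \<open>b m * gauss 1\<close>, hence at most \<open>b m\<close>, and the integral of \<bar>f\<bar>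
  suffices because \<open>b m\<close> tends to 0. Near \<open>y\<close> continuity at this one point
  is used.\<close>

lemma gauss_approximate_identity:
  fixes f :: "real^'n::finite \<Rightarrow> real"
  assumes f: "integrable lborel f" and cont: "isCont f y"
  shows "integrable lborel (\<lambda>x. f x * gauss (real (Suc m)) (y - x))"
    "(\<lambda>m. LINT x|lborel. f x * gauss (real (Suc m)) (y - x)) \<longlonglongrightarrow> f y"
proof -
  let ?k = "\<lambda>m. real (Suc m)"
  have [measurable]: "f \<in> borel_measurable borel" using borel_measurable_integrable[OF f] by simp
  have [measurable]: "gauss k \<in> borel_measurable borel" for k :: real
    unfolding gauss_def[abs_def] by measurable
  have kpos: "0 < ?k m" for m by simp
  have int_fg: "integrable lborel (\<lambda>x. f x * gauss (?k m) (y - x))" for m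
  proof (rule Bochner_Integration.integrable_bound)
    show "integrable lborel (\<lambda>x. f x * (?k m / sqrt (2 * pi)) ^ CARD('n))" using f by simp
    have "\<bar>f x\<bar> * gauss (?k m) (y - x) \<le> \<bar>f x\<bar> * (?k m / sqrt (2 * pi)) ^ CARD('n)" for x
    proof (rule mult_left_mono)
      have "exp (- (?k m)\<^sup>2 * (norm (y - x))\<^sup>2 / 2) \<le> 1" by simp
      from mult_left_mono[OF this, of "(?k m / sqrt (2 * pi)) ^ CARD('n)"]
      show "gauss (?k m) (y - x) \<le> (?k m / sqrt (2 * pi)) ^ CARD('n)" unfolding gauss_eq by simp
    qed simp
    then have "norm (f x * gauss (?k m) (y - x)) \<le> norm (f x * (?k m / sqrt (2 * pi)) ^ CARD('n))" for x
      by (simp add: abs_mult abs_of_nonneg[OF gauss_nonneg[OF kpos]] del: of_nat_Suc)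
    then show "AE x in lborel. norm (f x * gauss (?k m) (y - x)) \<le> norm (f x * (?k m / sqrt (2 * pi)) ^ CARD('n))"
      by (intro AE_I2)
  qed measurable
  then show "integrable lborel (\<lambda>x. f x * gauss (?k m) (y - x))" .
  show "(\<lambda>m. LINT x|lborel. f x * gauss (?k m) (y - x)) \<longlonglongrightarrow> f y"
  proof (rule LIMSEQ_I)
    fix e :: real assume e: "e > 0"
    obtain \<delta> where \<delta>: "\<delta> > 0" "\<And>x. dist x y < \<delta> \<Longrightarrow> dist (f x) (f y) < e / 2"
      using cont e unfolding continuous_at_eps_delta by (meson half_gt_zero)
    define b where "b m = ?k m ^ CARD('n) * exp (- ((?k m)\<^sup>2 - 1) * (\<delta>\<^sup>2 / 2))" for m
    define A where "A = (LINT x|lborel. \<bar>f x\<bar>) + \<bar>f y\<bar>"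
    have "b \<longlonglongrightarrow> 0"
      unfolding b_def[abs_def] using \<delta>(1) by (intro power_exp_square_tendsto_0) simp
    from tendsto_mult_left[OF this, of A] have "(\<lambda>m. A * b m) \<longlonglongrightarrow> 0" by simp
    from LIMSEQ_D[OF this, of "e / 2"] e obtain M where M: "\<And>m. m \<ge> M \<Longrightarrow> \<bar>A * b m\<bar> < e / 2" by auto
    have far: "gauss (?k m) z \<le> b m * gauss 1 z" if "norm z \<ge> \<delta>" for m and z :: "real^'n"
    proof -
      have "((?k m)\<^sup>2 - 1) * \<delta>\<^sup>2 \<le> ((?k m)\<^sup>2 - 1) * (norm z)\<^sup>2"
        using that \<delta>(1) one_le_power[of "?k m" 2] by (intro mult_left_mono power_mono) (auto simp del: of_nat_Suc)
      moreover have "- K * Z / 2 \<le> - (K - 1) * (d / 2) + - 1\<^sup>2 * Z / 2" if "(K - 1) * d \<le> (K - 1) * Z" for K Z d :: real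
        using that by (simp add: algebra_simps)
      ultimately have "- (?k m)\<^sup>2 * (norm z)\<^sup>2 / 2 \<le> - ((?k m)\<^sup>2 - 1) * (\<delta>\<^sup>2 / 2) + - 1\<^sup>2 * (norm z)\<^sup>2 / 2"
        by blast
      then have "exp (- (?k m)\<^sup>2 * (norm z)\<^sup>2 / 2) \<le> exp (- ((?k m)\<^sup>2 - 1) * (\<delta>\<^sup>2 / 2)) * exp (- 1\<^sup>2 * (norm z)\<^sup>2 / 2)"
        unfolding exp_add[symmetric] by (simp only: exp_le_cancel_iff)
      from mult_left_mono[OF this, of "(?k m / sqrt (2 * pi)) ^ CARD('n)"]
      show ?thesis unfolding gauss_eq b_def by (simp add: power_divide mult_ac)
    qed
    have g1: "gauss 1 z \<le> 1" for z :: "real^'n"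
    proof -
      have "sqrt 1 \<le> sqrt (2 * pi)" using pi_ge_two by (intro real_sqrt_le_mono) linarith
      then have "(1 / sqrt (2 * pi)) ^ CARD('n) \<le> 1" by (intro power_le_one) auto
      moreover have "exp (- 1\<^sup>2 * (norm z)\<^sup>2 / 2) \<le> 1" by simp
      ultimately have "(1 / sqrt (2 * pi)) ^ CARD('n) * exp (- 1\<^sup>2 * (norm z)\<^sup>2 / 2) \<le> 1 * 1"
        by (intro mult_mono) auto
      then show ?thesis unfolding gauss_eq by simp
    qed
    have b0: "b m \<ge> 0" for m by (simp add: b_def)
    have pw: "\<bar>(f x - f y) * gauss (?k m) (y - x)\<bar>
        \<le> e / 2 * gauss (?k m) (y - x) + b m * (\<bar>f x\<bar> + \<bar>f y\<bar> * gauss 1 (y - x))" for x m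
    proof (cases "dist x y < \<delta>")
      case True
      have "\<bar>f x - f y\<bar> * gauss (?k m) (y - x) \<le> e / 2 * gauss (?k m) (y - x)"
        using \<delta>(2)[OF True] gauss_nonneg[OF kpos] by (intro mult_right_mono) (auto simp: dist_real_def)
      moreover have "0 \<le> b m * (\<bar>f x\<bar> + \<bar>f y\<bar> * gauss 1 (y - x))"
        using b0[of m] gauss_nonneg[of 1 "y - x"] by simp
      ultimately show ?thesis using gauss_nonneg[OF kpos[of m], of "y - x"] by (simp add: abs_mult)
    next
      case False
      then have nz: "norm (y - x) \<ge> \<delta>" by (simp add: dist_norm norm_minus_commute)
      have "\<bar>f x - f y\<bar> * gauss (?k m) (y - x) \<le> (\<bar>f x\<bar> + \<bar>f y\<bar>) * (b m * gauss 1 (y - x))"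
        using far[OF nz, of m] gauss_nonneg[OF kpos[of m], of "y - x"] by (intro mult_mono) auto
      also have "\<dots> = b m * (\<bar>f x\<bar> * gauss 1 (y - x) + \<bar>f y\<bar> * gauss 1 (y - x))" by (simp add: algebra_simps)
      also have "\<dots> \<le> b m * (\<bar>f x\<bar> * 1 + \<bar>f y\<bar> * gauss 1 (y - x))"
        using g1 b0 by (intro mult_left_mono add_mono) auto
      finally have "\<bar>f x - f y\<bar> * gauss (?k m) (y - x) \<le> b m * (\<bar>f x\<bar> + \<bar>f y\<bar> * gauss 1 (y - x))" by simp
      moreover have "0 \<le> e / 2 * gauss (?k m) (y - x)"
        using e gauss_nonneg[OF kpos[of m], of "y - x"] by simp
      ultimately show ?thesis using gauss_nonneg[OF kpos[of m], of "y - x"] by (simp add: abs_mult)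
    qed
    have gi: "integrable lborel (\<lambda>x. gauss (?k m) (y - x))" for m by (rule gauss_integral(1)[OF kpos])
    have g1i: "integrable lborel (\<lambda>x. gauss 1 (y - x))" by (rule gauss_integral(1)) simp
    have "norm ((LINT x|lborel. f x * gauss (?k m) (y - x)) - f y) < e" if "m \<ge> M" for m
    proof -
      have "(LINT x|lborel. f x * gauss (?k m) (y - x)) - f y
        = (LINT x|lborel. f x * gauss (?k m) (y - x)) - (LINT x|lborel. f y * gauss (?k m) (y - x))"
        using gauss_integral(2)[OF kpos, of m y] by simp
      also have "\<dots> = (LINT x|lborel. f x * gauss (?k m) (y - x) - f y * gauss (?k m) (y - x))"
        by (rule Bochner_Integration.integral_diff[symmetric]) (use int_fg gi in auto)
      also have "\<dots> = (LINT x|lborel. (f x - f y) * gauss (?k m) (y - x))" by (simp add: left_diff_distrib)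
      finally have e1: "(LINT x|lborel. f x * gauss (?k m) (y - x)) - f y = (LINT x|lborel. (f x - f y) * gauss (?k m) (y - x))" .
      have "norm ((LINT x|lborel. f x * gauss (?k m) (y - x)) - f y)
        \<le> (LINT x|lborel. norm ((f x - f y) * gauss (?k m) (y - x)))"
        unfolding e1 by (rule integral_norm_bound)
      also have "\<dots> \<le> (LINT x|lborel. e / 2 * gauss (?k m) (y - x) + b m * (\<bar>f x\<bar> + \<bar>f y\<bar> * gauss 1 (y - x)))"
      proof (rule integral_mono)
        show "integrable lborel (\<lambda>x. norm ((f x - f y) * gauss (?k m) (y - x)))"
          unfolding left_diff_distrib using int_fg gi by (intro integrable_norm Bochner_Integration.integrable_diff integrable_mult_right) auto
        show "integrable lborel (\<lambda>x. e / 2 * gauss (?k m) (y - x) + b m * (\<bar>f x\<bar> + \<bar>f y\<bar> * gauss 1 (y - x)))"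
          using f gi g1i by (intro Bochner_Integration.integrable_add integrable_mult_right integrable_abs) auto
        show "norm ((f x - f y) * gauss (?k m) (y - x)) \<le> e / 2 * gauss (?k m) (y - x) + b m * (\<bar>f x\<bar> + \<bar>f y\<bar> * gauss 1 (y - x))" for x
          using pw by simp
      qed
      also have "\<dots> = e / 2 * (LINT x|lborel. gauss (?k m) (y - x)) + b m * ((LINT x|lborel. \<bar>f x\<bar>) + \<bar>f y\<bar> * (LINT x|lborel. gauss 1 (y - x)))"
      proof -
        have 1: "integrable lborel (\<lambda>x. \<bar>f x\<bar> + \<bar>f y\<bar> * gauss 1 (y - x))"
          by (intro Bochner_Integration.integrable_add integrable_abs[OF f] integrable_mult_right g1i)
        have 2: "(LINT x|lborel. \<bar>f x\<bar> + \<bar>f y\<bar> * gauss 1 (y - x)) = (LINT x|lborel. \<bar>f x\<bar>) + \<bar>f y\<bar> * (LINT x|lborel. gauss 1 (y - x))"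
          using Bochner_Integration.integral_add[OF integrable_abs[OF f] integrable_mult_right[OF g1i, of "\<bar>f y\<bar>"]]
          by (simp only: integral_mult_right_zero)
        show ?thesis
          using Bochner_Integration.integral_add[OF integrable_mult_right[OF gi[of m], of "e / 2"] integrable_mult_right[OF 1, of "b m"]]
          by (simp only: integral_mult_right_zero 2)
      qed
      also have "\<dots> = e / 2 + b m * A"
        using gauss_integral(2)[OF kpos, of m y] gauss_integral(2)[of 1 y]
        by (simp add: A_def del: of_nat_Suc)
      also have "\<dots> < e" using M[OF that] by (simp add: mult.commute abs_less_iff)
      finally show ?thesis .
    qed
    then show "\<exists>M. \<forall>m\<ge>M. norm ((LINT x|lborel. f x * gauss (?k m) (y - x)) - f y) < e" by blast
  qed
qed

text \<open>The Gaussian factor \<open>\<Phi> m\<close> makes the double integral absolutely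
  convergent, and exchanging the order turns it into an average of \<open>f\<close> against
  \<open>gauss\<close>. The constant is a product of two factors
  \<open>sqrt (2 * pi) ^ CARD('n)\<close>: one comes from the Fourier transform of
  \<open>\<Phi> m\<close>, the other from the limit of \<open>\<Phi> m\<close>, which is
  \<open>(1 / sqrt (2 * pi)) ^ CARD('n)\<close> and not 1.\<close>

lemma fourier_inversion:
  fixes f :: "real^'n::finite \<Rightarrow> real"
  assumes f: "integrable lborel f" and cont: "isCont f y"
    and F: "integrable lborel F" "\<And>\<xi>. F \<xi> = (LINT x|lborel. f x *\<^sub>R cis (- (x \<bullet> \<xi>)))"
  shows "fint F y = of_real ((2 * pi) ^ CARD('n) * f y)"
proof -
  let ?k = "\<lambda>m. real (Suc m)"
  have [measurable]: "f \<in> borel_measurable borel" using borel_measurable_integrable[OF f] by simp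
  have [measurable]: "F \<in> borel_measurable borel" using borel_measurable_integrable[OF F(1)] by simp
  define \<Phi> where "\<Phi> m \<xi> = (\<Prod>i\<in>UNIV. std_normal_density (\<xi>$i / ?k m))" for m and \<xi> :: "real^'n"
  have [measurable]: "\<Phi> m \<in> borel_measurable borel" for m unfolding \<Phi>_def[abs_def] by measurable
  have \<Phi>_nonneg: "0 \<le> \<Phi> m \<xi>" for m \<xi> unfolding \<Phi>_def by (intro prod_nonneg) auto
  have \<Phi>_bound: "\<Phi> m \<xi> \<le> 1" for m \<xi>
    unfolding \<Phi>_def
  proof (intro prod_le_1 conjI)
    fix i :: 'n
    have "1 / sqrt (2 * pi) \<le> 1" using pi_ge_two by (simp add: real_le_rsqrt)
    then have "1 / sqrt (2 * pi) * exp (- (\<xi> $ i / ?k m)\<^sup>2 / 2) \<le> 1 * 1"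
      by (intro mult_mono) auto
    then show "std_normal_density (\<xi> $ i / ?k m) \<le> 1" unfolding std_normal_density_def by simp
  qed auto
  have prod_eq: "\<Phi> m \<xi> *\<^sub>R cis (z \<bullet> \<xi>) = (\<Prod>i\<in>UNIV. std_normal_density (\<xi>$i / ?k m) *\<^sub>R cis (z$i * \<xi>$i))" for m z \<xi>
  proof -
    have "cis (z \<bullet> \<xi>) = (\<Prod>i\<in>UNIV. cis (z$i * \<xi>$i))"
      by (simp add: inner_vec_def cis_conv_exp sum_distrib_left exp_sum)
    then show ?thesis by (simp add: \<Phi>_def scaleR_conv_of_real prod.distrib)
  qed
  have \<Phi>_four: "(LINT \<xi>|lborel. \<Phi> m \<xi> *\<^sub>R cis (z \<bullet> \<xi>)) = of_real (sqrt (2 * pi) ^ CARD('n) * gauss (?k m) z)" for m z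
  proof -
    have "(LINT \<xi>|lborel. \<Phi> m \<xi> *\<^sub>R cis (z \<bullet> \<xi>)) = (\<Prod>i\<in>UNIV. LINT t|lborel. std_normal_density (t / ?k m) *\<^sub>R cis (z$i * t))"
      unfolding prod_eq by (rule integral_lborel_prod) (rule std_normal_fourier, simp)
    also have "\<dots> = (\<Prod>i\<in>UNIV. of_real (?k m * exp (- (?k m * z$i)\<^sup>2 / 2)))"
      by (intro prod.cong refl std_normal_fourier(2)) simp
    also have "\<dots> = of_real (\<Prod>i\<in>UNIV. sqrt (2 * pi) * (?k m * std_normal_density (?k m * z$i)))"
      unfolding of_real_prod by (intro prod.cong refl) (simp add: std_normal_density_def)
    also have "\<dots> = of_real (sqrt (2 * pi) ^ CARD('n) * gauss (?k m) z)"
      unfolding gauss_def by (simp only: prod.distrib prod_constant)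
    finally show ?thesis .
  qed
  have \<Phi>_int: "integrable lborel (\<Phi> m)" for m
  proof -
    have "integrable lborel (\<lambda>\<xi>. \<Phi> m \<xi> *\<^sub>R cis (0 \<bullet> \<xi>))"
      unfolding prod_eq by (rule integrable_lborel_prod) (rule std_normal_fourier, simp)
    then have "integrable lborel (\<lambda>\<xi>. norm (\<Phi> m \<xi> *\<^sub>R cis (0 \<bullet> \<xi>)))" by (rule integrable_norm)
    then show ?thesis using \<Phi>_nonneg by simp
  qed
  define g where "g m x \<xi> = f x *\<^sub>R (\<Phi> m \<xi> *\<^sub>R cis ((y - x) \<bullet> \<xi>))" for m x \<xi>
  have g_meas[measurable]: "case_prod (g m) \<in> borel_measurable (lborel \<Otimes>\<^sub>M lborel)" for m
    unfolding g_def[abs_def] by measurable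
  have ng: "norm (g m x \<xi>) = \<bar>f x\<bar> * \<Phi> m \<xi>" for m x \<xi>
    using \<Phi>_nonneg by (simp add: g_def abs_mult)
  have g_int: "integrable (lborel \<Otimes>\<^sub>M lborel) (case_prod (g m))" for m
  proof (rule lborel_pair.Fubini_integrable)
    show "integrable lborel (\<lambda>x. LINT \<xi>|lborel. norm (case (x, \<xi>) of (x, \<xi>) \<Rightarrow> g m x \<xi>))"
      using f by (simp add: ng)
    have "integrable lborel (g m x)" for x
    proof (rule Bochner_Integration.integrable_bound)
      show "integrable lborel (\<lambda>\<xi>. f x * \<Phi> m \<xi>)" using \<Phi>_int by simp
      show "g m x \<in> borel_measurable lborel" unfolding g_def[abs_def] by measurable
      show "AE \<xi> in lborel. norm (g m x \<xi>) \<le> norm (f x * \<Phi> m \<xi>)"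
        by (simp add: ng abs_mult \<Phi>_nonneg)
    qed
    then show "AE x in lborel. integrable lborel (\<lambda>\<xi>. case (x, \<xi>) of (x, \<xi>) \<Rightarrow> g m x \<xi>)" by simp
  qed measurable
  have key: "(LINT \<xi>|lborel. \<Phi> m \<xi> *\<^sub>R (F \<xi> * cis (y \<bullet> \<xi>)))
      = of_real (sqrt (2 * pi) ^ CARD('n)) * of_real (LINT x|lborel. f x * gauss (?k m) (y - x))" for m
  proof -
    have "\<Phi> m \<xi> *\<^sub>R (F \<xi> * cis (y \<bullet> \<xi>)) = (LINT x|lborel. g m x \<xi>)" for \<xi>
    proof -
      have "g m x \<xi> = (\<Phi> m \<xi> *\<^sub>R cis (y \<bullet> \<xi>)) * (f x *\<^sub>R cis (- (x \<bullet> \<xi>)))" for x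
        by (simp add: g_def inner_diff_left cis_mult mult.commute)
      then have "(LINT x|lborel. g m x \<xi>) = (\<Phi> m \<xi> *\<^sub>R cis (y \<bullet> \<xi>)) * F \<xi>"
        unfolding F(2) by (simp only: integral_mult_right_zero)
      then show ?thesis by (simp add: mult.commute)
    qed
    then have "(LINT \<xi>|lborel. \<Phi> m \<xi> *\<^sub>R (F \<xi> * cis (y \<bullet> \<xi>))) = (LINT \<xi>|lborel. LINT x|lborel. g m x \<xi>)" by simp
    also have "\<dots> = (LINT x|lborel. LINT \<xi>|lborel. g m x \<xi>)"
      using lborel_pair.Fubini_integral[OF g_int[of m]] .
    also have "\<dots> = (LINT x|lborel. of_real (sqrt (2 * pi) ^ CARD('n) * (f x * gauss (?k m) (y - x))))"
    proof (rule Bochner_Integration.integral_cong[OF refl])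
      fix x
      have "(LINT \<xi>|lborel. g m x \<xi>) = f x *\<^sub>R (LINT \<xi>|lborel. \<Phi> m \<xi> *\<^sub>R cis ((y - x) \<bullet> \<xi>))"
        unfolding g_def by (rule integral_scaleR_right) 
      then show "(LINT \<xi>|lborel. g m x \<xi>) = of_real (sqrt (2 * pi) ^ CARD('n) * (f x * gauss (?k m) (y - x)))"
        unfolding \<Phi>_four by (simp add: scaleR_conv_of_real mult_ac)
    qed
    also have "\<dots> = of_real (LINT x|lborel. sqrt (2 * pi) ^ CARD('n) * (f x * gauss (?k m) (y - x)))"
      by (rule integral_complex_of_real)
    also have "(LINT x|lborel. sqrt (2 * pi) ^ CARD('n) * (f x * gauss (?k m) (y - x)))
        = sqrt (2 * pi) ^ CARD('n) * (LINT x|lborel. f x * gauss (?k m) (y - x))"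
      by (rule integral_mult_right_zero)
    finally show ?thesis by simp
  qed
  have lim1: "(\<lambda>m. LINT \<xi>|lborel. \<Phi> m \<xi> *\<^sub>R (F \<xi> * cis (y \<bullet> \<xi>))) \<longlonglongrightarrow>
      (LINT \<xi>|lborel. (1 / sqrt (2 * pi)) ^ CARD('n) *\<^sub>R (F \<xi> * cis (y \<bullet> \<xi>)))"
  proof (rule integral_dominated_convergence[where w="\<lambda>\<xi>. norm (F \<xi>)"])
    have lim\<Phi>: "(\<lambda>m. \<Phi> m \<xi>) \<longlonglongrightarrow> (1 / sqrt (2 * pi)) ^ CARD('n)" for \<xi>
    proof -
      have d: "(\<lambda>m. \<xi>$i / ?k m) \<longlonglongrightarrow> 0" for i
        using tendsto_mult_left[OF LIMSEQ_inverse_real_of_nat, of "\<xi>$i"] by (simp add: divide_inverse)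
      have "(\<lambda>m. std_normal_density (\<xi>$i / ?k m)) \<longlonglongrightarrow> 1 / sqrt (2 * pi)" for i
      proof -
        have "(\<lambda>m. 1 / sqrt (2 * pi) * exp (- (\<xi>$i / ?k m)\<^sup>2 / 2)) \<longlonglongrightarrow> 1 / sqrt (2 * pi) * exp (- 0\<^sup>2 / 2)"
          by (intro tendsto_intros d) simp
        then show ?thesis by (simp only: std_normal_density_def) simp
      qed
      then have "(\<lambda>m. \<Phi> m \<xi>) \<longlonglongrightarrow> (\<Prod>i\<in>(UNIV::'n set). 1 / sqrt (2 * pi))"
        unfolding \<Phi>_def by (intro tendsto_prod)
      then show ?thesis by simp
    qed
    show "AE \<xi> in lborel. (\<lambda>m. \<Phi> m \<xi> *\<^sub>R (F \<xi> * cis (y \<bullet> \<xi>))) \<longlonglongrightarrow> (1 / sqrt (2 * pi)) ^ CARD('n) *\<^sub>R (F \<xi> * cis (y \<bullet> \<xi>))"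
      by (intro AE_I2 tendsto_intros lim\<Phi>)
    show "AE \<xi> in lborel. norm (\<Phi> m \<xi> *\<^sub>R (F \<xi> * cis (y \<bullet> \<xi>))) \<le> norm (F \<xi>)" for m
      using \<Phi>_bound \<Phi>_nonneg by (auto simp: norm_mult intro!: AE_I2 mult_left_le_one_le)
    show "integrable lborel (\<lambda>\<xi>. norm (F \<xi>))" using F(1) by (rule integrable_norm)
  qed measurable
  have lim2: "(\<lambda>m. of_real (sqrt (2 * pi) ^ CARD('n)) * of_real (LINT x|lborel. f x * gauss (?k m) (y - x)))
      \<longlonglongrightarrow> of_real (sqrt (2 * pi) ^ CARD('n)) * complex_of_real (f y)"
    by (intro tendsto_intros gauss_approximate_identity[OF f cont])
  have "(LINT \<xi>|lborel. (1 / sqrt (2 * pi)) ^ CARD('n) *\<^sub>R (F \<xi> * cis (y \<bullet> \<xi>))) = of_real (sqrt (2 * pi) ^ CARD('n)) * complex_of_real (f y)"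
    using LIMSEQ_unique[OF lim1[unfolded key] lim2] .
  moreover have "(LINT \<xi>|lborel. (1 / sqrt (2 * pi)) ^ CARD('n) *\<^sub>R (F \<xi> * cis (y \<bullet> \<xi>))) = (1 / sqrt (2 * pi)) ^ CARD('n) *\<^sub>R fint F y"
    unfolding fint_def by (rule integral_scaleR_right)
  ultimately have "(1 / sqrt (2 * pi)) ^ CARD('n) *\<^sub>R fint F y = of_real (sqrt (2 * pi) ^ CARD('n)) * complex_of_real (f y)" by simp
  from arg_cong[OF this, of "\<lambda>c. sqrt (2 * pi) ^ CARD('n) *\<^sub>R c"]
  have *: "sqrt (2 * pi) ^ CARD('n) *\<^sub>R ((1 / sqrt (2 * pi)) ^ CARD('n) *\<^sub>R fint F y)
    = sqrt (2 * pi) ^ CARD('n) *\<^sub>R (of_real (sqrt (2 * pi) ^ CARD('n)) * complex_of_real (f y))" .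
  have "sqrt (2 * pi) ^ CARD('n) * (1 / sqrt (2 * pi)) ^ CARD('n) = 1"
    by (simp add: power_divide)
  with * have "fint F y = sqrt (2 * pi) ^ CARD('n) *\<^sub>R (of_real (sqrt (2 * pi) ^ CARD('n)) * complex_of_real (f y))"
    unfolding scaleR_scaleR by (simp only: scaleR_one)
  also have "\<dots> = of_real (sqrt (2 * pi) ^ CARD('n) * sqrt (2 * pi) ^ CARD('n) * f y)"
    by (simp only: of_real_mult mult.assoc scaleR_conv_of_real)
  also have "sqrt (2 * pi) ^ CARD('n) * sqrt (2 * pi) ^ CARD('n) = (2 * pi) ^ CARD('n)"
    unfolding power_mult_distrib[symmetric] by simp
  finally show ?thesis .
qed

section \<open>Integrable radial singularities\<close>

text \<open>One-dimensional majorants whose products over the coordinates dominate radial functions,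
  so that Fubini replaces polar coordinates. The denominator provides integrability at infinity,
  \<open>s < 1\<close> at 0.\<close>

definition kern :: "real \<Rightarrow> real \<Rightarrow> real" where
  "kern s t = \<bar>t\<bar> powr (- s) / (1 + t\<^sup>2)"

lemma kern_nonneg: "kern s t \<ge> 0"
  by (simp add: kern_def)

lemma integrable_powr_unit_interval:
  assumes "s < 1"
  shows "integrable lborel (\<lambda>t::real. indicator {0..1} t * t powr (- s))"
proof -
  have "(\<lambda>t. t powr (- s)) integrable_on {0..1::real}"
    using has_integral_powr_from_0[of "- s" 1] assms by (auto simp: has_integral_integrable)
  then have "(\<lambda>t. t powr (- s)) absolutely_integrable_on {0..1::real}"
    by (intro nonnegative_absolutely_integrable_1) auto
  then have "integrable lebesgue (\<lambda>t::real. indicator {0..1} t * t powr (- s))"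
    by (simp add: set_integrable_def)
  then show ?thesis
    by (subst (asm) integrable_completion) auto
qed

lemma kern_integrable:
  assumes "0 \<le> s" "s < 1"
  shows "integrable lborel (kern s)"
proof (rule Bochner_Integration.integrable_bound)
  let ?g = "\<lambda>t::real. indicator {0..1} t * t powr (- s)"
  have "integrable lborel (\<lambda>t. ?g (0 + (- 1) * t))"
    by (rule lborel_integrable_real_affine[OF integrable_powr_unit_interval[OF assms(2)]]) simp
  then show "integrable lborel (\<lambda>t. ?g t + ?g (0 + (- 1) * t) + inverse (1 + t\<^sup>2))"
    by (intro Bochner_Integration.integrable_add integrable_powr_unit_interval[OF assms(2)] integrable_inverse_one_plus_square)
  show "kern s \<in> borel_measurable lborel"
    unfolding kern_def[abs_def] by measurable
  have "kern s t \<le> ?g t + ?g (0 + (- 1) * t) + inverse (1 + t\<^sup>2)" for t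
  proof (cases "\<bar>t\<bar> \<le> 1")
    case True
    have "\<bar>t\<bar> powr (- s) / (1 + t\<^sup>2) \<le> \<bar>t\<bar> powr (- s) / 1" by (intro divide_left_mono) (auto simp: add_pos_nonneg)
    also have "\<dots> \<le> ?g t + ?g (0 + (- 1) * t)"
      using True by (cases "t \<ge> 0") (auto simp: indicator_def)
    finally have "kern s t \<le> ?g t + ?g (0 + (- 1) * t)" by (simp add: kern_def)
    moreover have "0 \<le> inverse (1 + t\<^sup>2)" by (simp add: add_nonneg_nonneg)
    ultimately show ?thesis by linarith
  next
    case False
    then have "\<bar>t\<bar> powr (- s) \<le> 1" using powr_mono[of "- s" 0 "\<bar>t\<bar>"] assms(1) by (cases "t = 0") auto
    then have "\<bar>t\<bar> powr (- s) / (1 + t\<^sup>2) \<le> 1 / (1 + t\<^sup>2)"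
      using False by (intro divide_right_mono) (auto simp: add_nonneg_nonneg)
    moreover have "0 \<le> ?g t + ?g (0 + (- 1) * t)" by (auto simp: indicator_def)
    ultimately show ?thesis unfolding kern_def inverse_eq_divide by linarith
  qed
  then have "norm (kern s t) \<le> norm (?g t + ?g (0 + (- 1) * t) + inverse (1 + t\<^sup>2))" for t
    unfolding real_norm_def abs_of_nonneg[OF kern_nonneg] by (rule order.trans[OF _ abs_ge_self])
  then show "AE t in lborel. norm (kern s t) \<le> norm (?g t + ?g (0 + (- 1) * t) + inverse (1 + t\<^sup>2))"
    by (intro AE_I2)
qed

text \<open>Scaled like an approximate identity: the integral does not depend on
  \<open>\<tau>\<close>. In dimension two with \<open>s = 0\<close> it dominates
  \<open>(\<tau> / ((norm x)\<^sup>2 + \<tau>\<^sup>2))\<^sup>2\<close>, the mass that the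
  logarithmic cutoff produces.\<close>

definition kernel_product :: "real \<Rightarrow> real \<Rightarrow> real^'n::finite \<Rightarrow> real" where
  "kernel_product s \<tau> x = (\<Prod>i\<in>UNIV. inverse \<tau> * kern s (x$i / \<tau>))"

lemma kernel_product_integral:
  assumes "0 \<le> s" "s < 1" "\<tau> > 0"
  shows "integrable lborel (kernel_product s \<tau> :: real^'n::finite \<Rightarrow> real)"
    "(LINT x|lborel. kernel_product s \<tau> (x::real^'n)) = (LINT t|lborel. kern s t) ^ CARD('n)"
proof -
  have 1: "integrable lborel (\<lambda>t. inverse \<tau> * kern s (t / \<tau>))"
    using lborel_integrable_real_affine[OF kern_integrable[OF assms(1,2)], of "inverse \<tau>" 0] assms(3)
    by (simp add: divide_inverse_commute)
  have 2: "(LINT t|lborel. inverse \<tau> * kern s (t / \<tau>)) = (LINT t|lborel. kern s t)"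
    using lborel_integral_real_affine[of "inverse \<tau>" "kern s" 0] assms(3)
    by (simp add: divide_inverse_commute)
  show "integrable lborel (kernel_product s \<tau> :: real^'n \<Rightarrow> real)"
    unfolding kernel_product_def[abs_def] by (rule integrable_lborel_prod) (rule 1)
  show "(LINT x|lborel. kernel_product s \<tau> (x::real^'n)) = (LINT t|lborel. kern s t) ^ CARD('n)"
    unfolding kernel_product_def using integral_lborel_prod[of "\<lambda>_ t. inverse \<tau> * kern s (t / \<tau>)", OF 1] 2 by simp
qed

lemma AE_components_nonzero: "AE x in lborel. \<forall>i. (x::real^'n::finite)$i \<noteq> 0"
proof -
  have "AE x in lborel. (x::real^'n)$i \<noteq> 0" for i
  proof -
    have "closed {x::real^'n. x$i = 0}" by (intro closed_Collect_eq continuous_intros)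
    then have "{x::real^'n. x$i = 0} \<in> sets lborel" by simp
    moreover have "{x::real^'n. x$i = 0} \<in> null_sets lebesgue"
      using negligible_standard_hyperplane_cart[of i] by (simp add: negligible_iff_null_sets)
    ultimately have "{x::real^'n. x$i = 0} \<in> null_sets lborel"
      by (simp add: null_sets_completion_iff)
    then show ?thesis by (rule AE_I') auto
  qed
  then show ?thesis by (simp add: AE_all_countable)
qed

text \<open>The hypothesis on the components is needed: \<open>0 powr (- s) = 0\<close>, so the kernels vanish instead of
  blowing up on the coordinate hyperplanes.\<close>

lemma radial_le_kernel_product:
  fixes x :: "real^'n::finite"
  assumes "\<tau> > 0" "s \<ge> 0" "\<And>i. x$i \<noteq> 0"
  shows "(norm x / \<tau>) powr (- (real CARD('n) * s)) * (\<tau> / ((norm x)\<^sup>2 + \<tau>\<^sup>2)) ^ CARD('n) \<le> kernel_product s \<tau> x"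
proof -
  have x: "x \<noteq> 0" using assms(3) by auto
  have "(norm x / \<tau>) powr (- (real CARD('n) * s)) = ((norm x / \<tau>) powr (- s)) ^ CARD('n)"
    using x assms(1) by (simp add: powr_powr powr_realpow[symmetric] mult.commute)
  then have "(norm x / \<tau>) powr (- (real CARD('n) * s)) * (\<tau> / ((norm x)\<^sup>2 + \<tau>\<^sup>2)) ^ CARD('n)
    = (\<Prod>i\<in>(UNIV::'n set). (norm x / \<tau>) powr (- s) * (\<tau> / ((norm x)\<^sup>2 + \<tau>\<^sup>2)))"
    by (simp only: prod_constant power_mult_distrib)
  also have "\<dots> \<le> kernel_product s \<tau> x"
    unfolding kernel_product_def
  proof (intro prod_mono conjI)
    fix i :: 'n
    show "0 \<le> (norm x / \<tau>) powr (- s) * (\<tau> / ((norm x)\<^sup>2 + \<tau>\<^sup>2))"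
      using assms(1) by (intro mult_nonneg_nonneg divide_nonneg_nonneg) (auto simp: add_nonneg_nonneg)
    have c: "\<bar>x$i\<bar> \<le> norm x" by (rule component_le_norm_cart)
    have c2: "(x$i)\<^sup>2 \<le> (norm x)\<^sup>2" using power_mono[OF c, of 2] by simp
    have "(norm x / \<tau>) powr (- s) \<le> (\<bar>x$i\<bar> / \<tau>) powr (- s)"
      using assms c by (intro powr_mono2') (auto simp: divide_right_mono)
    moreover have "\<tau> / ((norm x)\<^sup>2 + \<tau>\<^sup>2) \<le> \<tau> / ((x$i)\<^sup>2 + \<tau>\<^sup>2)"
      using assms(1) c2 by (intro divide_left_mono) (auto intro!: mult_pos_pos add_nonneg_pos)
    ultimately have "(norm x / \<tau>) powr (- s) * (\<tau> / ((norm x)\<^sup>2 + \<tau>\<^sup>2)) \<le> (\<bar>x$i\<bar> / \<tau>) powr (- s) * (\<tau> / ((x$i)\<^sup>2 + \<tau>\<^sup>2))"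
      using assms(1) by (intro mult_mono) (auto simp: add_nonneg_nonneg)
    also have "\<dots> = inverse \<tau> * kern s (x$i / \<tau>)"
    proof -
      have "\<tau> / ((x$i)\<^sup>2 + \<tau>\<^sup>2) = inverse \<tau> / (1 + (x$i / \<tau>)\<^sup>2)"
      proof -
        have "(x$i)\<^sup>2 + \<tau>\<^sup>2 = \<tau>\<^sup>2 * (1 + (x$i / \<tau>)\<^sup>2)" using assms(1) by (simp add: power_divide distrib_left)
        then show ?thesis using assms(1) by (simp add: power2_eq_square inverse_eq_divide)
      qed
      then show ?thesis using assms(1) by (simp add: kern_def)
    qed
    finally show "(norm x / \<tau>) powr (- s) * (\<tau> / ((norm x)\<^sup>2 + \<tau>\<^sup>2)) \<le> inverse \<tau> * kern s (x$i / \<tau>)" .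
  qed
  finally show ?thesis .
qed

lemma integrable_norm_powr_ball:
  assumes "0 \<le> s" "s < real CARD('n)"
  shows "integrable lborel (\<lambda>x::real^'n::finite. indicator (cball 0 1) x * norm x powr (- s))"
proof (rule Bochner_Integration.integrable_bound)
  \<comment> \<open>Splitting the exponent evenly over the coordinates leaves an exponent below 1 in
    each. On the unit ball \<open>1 / ((norm x)\<^sup>2 + 1)\<close> is at least 1/2, which explains
    \<open>2 ^ CARD('n)\<close>.\<close>
  define \<sigma> where "\<sigma> = s / real CARD('n)"
  have \<sigma>: "0 \<le> \<sigma>" "\<sigma> < 1" "s = real CARD('n) * \<sigma>" using assms by (auto simp: \<sigma>_def)
  show "integrable lborel (\<lambda>x::real^'n. 2 ^ CARD('n) * kernel_product \<sigma> 1 x)"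
    using kernel_product_integral(1)[OF \<sigma>(1,2), of 1] by simp
  show "AE x in lborel. norm (indicator (cball 0 1) x * norm x powr (- s)) \<le> norm (2 ^ CARD('n) * kernel_product \<sigma> 1 (x::real^'n))"
    using AE_components_nonzero
  proof eventually_elim
    fix x :: "real^'n" assume x: "\<forall>i. x$i \<noteq> 0"
    have kn: "0 \<le> kernel_product \<sigma> 1 x" unfolding kernel_product_def by (intro prod_nonneg) (auto simp: kern_nonneg)
    show "norm (indicator (cball 0 1) x * norm x powr (- s)) \<le> norm (2 ^ CARD('n) * kernel_product \<sigma> 1 x)"
    proof (cases "norm x \<le> 1")
      case True
      have "1 / 2 \<le> 1 / ((norm x)\<^sup>2 + 1)"
        using True by (intro divide_left_mono) (auto simp: power_le_one add_nonneg_pos)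
      then have "(1 / 2) ^ CARD('n) \<le> (1 / ((norm x)\<^sup>2 + 1\<^sup>2)) ^ CARD('n)" by (intro power_mono) auto
      then have "norm x powr (- s) * (1 / 2) ^ CARD('n) \<le> (norm x / 1) powr (- s) * (1 / ((norm x)\<^sup>2 + 1\<^sup>2)) ^ CARD('n)"
        by (intro mult_mono) auto
      also have "\<dots> \<le> kernel_product \<sigma> 1 x"
        unfolding \<sigma>(3) by (rule radial_le_kernel_product) (use \<sigma>(1) x in auto)
      finally have "norm x powr (- s) * (1 / 2) ^ CARD('n) * 2 ^ CARD('n) \<le> kernel_product \<sigma> 1 x * 2 ^ CARD('n)"
        by (intro mult_right_mono) auto
      moreover have "norm x powr (- s) * (1 / 2) ^ CARD('n) * 2 ^ CARD('n) = norm x powr (- s)"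
        unfolding mult.assoc power_mult_distrib[symmetric] by simp
      ultimately have "norm x powr (- s) \<le> 2 ^ CARD('n) * kernel_product \<sigma> 1 x"
        by (simp only: mult.commute[of "2 ^ CARD('n)"])
      moreover have "0 \<le> 2 ^ CARD('n) * kernel_product \<sigma> 1 x" using kn by simp
      ultimately show ?thesis using True by (simp only: real_norm_def abs_of_nonneg) simp
    qed (use kn in simp)
  qed
  have [measurable]: "cball (0::real^'n) 1 \<in> sets borel" by simp
  show "(\<lambda>x::real^'n. indicator (cball 0 1) x * norm x powr (- s)) \<in> borel_measurable lborel"
    by measurable
qed

section \<open>The parametrix of an elliptic operator\<close>

text \<open>The coefficients live on the open set \<open>D\<close>, while test functions and
  amplitudes are supported in the compact subset \<open>K\<close>. They thus vanish near the
  boundary of \<open>D\<close>, and extension by zero is harmless.\<close>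

locale elliptic_operator =
  fixes D K :: "(real^'n::finite) set" and a :: "'n \<Rightarrow> 'n \<Rightarrow> real^'n \<Rightarrow> real" and \<mu> :: real
  assumes D: "open D" and K: "compact K" "K \<subseteq> D"
    and smooth: "\<And>i j. smooth_on (a i j) D"
    and elliptic: "\<mu> > 0" "\<And>x \<xi>. x \<in> D \<Longrightarrow> \<mu> * (norm \<xi>)\<^sup>2 \<le> (\<Sum>i\<in>UNIV. \<Sum>j\<in>UNIV. a i j x * (\<xi>$i * \<xi>$j))"
begin

text \<open>The principal symbol up to sign: when both derivatives fall on
  \<open>wave \<xi>\<close>, the factor \<open>- p x \<xi>\<close> results.\<close>

definition p :: "real^'n \<Rightarrow> real^'n \<Rightarrow> real" where
  "p x \<xi> = (\<Sum>i\<in>UNIV. \<Sum>j\<in>UNIV. a i j x * (\<xi>$i * \<xi>$j))"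

text \<open>The formal adjoint \<open>\<partial>\<^sub>i\<partial>\<^sub>j(a\<^sub>i\<^sub>j \<psi>)\<close> of \<open>a\<^sub>i\<^sub>j\<partial>\<^sub>i\<partial>\<^sub>j\<close>, expanded by the product rule.\<close>

definition adj :: "(real^'n \<Rightarrow> 'b::real_normed_vector) \<Rightarrow> ('n \<Rightarrow> real^'n \<Rightarrow> 'b) \<Rightarrow> ('n \<Rightarrow> 'n \<Rightarrow> real^'n \<Rightarrow> 'b)
    \<Rightarrow> real^'n \<Rightarrow> 'b" where
  "adj \<psi> \<psi>1 \<psi>2 x = (\<Sum>i\<in>UNIV. \<Sum>j\<in>UNIV. a i j x *\<^sub>R \<psi>2 i j x + pd j (a i j) x *\<^sub>R \<psi>1 i x
     + (pd i (a i j) x *\<^sub>R \<psi>1 j x + pd j (pd i (a i j)) x *\<^sub>R \<psi> x))"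

text \<open>The order \<open>d\<close> bounds the growth \<open>|\<xi>|\<^sup>d\<close> for \<open>|\<xi>| \<ge> 1\<close> only, so it may be raised. Products with
  coefficients and \<open>x\<close>-derivatives stay in the class, which makes an explicit symbol calculus unnecessary.\<close>

inductive symb :: "int \<Rightarrow> (real^'n \<Rightarrow> real^'n \<Rightarrow> complex) \<Rightarrow> bool" where
  symb_base: "smooth_on f D \<Longrightarrow> (\<And>x. x \<notin> K \<Longrightarrow> f x = 0) \<Longrightarrow> symb 0 (\<lambda>x \<xi>. f x)"
| symb_add: "symb d s \<Longrightarrow> symb d t \<Longrightarrow> symb d (\<lambda>x \<xi>. s x \<xi> + t x \<xi>)"
| symb_xi: "symb d s \<Longrightarrow> symb (d + 1) (\<lambda>x \<xi>. (\<xi>$i) *\<^sub>R s x \<xi>)"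
| symb_div: "symb d s \<Longrightarrow> symb (d - 2) (\<lambda>x \<xi>. inverse (p x \<xi>) *\<^sub>R s x \<xi>)"
| symb_raise: "symb d s \<Longrightarrow> symb (d + 1) s"

lemma symb_zero: "symb d s \<Longrightarrow> x \<notin> K \<Longrightarrow> s x \<xi> = 0"
  by (induction rule: symb.induct) auto

text \<open>A coefficient is smooth on \<open>D\<close> only; it is pushed through the constructors
  down to a base function, whose support in \<open>K\<close> it preserves.\<close>

lemma symb_mult:
  assumes "symb d s" "smooth_on g D"
  shows "symb d (\<lambda>x \<xi>. g x * s x \<xi>)"
  using assms(1)
proof induction
  case (symb_base f)
  then show ?case
    using assms(2) by (intro symb.symb_base smooth_on_mult D) auto
next
  case (symb_add d s t)
  from symb.symb_add[OF symb_add.IH] show ?case by (simp add: distrib_left)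
next
  case (symb_xi d s i)
  from symb.symb_xi[OF symb_xi.IH, of i] show ?case by simp
next
  case (symb_div d s)
  from symb.symb_div[OF symb_div.IH] show ?case by simp
next
  case (symb_raise d s)
  then show ?case by (intro symb.symb_raise)
qed

lemma symb_cmult: "symb d s \<Longrightarrow> symb d (\<lambda>x \<xi>. c * s x \<xi>)"
  by (rule symb_mult[OF _ smooth_on_const])

lemma symb_scaleR:
  assumes "symb d s" "smooth_on (g :: real^'n \<Rightarrow> real) D"
  shows "symb d (\<lambda>x \<xi>. g x *\<^sub>R s x \<xi>)"
  using symb_mult[OF assms(1) smooth_on_compose_linear[OF bounded_linear_of_real D assms(2)]]
  by (simp add: scaleR_conv_of_real)

lemma symb_sum:
  assumes "\<And>i. symb d (s i)"
  shows "symb d (\<lambda>x \<xi>. \<Sum>i\<in>(I::'i set). s i x \<xi>)"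
proof (induction I rule: infinite_finite_induct)
  case (infinite A)
  from symb_cmult[OF assms, of 0] infinite show ?case by simp
next
  case empty
  from symb_cmult[OF assms, of 0] show ?case by simp
next
  case (insert i I)
  from symb_add[OF assms insert.IH] insert.hyps show ?case by simp
qed

lemma p_lower: "x \<in> D \<Longrightarrow> \<mu> * (norm \<xi>)\<^sup>2 \<le> p x \<xi>"
  using elliptic(2) by (simp add: p_def)

lemma p_pos: "x \<in> D \<Longrightarrow> \<xi> \<noteq> 0 \<Longrightarrow> p x \<xi> > 0"
  by (rule less_le_trans[OF _ p_lower]) (use elliptic(1) in auto)

text \<open>Compactness of \<open>K\<close> makes the constant uniform in \<open>x\<close>.
  Ellipticity enters at the division, through
  \<open>\<mu> * (norm \<xi>)\<^sup>2 \<le> p x \<xi>\<close> on \<open>D\<close>; off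
  \<open>K\<close> the symbol vanishes, whatever the value of \<open>p\<close>.\<close>

lemma symb_bound:
  assumes "symb d s"
  shows "\<exists>C\<ge>0. \<forall>x \<xi>. norm \<xi> \<ge> 1 \<longrightarrow> norm (s x \<xi>) \<le> C * norm \<xi> powi d"
  using assms
proof induction
  case (symb_base f)
  have "continuous_on K f"
    using continuous_on_subset[OF smooth_on_continuous[OF symb_base(1)] K(2)] .
  then have "bounded (f ` K)"
    using compact_imp_bounded compact_continuous_image K(1) by blast
  then obtain C where C: "C > 0" "\<And>x. x \<in> K \<Longrightarrow> norm (f x) \<le> C"
    unfolding bounded_pos by auto
  have "norm (f x) \<le> C" for x
    using C symb_base(2) by (cases "x \<in> K") auto
  then show ?case using C(1) by (auto intro!: exI[of _ C])
next
  case (symb_add d s t)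
  then obtain C1 C2 where C: "C1 \<ge> 0" "C2 \<ge> 0"
    "\<And>x \<xi>. norm \<xi> \<ge> 1 \<Longrightarrow> norm (s x \<xi>) \<le> C1 * norm \<xi> powi d"
    "\<And>x \<xi>. norm \<xi> \<ge> 1 \<Longrightarrow> norm (t x \<xi>) \<le> C2 * norm \<xi> powi d" by auto
  have "norm (s x \<xi> + t x \<xi>) \<le> (C1 + C2) * norm \<xi> powi d" if "norm \<xi> \<ge> 1" for x \<xi>
    using norm_triangle_ineq[of "s x \<xi>" "t x \<xi>"] C(3,4)[OF that, of x] by (simp add: distrib_right)
  then show ?case using C(1,2) by (intro exI[of _ "C1 + C2"]) auto
next
  case (symb_xi d s i)
  then obtain C where C: "C \<ge> 0"
    "\<And>x \<xi>. norm \<xi> \<ge> 1 \<Longrightarrow> norm (s x \<xi>) \<le> C * norm \<xi> powi d" by auto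
  have "norm ((\<xi>$i) *\<^sub>R s x \<xi>) \<le> C * norm \<xi> powi (d + 1)" if "norm \<xi> \<ge> 1" for x \<xi>
  proof -
    have "norm ((\<xi>$i) *\<^sub>R s x \<xi>) \<le> norm \<xi> * (C * norm \<xi> powi d)"
      using C(2)[OF that, of x] component_le_norm_cart[of \<xi> i] by (simp add: mult_mono)
    also have "\<dots> = C * norm \<xi> powi (d + 1)"
      using that by (subst power_int_add_1) (auto simp: mult_ac)
    finally show ?thesis .
  qed
  then show ?case using C(1) by auto
next
  case (symb_div d s)
  then obtain C where C: "C \<ge> 0"
    "\<And>x \<xi>. norm \<xi> \<ge> 1 \<Longrightarrow> norm (s x \<xi>) \<le> C * norm \<xi> powi d" by auto
  have "norm (inverse (p x \<xi>) *\<^sub>R s x \<xi>) \<le> (C / \<mu>) * norm \<xi> powi (d - 2)" if "norm \<xi> \<ge> 1" for x \<xi>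
  proof (cases "x \<in> K")
    case True
    then have x: "x \<in> D" using K by auto
    have \<xi>: "\<xi> \<noteq> 0" using that by auto
    have "norm (inverse (p x \<xi>) *\<^sub>R s x \<xi>) = norm (s x \<xi>) / p x \<xi>"
      using p_pos[OF x \<xi>] by (simp add: divide_inverse_commute)
    also have "\<dots> \<le> (C * norm \<xi> powi d) / (\<mu> * (norm \<xi>)\<^sup>2)"
      using C(2)[OF that, of x] p_lower[OF x, of \<xi>] elliptic(1) \<xi> C(1)
      by (intro frac_le) auto
    also have "\<dots> = (C / \<mu>) * norm \<xi> powi (d - 2)"
      using \<xi> by (simp add: power_int_diff)
    finally show ?thesis .
  next
    case False
    then show ?thesis using symb_zero[OF symb_div.hyps(1)] C(1) elliptic(1) by simp
  qed
  then show ?case using C(1) elliptic(1) by (intro exI[of _ "C / \<mu>"]) auto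
next
  case (symb_raise d s)
  then obtain C where C: "C \<ge> 0"
    "\<And>x \<xi>. norm \<xi> \<ge> 1 \<Longrightarrow> norm (s x \<xi>) \<le> C * norm \<xi> powi d" by auto
  have "norm (s x \<xi>) \<le> C * norm \<xi> powi (d + 1)" if "norm \<xi> \<ge> 1" for x \<xi>
  proof -
    have "C * norm \<xi> powi d \<le> C * norm \<xi> powi (d + 1)"
      using C(1) that by (intro mult_left_mono power_int_increasing) auto
    then show ?thesis using C(2)[OF that, of x] by simp
  qed
  then show ?case using C(1) by auto
qed

lemma p_has_partials:
  assumes "x \<in> D"
  shows "has_partials (\<lambda>x. p x \<xi>) (\<lambda>l. \<Sum>i\<in>UNIV. \<Sum>j\<in>UNIV. pd l (a i j) x * (\<xi>$i * \<xi>$j)) x"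
proof -
  have "has_partials (\<lambda>x. a i j x * (\<xi>$i * \<xi>$j)) (\<lambda>l. pd l (a i j) x * (\<xi>$i * \<xi>$j)) x" for i j
    using has_partials_mult[OF has_partials_smooth[OF smooth assms] has_partials_const] by simp
  then show ?thesis unfolding p_def by (intro has_partials_sum)
qed

text \<open>Differentiation in \<open>x\<close> does not raise the order. The critical case is the
  quotient: the derivative of \<open>inverse (p x \<xi>)\<close> brings two factors of \<xi> from
  the derivative of \<open>p\<close> and two divisions by \<open>p\<close>, so the order is d + 2 -
  4 = d - 2 as before.\<close>

lemma symb_deriv:
  assumes "symb d s"
  shows "\<exists>t. (\<forall>l. symb d (t l)) \<and>
    (\<forall>\<xi> x. \<xi> \<noteq> 0 \<longrightarrow> x \<in> D \<longrightarrow> has_partials (\<lambda>x. s x \<xi>) (\<lambda>l. t l x \<xi>) x)"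
  using assms
proof induction
  case (symb_base f)
  have "pd l f x = 0" if "x \<notin> K" for x l
  proof (cases "x \<in> D")
    case True
    show ?thesis
      by (rule has_partials_zero_outside[OF _ symb_base(2) that has_partials_smooth[OF symb_base(1) True]])
        (use K in \<open>auto simp: compact_imp_closed\<close>)
  next
    case False
    have "has_partials f (\<lambda>_. 0) x"
      by (rule has_partials_transform[OF has_partials_const[of 0], of "- K"])
        (use K that symb_base(2) in \<open>auto simp: compact_imp_closed open_Compl\<close>)
    then show ?thesis by (rule pd_eq)
  qed
  then have "symb 0 (\<lambda>x \<xi>. pd l f x)" for l
    by (intro symb.symb_base smooth_on_pd symb_base(1))
  then show ?case
    by (intro exI[of _ "\<lambda>l x \<xi>. pd l f x"]) (auto intro: has_partials_smooth[OF symb_base(1)])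
next
  case (symb_add d s t)
  then obtain s' t' where "\<forall>l. symb d (s' l)" "\<forall>l. symb d (t' l)"
    "\<forall>\<xi> x. \<xi> \<noteq> 0 \<longrightarrow> x \<in> D \<longrightarrow> has_partials (\<lambda>x. s x \<xi>) (\<lambda>l. s' l x \<xi>) x"
    "\<forall>\<xi> x. \<xi> \<noteq> 0 \<longrightarrow> x \<in> D \<longrightarrow> has_partials (\<lambda>x. t x \<xi>) (\<lambda>l. t' l x \<xi>) x" by auto
  then show ?case
    by (intro exI[of _ "\<lambda>l x \<xi>. s' l x \<xi> + t' l x \<xi>"]) (auto intro: has_partials_add symb.symb_add)
next
  case (symb_xi d s i)
  then obtain s' where "\<forall>l. symb d (s' l)"
    "\<forall>\<xi> x. \<xi> \<noteq> 0 \<longrightarrow> x \<in> D \<longrightarrow> has_partials (\<lambda>x. s x \<xi>) (\<lambda>l. s' l x \<xi>) x" by auto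
  then show ?case
    by (intro exI[of _ "\<lambda>l x \<xi>. (\<xi>$i) *\<^sub>R s' l x \<xi>"])
      (auto intro!: has_partials_linear[OF bounded_linear_scaleR_right] symb.symb_xi)
next
  case (symb_div d s)
  then obtain s' where s': "\<And>l. symb d (s' l)"
    "\<And>\<xi> x. \<xi> \<noteq> 0 \<Longrightarrow> x \<in> D \<Longrightarrow> has_partials (\<lambda>x. s x \<xi>) (\<lambda>l. s' l x \<xi>) x" by auto
  define p' where "p' l x \<xi> = (\<Sum>i\<in>UNIV. \<Sum>j\<in>UNIV. pd l (a i j) x * (\<xi>$i * \<xi>$j))" for l x \<xi>
  define t where "t l x \<xi> = inverse (p x \<xi>) *\<^sub>R s' l x \<xi> + (- 1) * (inverse (p x \<xi>) *\<^sub>R (inverse (p x \<xi>) *\<^sub>R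
     (\<Sum>i\<in>UNIV. \<Sum>j\<in>UNIV. (\<xi>$i) *\<^sub>R ((\<xi>$j) *\<^sub>R (pd l (a i j) x *\<^sub>R s x \<xi>)))))" for l x \<xi>
  have "symb (d - 2) (t l)" for l
  proof -
    have "symb (d + 1 + 1) (\<lambda>x \<xi>. \<Sum>i\<in>UNIV. \<Sum>j\<in>UNIV. (\<xi>$i) *\<^sub>R ((\<xi>$j) *\<^sub>R (pd l (a i j) x *\<^sub>R s x \<xi>)))"
      by (intro symb_sum symb.symb_xi symb_scaleR symb_div.hyps smooth_on_pd smooth)
    from symb_cmult[OF symb.symb_div[OF symb.symb_div[OF this]], of "- 1"]
    have "symb (d - 2) (\<lambda>x \<xi>. (- 1) * (inverse (p x \<xi>) *\<^sub>R (inverse (p x \<xi>) *\<^sub>R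
       (\<Sum>i\<in>UNIV. \<Sum>j\<in>UNIV. (\<xi>$i) *\<^sub>R ((\<xi>$j) *\<^sub>R (pd l (a i j) x *\<^sub>R s x \<xi>))))))" by simp
    then show ?thesis unfolding t_def[abs_def] by (intro symb.symb_add symb.symb_div s')
  qed
  moreover have "has_partials (\<lambda>x. inverse (p x \<xi>) *\<^sub>R s x \<xi>) (\<lambda>l. t l x \<xi>) x" if "\<xi> \<noteq> 0" "x \<in> D" for \<xi> x
  proof -
    have "has_partials (\<lambda>x. p x \<xi>) (\<lambda>l. p' l x \<xi>) x"
      unfolding p'_def by (rule p_has_partials[OF that(2)])
    then have "has_partials (\<lambda>x. inverse (p x \<xi>)) (\<lambda>l. - (p' l x \<xi> * (inverse (p x \<xi>) * inverse (p x \<xi>)))) x"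
      using p_pos[OF that(2,1)] by (intro has_partials_inverse) auto
    from has_partials_scaleR[OF this s'(2)[OF that]]
    have "has_partials (\<lambda>x. inverse (p x \<xi>) *\<^sub>R s x \<xi>)
      (\<lambda>l. inverse (p x \<xi>) *\<^sub>R s' l x \<xi> + - (p' l x \<xi> * (inverse (p x \<xi>) * inverse (p x \<xi>))) *\<^sub>R s x \<xi>) x" .
    moreover have "t l x \<xi> = inverse (p x \<xi>) *\<^sub>R s' l x \<xi> + - (p' l x \<xi> * (inverse (p x \<xi>) * inverse (p x \<xi>))) *\<^sub>R s x \<xi>" for l
      unfolding t_def p'_def by (simp add: scaleR_sum_left scaleR_sum_right sum_distrib_left sum_negf mult_ac)
    ultimately show ?thesis by simp
  qed
  ultimately show ?case by (intro exI[of _ t]) auto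
next
  case (symb_raise d s)
  then show ?case using symb.symb_raise by blast
qed

section \<open>Oscillating test functions\<close>

definition wave :: "real^'n \<Rightarrow> real^'n \<Rightarrow> complex" where
  "wave \<xi> x = cis (- (x \<bullet> \<xi>))"

lemma norm_wave [simp]: "norm (wave \<xi> x) = 1"
  by (simp add: wave_def)

lemma wave_has_partials: "has_partials (wave \<xi>) (\<lambda>l. wave \<xi> x * (- \<i> * (\<xi>$l))) x"
proof -
  have "has_partials (\<lambda>x. x \<bullet> \<xi>) (\<lambda>l. \<Sum>i\<in>UNIV. (if l = i then 1 else 0) * (\<xi>$i)) x"
    unfolding inner_vec_def
    by (intro has_partials_sum)
      (use has_partials_mult[OF has_partials_component has_partials_const] in \<open>simp\<close>)
  moreover have "(\<Sum>i\<in>UNIV. (if l = i then 1 else 0) * (\<xi>$i)) = \<xi>$l" for l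
    by (simp add: if_distrib[where f="\<lambda>c. c * _"] cong: if_cong)
  ultimately have "has_partials (\<lambda>x. x \<bullet> \<xi>) (\<lambda>l. \<xi>$l) x" by simp
  from has_partials_minus[OF this]
  have 1: "has_partials (\<lambda>x. - (x \<bullet> \<xi>)) (\<lambda>l. - \<xi>$l) x" .
  have "(cis has_vector_derivative (\<i> * cis t)) (at t)" for t
  proof -
    have "((\<lambda>t. exp (\<i> * of_real t)) has_vector_derivative (\<i> * exp (\<i> * of_real t))) (at t)"
      by (rule has_vector_derivative_real_field) (auto intro!: derivative_eq_intros)
    moreover have "cis = (\<lambda>t. exp (\<i> * of_real t))" by (simp add: fun_eq_iff cis_conv_exp)
    ultimately show ?thesis by (simp add: cis_conv_exp)
  qed
  from has_partials_chain[OF 1 this] show ?thesis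
    unfolding wave_def[abs_def] by (simp add: scaleR_conv_of_real mult_ac)
qed

text \<open>Only the principal term raises the order by two.\<close>

lemma adj_wave:
  assumes s: "symb d s"
  shows "\<exists>t. symb (d + 1) t \<and> (\<forall>\<xi>. \<xi> \<noteq> 0 \<longrightarrow> (\<exists>\<psi>1 \<psi>2. hasC2 D (\<lambda>x. wave \<xi> x * s x \<xi>) \<psi>1 \<psi>2 \<and>
    (\<forall>x. adj (\<lambda>x. wave \<xi> x * s x \<xi>) \<psi>1 \<psi>2 x = wave \<xi> x * (t x \<xi> - p x \<xi> *\<^sub>R s x \<xi>))))"
proof -
  obtain r where r: "\<And>l. symb d (r l)"
    "\<And>\<xi> x. \<xi> \<noteq> 0 \<Longrightarrow> x \<in> D \<Longrightarrow> has_partials (\<lambda>x. s x \<xi>) (\<lambda>l. r l x \<xi>) x"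
    using symb_deriv[OF s] by auto
  have "\<forall>l. \<exists>q. (\<forall>m. symb d (q m)) \<and>
    (\<forall>\<xi> x. \<xi> \<noteq> 0 \<longrightarrow> x \<in> D \<longrightarrow> has_partials (\<lambda>x. r l x \<xi>) (\<lambda>m. q m x \<xi>) x)"
    using symb_deriv[OF r(1)] by blast
  then obtain q where q: "\<And>l m. symb d (q l m)"
    "\<And>l \<xi> x. \<xi> \<noteq> 0 \<Longrightarrow> x \<in> D \<Longrightarrow> has_partials (\<lambda>x. r l x \<xi>) (\<lambda>m. q l m x \<xi>) x"
    by metis
  \<comment> \<open>\<open>t\<close> collects the terms of \<open>adj\<close> in which the wave is
    differentiated at most once, each such derivative giving \<open>- \<i> * (\<xi>$l)\<close>. The
    terms with two derivatives on the wave add up to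
    \<open>- p x \<xi> *\<^sub>R s x \<xi>\<close>.\<close>
  define t where "t x \<xi> = (\<Sum>i\<in>UNIV. \<Sum>j\<in>UNIV.
      a i j x *\<^sub>R q i j x \<xi> + (- \<i>) * ((\<xi>$i) *\<^sub>R (a i j x *\<^sub>R r j x \<xi>)) + (- \<i>) * ((\<xi>$j) *\<^sub>R (a i j x *\<^sub>R r i x \<xi>))
      + (pd j (a i j) x *\<^sub>R r i x \<xi> + (- \<i>) * ((\<xi>$i) *\<^sub>R (pd j (a i j) x *\<^sub>R s x \<xi>)))
      + (pd i (a i j) x *\<^sub>R r j x \<xi> + (- \<i>) * ((\<xi>$j) *\<^sub>R (pd i (a i j) x *\<^sub>R s x \<xi>)))
      + pd j (pd i (a i j)) x *\<^sub>R s x \<xi>)" for x \<xi>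
  have t: "symb (d + 1) t"
    unfolding t_def[abs_def]
    by (intro symb_sum symb_add symb_cmult symb_xi symb_scaleR smooth smooth_on_pd s r(1);
        intro symb_raise symb_scaleR smooth smooth_on_pd s r(1) q(1))
  define \<psi>1 where "\<psi>1 \<xi> l x = wave \<xi> x * (r l x \<xi> - \<i> * (\<xi>$l) * s x \<xi>)" for \<xi> l x
  define \<psi>2 where "\<psi>2 \<xi> l m x = wave \<xi> x * (q l m x \<xi> - \<i> * (\<xi>$l) * r m x \<xi> - \<i> * (\<xi>$m) * r l x \<xi>
    - (\<xi>$l) * (\<xi>$m) * s x \<xi>)" for \<xi> l m x
  have "hasC2 D (\<lambda>x. wave \<xi> x * s x \<xi>) (\<psi>1 \<xi>) (\<psi>2 \<xi>)" if \<xi>: "\<xi> \<noteq> 0" for \<xi>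
  proof -
    have 1: "has_partials (\<lambda>x. wave \<xi> x * s x \<xi>) (\<lambda>l. \<psi>1 \<xi> l x) x" if "x \<in> D" for x
      using has_partials_mult[OF wave_has_partials r(2)[OF \<xi> that]]
      unfolding \<psi>1_def by (simp add: algebra_simps)
    have 2: "has_partials (\<psi>1 \<xi> l) (\<lambda>m. \<psi>2 \<xi> l m x) x" if "x \<in> D" for x l
    proof -
      have "has_partials (\<lambda>x. r l x \<xi> - \<i> * (\<xi>$l) * s x \<xi>) (\<lambda>m. q l m x \<xi> - \<i> * (\<xi>$l) * r m x \<xi>) x"
        by (intro has_partials_diff has_partials_linear[OF bounded_linear_mult_right] q(2) r(2) \<xi> that)
      from has_partials_mult[OF wave_has_partials this]
      show ?thesis unfolding \<psi>1_def[abs_def] \<psi>2_def by (simp add: algebra_simps)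
    qed
    have cont: "continuous_on D (\<lambda>x. u x \<xi>)" if u: "symb d u" for u
    proof -
      obtain u' where "\<And>x. x \<in> D \<Longrightarrow> has_partials (\<lambda>x. u x \<xi>) (\<lambda>l. u' l x \<xi>) x"
        using symb_deriv[OF u] \<xi> by blast
      then show ?thesis by (meson continuous_at_imp_continuous_on has_partials_continuous)
    qed
    have "continuous_on D (wave \<xi>)"
      by (intro continuous_at_imp_continuous_on ballI has_partials_continuous[OF wave_has_partials])
    then have "continuous_on D (\<psi>2 \<xi> l m)" for l m
      using cont[OF q(1), of l m] cont[OF r(1), of l] cont[OF r(1), of m] cont[OF s]
      unfolding \<psi>2_def[abs_def] by (intro continuous_intros)
    then show ?thesis using 1 2 unfolding hasC2_def by blast
  qed
  moreover have "adj (\<lambda>x. wave \<xi> x * s x \<xi>) (\<psi>1 \<xi>) (\<psi>2 \<xi>) x = wave \<xi> x * (t x \<xi> - p x \<xi> *\<^sub>R s x \<xi>)" for \<xi> x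
  proof -
    have "adj (\<lambda>x. wave \<xi> x * s x \<xi>) (\<psi>1 \<xi>) (\<psi>2 \<xi>) x = (\<Sum>i\<in>UNIV. \<Sum>j\<in>UNIV. wave \<xi> x * (
      (a i j x *\<^sub>R q i j x \<xi> + (- \<i>) * ((\<xi>$i) *\<^sub>R (a i j x *\<^sub>R r j x \<xi>)) + (- \<i>) * ((\<xi>$j) *\<^sub>R (a i j x *\<^sub>R r i x \<xi>))
      + (pd j (a i j) x *\<^sub>R r i x \<xi> + (- \<i>) * ((\<xi>$i) *\<^sub>R (pd j (a i j) x *\<^sub>R s x \<xi>)))
      + (pd i (a i j) x *\<^sub>R r j x \<xi> + (- \<i>) * ((\<xi>$j) *\<^sub>R (pd i (a i j) x *\<^sub>R s x \<xi>)))
      + pd j (pd i (a i j)) x *\<^sub>R s x \<xi>) - (a i j x * (\<xi>$i * \<xi>$j)) *\<^sub>R s x \<xi>))"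
      unfolding adj_def \<psi>1_def \<psi>2_def
      by (intro sum.cong refl) (simp add: scaleR_conv_of_real algebra_simps)
    also have "\<dots> = wave \<xi> x * (t x \<xi> - p x \<xi> *\<^sub>R s x \<xi>)"
      unfolding t_def p_def by (simp only: sum_distrib_left sum_subtractf right_diff_distrib scaleR_sum_left)
    finally show ?thesis .
  qed
  ultimately show ?thesis using t by blast
qed

text \<open>The derivative families of a \<open>hasC2\<close> triple are unconstrained outside
  \<open>D\<close>; hence the guard \<open>x \<in> D\<close> in front of such integrands.\<close>

lemma integrable_mult_compact_support:
  fixes V :: "real^'n \<Rightarrow> real" and g :: "real^'n \<Rightarrow> 'b::euclidean_space"
  assumes V: "integrable lborel V" and g: "continuous_on D g" "\<And>x. x \<in> D \<Longrightarrow> x \<notin> K \<Longrightarrow> g x = 0"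
  shows "integrable lborel (\<lambda>x. if x \<in> D then V x *\<^sub>R g x else 0)"
proof -
  define G where "G x = (if x \<in> D then g x else 0)" for x
  have GK: "G x = 0" if "x \<notin> K" for x using g(2) that by (auto simp: G_def)
  have cont: "continuous_on K G"
    using continuous_on_subset[OF g(1) K(2)] K(2) continuous_on_cong[of K K G g] unfolding G_def by (metis (no_types, lifting) subsetD)
  have int: "integrable lborel G"
    using K(1) cont GK by (rule integrable_lborel_compact_support)
  obtain B where B: "B \<ge> 0" "\<And>x. x \<in> K \<Longrightarrow> norm (G x) \<le> B"
    by (rule compact_norm_bound[OF K(1) cont]) (rule that)
  have BG: "norm (G x) \<le> B" for x using B GK[of x] by (cases "x \<in> K") auto
  have "integrable lborel (\<lambda>x. V x *\<^sub>R G x)"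
  proof (rule Bochner_Integration.integrable_bound[of _ "\<lambda>x. B * V x"])
    show "integrable lborel (\<lambda>x. B * V x)" using V by simp
    show "(\<lambda>x. V x *\<^sub>R G x) \<in> borel_measurable lborel"
      using borel_measurable_integrable[OF V] borel_measurable_integrable[OF int] by measurable
    show "AE x in lborel. norm (V x *\<^sub>R G x) \<le> norm (B * V x)"
      using BG B(1) by (auto simp: abs_mult mult.commute[of B] intro!: mult_left_mono)
  qed
  moreover have "V x *\<^sub>R G x = (if x \<in> D then V x *\<^sub>R g x else 0)" for x by (simp add: G_def)
  ultimately show ?thesis by simp
qed

lemma integrable_mult_compact_support_everywhere:
  fixes V :: "real^'n \<Rightarrow> real" and g :: "real^'n \<Rightarrow> 'b::euclidean_space"
  assumes V: "integrable lborel V" and g: "continuous_on D g" "\<And>x. x \<notin> K \<Longrightarrow> g x = 0"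
  shows "integrable lborel (\<lambda>x. V x *\<^sub>R g x)"
proof -
  have "(if x \<in> D then V x *\<^sub>R g x else 0) = V x *\<^sub>R g x" for x
    using g(2)[of x] K(2) by auto
  then show ?thesis using integrable_mult_compact_support[OF V g(1,2)] by simp
qed

text \<open>For the amplitude \<open>s x \<xi> = \<eta> x\<close> this is the Fourier transform of
  \<open>V * \<eta>\<close>; amplitudes depending on \<xi> arise from the repeated use of
  \<open>osc_gain\<close>.\<close>

definition osc :: "(real^'n \<Rightarrow> real) \<Rightarrow> (real^'n \<Rightarrow> real^'n \<Rightarrow> complex) \<Rightarrow> real^'n \<Rightarrow> complex" where
  "osc V s \<xi> = (LINT x|lborel. V x *\<^sub>R (wave \<xi> x * s x \<xi>))"

lemma osc_integrable:
  assumes "integrable lborel V" "symb d s" "\<xi> \<noteq> 0"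
  shows "integrable lborel (\<lambda>x. V x *\<^sub>R (wave \<xi> x * s x \<xi>))"
proof (rule integrable_mult_compact_support_everywhere[OF assms(1)])
  obtain \<psi>1 \<psi>2 where "hasC2 D (\<lambda>x. wave \<xi> x * s x \<xi>) \<psi>1 \<psi>2"
    using adj_wave[OF assms(2)] assms(3) by blast
  then show "continuous_on D (\<lambda>x. wave \<xi> x * s x \<xi>)" by (rule hasC2D)
qed (simp add: symb_zero[OF assms(2)])

text \<open>Testing the weak equation with \<open>wave \<xi> * s / p\<close> reproduces \<open>s\<close> from the principal part and leaves
  a symbol of one order less.\<close>

lemma osc_gain:
  assumes V: "integrable lborel V"
    and weak: "\<And>(\<psi>::real^'n \<Rightarrow> complex) \<psi>1 \<psi>2. hasC2 D \<psi> \<psi>1 \<psi>2 \<Longrightarrow> (\<And>x. x \<notin> K \<Longrightarrow> \<psi> x = 0) \<Longrightarrow>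
      (LINT x|lborel. V x *\<^sub>R (if x \<in> D then adj \<psi> \<psi>1 \<psi>2 x else 0)) = 0"
    and s: "symb d s"
  shows "\<exists>t. symb (d - 1) t \<and> (\<forall>\<xi>. \<xi> \<noteq> 0 \<longrightarrow> osc V s \<xi> = osc V t \<xi>)"
proof -
  obtain t where t: "symb (d - 1) t" and t':
    "\<And>\<xi>. \<xi> \<noteq> 0 \<Longrightarrow> \<exists>\<psi>1 \<psi>2. hasC2 D (\<lambda>x. wave \<xi> x * (inverse (p x \<xi>) *\<^sub>R s x \<xi>)) \<psi>1 \<psi>2 \<and>
    (\<forall>x. adj (\<lambda>x. wave \<xi> x * (inverse (p x \<xi>) *\<^sub>R s x \<xi>)) \<psi>1 \<psi>2 x
      = wave \<xi> x * (t x \<xi> - p x \<xi> *\<^sub>R (inverse (p x \<xi>) *\<^sub>R s x \<xi>)))"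
    using adj_wave[OF symb_div[OF s]] by auto
  have "osc V s \<xi> = osc V t \<xi>" if \<xi>: "\<xi> \<noteq> 0" for \<xi>
  proof -
    obtain \<psi>1 \<psi>2 where \<psi>: "hasC2 D (\<lambda>x. wave \<xi> x * (inverse (p x \<xi>) *\<^sub>R s x \<xi>)) \<psi>1 \<psi>2"
      "\<And>x. adj (\<lambda>x. wave \<xi> x * (inverse (p x \<xi>) *\<^sub>R s x \<xi>)) \<psi>1 \<psi>2 x
        = wave \<xi> x * (t x \<xi> - p x \<xi> *\<^sub>R (inverse (p x \<xi>) *\<^sub>R s x \<xi>))"
      using t'[OF \<xi>] by blast
    have eq: "(if x \<in> D then adj (\<lambda>x. wave \<xi> x * (inverse (p x \<xi>) *\<^sub>R s x \<xi>)) \<psi>1 \<psi>2 x else 0)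
        = wave \<xi> x * t x \<xi> - wave \<xi> x * s x \<xi>" for x
    proof (cases "x \<in> D")
      case True
      have "p x \<xi> *\<^sub>R (inverse (p x \<xi>) *\<^sub>R s x \<xi>) = s x \<xi>"
        using p_pos[OF True \<xi>] by simp
      then show ?thesis by (simp only: True if_True \<psi>(2) right_diff_distrib)
    next
      case False
      then have "x \<notin> K" using K by auto
      then show ?thesis using False symb_zero[OF t] symb_zero[OF s] by simp
    qed
    have "0 = (LINT x|lborel. V x *\<^sub>R (wave \<xi> x * t x \<xi> - wave \<xi> x * s x \<xi>))"
      unfolding eq[symmetric] by (rule weak[symmetric, OF \<psi>(1)]) (simp add: symb_zero[OF s])
    also have "\<dots> = osc V t \<xi> - osc V s \<xi>"
      unfolding osc_def scaleR_diff_right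
      by (rule Bochner_Integration.integral_diff) (rule osc_integrable[OF V _ \<xi>], rule t s)+
    finally show ?thesis by simp
  qed
  then show ?thesis using t by blast
qed

text \<open>\<open>N\<close> applications of \<open>osc_gain\<close> replace the amplitude by one of
  order \<open>- N\<close> without changing the integral. The bound then needs only the integral of
  \<bar>V\<bar>. It is restricted to \<open>norm \<xi> \<ge> 1\<close> since symbols may be singular
  at \<xi> = 0.\<close>

lemma osc_decay:
  assumes V: "integrable lborel V"
    and weak: "\<And>(\<psi>::real^'n \<Rightarrow> complex) \<psi>1 \<psi>2. hasC2 D \<psi> \<psi>1 \<psi>2 \<Longrightarrow> (\<And>x. x \<notin> K \<Longrightarrow> \<psi> x = 0) \<Longrightarrow>
      (LINT x|lborel. V x *\<^sub>R (if x \<in> D then adj \<psi> \<psi>1 \<psi>2 x else 0)) = 0"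
    and s: "symb 0 s"
  shows "\<exists>C. \<forall>\<xi>. norm \<xi> \<ge> 1 \<longrightarrow> norm (osc V s \<xi>) \<le> C * norm \<xi> powi (- int N)"
proof -
  have "\<exists>t. symb (- int N) t \<and> (\<forall>\<xi>. \<xi> \<noteq> 0 \<longrightarrow> osc V s \<xi> = osc V t \<xi>)"
  proof (induction N)
    case 0
    then show ?case using s by auto
  next
    case (Suc N)
    then obtain t where t: "symb (- int N) t" "\<forall>\<xi>. \<xi> \<noteq> 0 \<longrightarrow> osc V s \<xi> = osc V t \<xi>" by blast
    from osc_gain[OF V weak t(1)] obtain t' where t':
      "symb (- int N - 1) t'" "\<forall>\<xi>. \<xi> \<noteq> 0 \<longrightarrow> osc V t \<xi> = osc V t' \<xi>" by blast
    have "- int N - 1 = - int (Suc N)" by simp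
    with t'(1) have "symb (- int (Suc N)) t'" by (simp only:)
    moreover have "osc V s \<xi> = osc V t' \<xi>" if "\<xi> \<noteq> 0" for \<xi>
      using t(2) t' that by simp
    ultimately show ?case by blast
  qed
  then obtain t where t: "symb (- int N) t" "\<And>\<xi>. \<xi> \<noteq> 0 \<Longrightarrow> osc V s \<xi> = osc V t \<xi>" by blast
  obtain C where C: "C \<ge> 0" "\<And>x \<xi>. norm \<xi> \<ge> 1 \<Longrightarrow> norm (t x \<xi>) \<le> C * norm \<xi> powi (- int N)"
    using symb_bound[OF t(1)] by blast
  have "norm (osc V s \<xi>) \<le> (LINT x|lborel. \<bar>V x\<bar>) * C * norm \<xi> powi (- int N)" if \<xi>: "norm \<xi> \<ge> 1" for \<xi>
  proof -
    have \<xi>0: "\<xi> \<noteq> 0" using \<xi> by auto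
    have "norm (osc V s \<xi>) \<le> (LINT x|lborel. norm (V x *\<^sub>R (wave \<xi> x * t x \<xi>)))"
      unfolding t(2)[OF \<xi>0] unfolding osc_def by (rule integral_norm_bound)
    also have "\<dots> \<le> (LINT x|lborel. \<bar>V x\<bar> * (C * norm \<xi> powi (- int N)))"
    proof (rule integral_mono)
      show "integrable lborel (\<lambda>x. norm (V x *\<^sub>R (wave \<xi> x * t x \<xi>)))"
        using osc_integrable[OF V t(1) \<xi>0] by (rule integrable_norm)
      show "integrable lborel (\<lambda>x. \<bar>V x\<bar> * (C * norm \<xi> powi (- int N)))"
        using V by simp
      show "norm (V x *\<^sub>R (wave \<xi> x * t x \<xi>)) \<le> \<bar>V x\<bar> * (C * norm \<xi> powi (- int N))" for x
        using C(2)[OF \<xi>, of x] by (simp add: norm_mult mult_left_mono)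
    qed
    finally show ?thesis by (simp add: mult_ac)
  qed
  then show ?thesis by blast
qed

end

context elliptic_operator
begin

text \<open>\<open>w\<close> is the normalized inverse transform of the Fourier transform
  \<open>F\<close> of \<open>V * \<eta>\<close>. Inversion identifies it with
  \<open>V * \<eta>\<close> at points of continuity only; nothing is claimed at the puncture, where
  \<open>w\<close> provides the missing value.\<close>

lemma weak_solution_C2:
  fixes V \<eta> :: "real^'n \<Rightarrow> real"
  assumes V: "integrable lborel V"
    and weak: "\<And>(\<psi>::real^'n \<Rightarrow> complex) \<psi>1 \<psi>2. hasC2 D \<psi> \<psi>1 \<psi>2 \<Longrightarrow> (\<And>x. x \<notin> K \<Longrightarrow> \<psi> x = 0) \<Longrightarrow>
      (LINT x|lborel. V x *\<^sub>R (if x \<in> D then adj \<psi> \<psi>1 \<psi>2 x else 0)) = 0"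
    and \<eta>: "smooth_on \<eta> D" "\<And>x. x \<notin> K \<Longrightarrow> \<eta> x = 0"
  shows "\<exists>w w1 w2. hasC2 UNIV (w::real^'n \<Rightarrow> real) w1 w2 \<and> (\<forall>y. isCont (\<lambda>x. V x * \<eta> x) y \<longrightarrow> V y * \<eta> y = w y)"
proof -
  define f where "f x = V x * \<eta> x" for x
  define s :: "real^'n \<Rightarrow> real^'n \<Rightarrow> complex" where "s x \<xi> = of_real (\<eta> x)" for x \<xi>
  define F where "F \<xi> = (LINT x|lborel. f x *\<^sub>R cis (- (x \<bullet> \<xi>)))" for \<xi>
  have sm: "smooth_on (\<lambda>x. complex_of_real (\<eta> x)) D"
    by (rule smooth_on_compose_linear[OF bounded_linear_of_real D \<eta>(1)])
  have s: "symb 0 s"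
    unfolding s_def by (rule symb_base[OF sm]) (simp add: \<eta>(2))
  have osc: "osc V s = F"
    by (simp add: fun_eq_iff osc_def F_def f_def s_def wave_def scaleR_conv_of_real mult_ac)
  have "integrable lborel (\<lambda>x. V x *\<^sub>R complex_of_real (\<eta> x))"
    by (rule integrable_mult_compact_support_everywhere[OF V smooth_on_continuous[OF sm]]) (simp add: \<eta>(2))
  from integrable_Re[OF this] have f: "integrable lborel f" by (simp add: f_def[abs_def])
  have [measurable]: "f \<in> borel_measurable borel" using borel_measurable_integrable[OF f] by simp
  have F_meas[measurable]: "F \<in> borel_measurable borel"
    unfolding F_def[abs_def] by measurable
  \<comment> \<open>Of these powers of \<open>inverse (1 + (norm \<xi>)\<^sup>2)\<close>,
    \<open>CARD('n)\<close> secure integrability and 2 absorb the weight required by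
    \<open>fint_hasC2\<close>.\<close>
  define N where "N = CARD('n) + 2"
  obtain C where C: "\<And>\<xi>. norm \<xi> \<ge> 1 \<Longrightarrow> norm (F \<xi>) \<le> C * norm \<xi> powi (- int (2 * N))"
    using osc_decay[OF V weak s, of "2 * N"] unfolding osc by blast
  \<comment> \<open>The factor \<open>2 ^ N\<close> serves both ranges:
    \<open>1 + (norm \<xi>)\<^sup>2\<close> is at most \<open>2 * (norm \<xi>)\<^sup>2\<close> if
    \<open>norm \<xi> \<ge> 1\<close> and at most 2 otherwise. For small \<xi> the trivial bound by
    the integral of \<bar>f\<bar> takes over.\<close>
  define B where "B = 2 ^ N * (\<bar>C\<bar> + (LINT x|lborel. \<bar>f x\<bar>))"
  have I0: "0 \<le> (LINT x|lborel. \<bar>f x\<bar>)" by (intro integral_nonneg_AE) auto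
  have bound: "norm (F \<xi>) \<le> B * inverse ((1 + (norm \<xi>)\<^sup>2) ^ N)" for \<xi>
  proof (cases "norm \<xi> \<ge> 1")
    case True
    have "(1 + (norm \<xi>)\<^sup>2) ^ N \<le> (2 * (norm \<xi>)\<^sup>2) ^ N"
      using True one_le_power[OF True, of 2] by (intro power_mono) auto
    also have "\<dots> = 2 ^ N * norm \<xi> ^ (2 * N)" by (simp add: power_mult_distrib power_mult)
    finally have "inverse (2 ^ N * norm \<xi> ^ (2 * N)) \<le> inverse ((1 + (norm \<xi>)\<^sup>2) ^ N)"
      by (intro le_imp_inverse_le) (auto intro!: zero_less_power add_pos_nonneg)
    moreover have "2 ^ N * A * inverse (2 ^ N * Y) = A * inverse Y" for A Y :: real
      by (cases "Y = 0") (simp_all add: field_simps)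
    ultimately have "\<bar>C\<bar> * inverse (norm \<xi> ^ (2 * N)) \<le> 2 ^ N * \<bar>C\<bar> * inverse ((1 + (norm \<xi>)\<^sup>2) ^ N)"
      using mult_left_mono[of "inverse (2 ^ N * norm \<xi> ^ (2 * N))" _ "2 ^ N * \<bar>C\<bar>"] by (metis abs_ge_zero mult_nonneg_nonneg zero_le_numeral zero_le_power)
    also have "\<dots> \<le> B * inverse ((1 + (norm \<xi>)\<^sup>2) ^ N)"
      unfolding B_def using I0 by (intro mult_right_mono mult_left_mono) auto
    finally have "\<bar>C\<bar> * inverse (norm \<xi> ^ (2 * N)) \<le> B * inverse ((1 + (norm \<xi>)\<^sup>2) ^ N)" .
    moreover have "norm (F \<xi>) \<le> \<bar>C\<bar> * inverse (norm \<xi> ^ (2 * N))"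
    proof -
      have "norm (F \<xi>) \<le> C * inverse (norm \<xi> ^ (2 * N))"
        using C[OF True] by (simp add: power_int_minus del: of_nat_mult)
      also have "\<dots> \<le> \<bar>C\<bar> * inverse (norm \<xi> ^ (2 * N))" by (intro mult_right_mono) auto
      finally show ?thesis .
    qed
    ultimately show ?thesis by linarith
  next
    case False
    have "norm (F \<xi>) \<le> (LINT x|lborel. norm (f x *\<^sub>R cis (- (x \<bullet> \<xi>))))"
      unfolding F_def by (rule integral_norm_bound)
    then have 1: "norm (F \<xi>) \<le> (LINT x|lborel. \<bar>f x\<bar>)" by simp
    have "(1 + (norm \<xi>)\<^sup>2) ^ N \<le> 2 ^ N"
      using False by (intro power_mono) (auto simp: power_le_one)
    then have "1 \<le> 2 ^ N * inverse ((1 + (norm \<xi>)\<^sup>2) ^ N)"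
      by (simp add: divide_inverse[symmetric] le_divide_eq add_pos_nonneg)
    from mult_right_mono[OF this, of "\<bar>C\<bar> + (LINT x|lborel. \<bar>f x\<bar>)"]
    have "\<bar>C\<bar> + (LINT x|lborel. \<bar>f x\<bar>) \<le> B * inverse ((1 + (norm \<xi>)\<^sup>2) ^ N)"
      using I0 by (simp add: B_def mult_ac)
    then show ?thesis using 1 by linarith
  qed
  have F2: "integrable lborel (\<lambda>\<xi>. F \<xi> * (1 + (norm \<xi>)\<^sup>2)\<^sup>2)"
  proof (rule Bochner_Integration.integrable_bound)
    show "integrable lborel (\<lambda>\<xi>::real^'n. B * inverse ((1 + (norm \<xi>)\<^sup>2) ^ CARD('n)))"
      by (intro integrable_mult_right integrable_inverse_norm_power)
    have "norm (F \<xi> * (1 + (norm \<xi>)\<^sup>2)\<^sup>2) \<le> B * inverse ((1 + (norm \<xi>)\<^sup>2) ^ CARD('n))" for \<xi>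
    proof -
      define r where "r = 1 + (norm \<xi>)\<^sup>2"
      have r: "r > 0" by (simp add: r_def add_pos_nonneg)
      have "norm (F \<xi> * (complex_of_real r)\<^sup>2) = norm (F \<xi>) * r\<^sup>2"
        using r by (simp add: norm_mult norm_power)
      also have "\<dots> \<le> B * inverse (r ^ N) * r\<^sup>2"
        using bound[of \<xi>] by (intro mult_right_mono) (auto simp: r_def)
      also have "\<dots> = B * inverse (r ^ CARD('n))"
        using r by (simp add: N_def power_add field_simps power2_eq_square)
      finally show ?thesis by (simp add: r_def)
    qed
    then show "AE \<xi> in lborel. norm (F \<xi> * (1 + (norm \<xi>)\<^sup>2)\<^sup>2) \<le> norm (B * inverse ((1 + (norm \<xi>)\<^sup>2) ^ CARD('n)))"
      by (intro AE_I2) (metis abs_ge_self order.trans real_norm_def)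
  qed measurable
  have F1: "integrable lborel F"
  proof (rule Bochner_Integration.integrable_bound[OF F2])
    have "norm (F \<xi>) \<le> norm (F \<xi> * (1 + (norm \<xi>)\<^sup>2)\<^sup>2)" for \<xi>
    proof -
      define r where "r = 1 + (norm \<xi>)\<^sup>2"
      have r: "r \<ge> 1" by (simp add: r_def)
      have "norm (F \<xi>) * 1 \<le> norm (F \<xi>) * r\<^sup>2"
        using one_le_power[OF r, of 2] by (intro mult_left_mono) auto
      also have "\<dots> = norm (F \<xi> * (complex_of_real r)\<^sup>2)" using r by (simp add: norm_mult norm_power)
      finally show ?thesis by (simp add: r_def)
    qed
    then show "AE \<xi> in lborel. norm (F \<xi>) \<le> norm (F \<xi> * (1 + (norm \<xi>)\<^sup>2)\<^sup>2)" by (intro AE_I2)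
  qed measurable
  obtain f1 f2 where W: "hasC2 UNIV (fint F) f1 f2"
    using fint_hasC2[OF F_meas F2] by blast
  let ?c = "inverse ((2 * pi) ^ CARD('n))"
  have lin: "bounded_linear (\<lambda>z. ?c * Re z)"
    by (intro bounded_linear_const_mult bounded_linear_Re)
  have "hasC2 UNIV (\<lambda>y. ?c * Re (fint F y)) (\<lambda>l y. ?c * Re (f1 l y)) (\<lambda>l m y. ?c * Re (f2 l m y))"
    unfolding hasC2_def
    using hasC2D[OF W] by (intro conjI ballI allI has_partials_linear[OF lin] continuous_intros) auto
  moreover have "V y * \<eta> y = ?c * Re (fint F y)" if "isCont (\<lambda>x. V x * \<eta> x) y" for y
  proof -
    have "fint F y = of_real ((2 * pi) ^ CARD('n) * f y)"
      by (rule fourier_inversion[OF f _ F1 F_def]) (use that in \<open>simp add: f_def[abs_def]\<close>)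
    then have r: "Re (fint F y) = (2 * pi) ^ CARD('n) * f y" by (simp only: Re_complex_of_real)
    have inv: "inverse c * (c * t) = t" if "c \<noteq> 0" for c t :: real using that by simp
    have "?c * Re (fint F y) = f y" unfolding r by (rule inv) simp
    then show ?thesis by (simp only: f_def)
  qed
  ultimately show ?thesis by (intro exI[of _ "\<lambda>y. ?c * Re (fint F y)"] exI conjI allI impI)
qed

lemma adj_zero_outside:
  assumes "hasC2 D \<psi> \<psi>1 \<psi>2" "\<And>x. x \<notin> L \<Longrightarrow> \<psi> x = 0" "closed L" "x \<in> D" "x \<notin> L"
  shows "adj \<psi> \<psi>1 \<psi>2 x = 0"
  unfolding adj_def using hasC2_zero_outside[OF assms(1) D assms(3,2,4,5)] assms(2,5) by simp

lemma hasC2_coeff: "hasC2 D (a i j) (\<lambda>l. pd l (a i j)) (\<lambda>l m. pd m (pd l (a i j)))"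
  by (rule smooth_on_hasC2[OF smooth])

lemma adj_continuous:
  assumes "hasC2 D \<psi> \<psi>1 \<psi>2"
  shows "continuous_on D (adj \<psi> \<psi>1 \<psi>2)"
  unfolding adj_def[abs_def]
  by (intro continuous_intros hasC2D[OF assms] hasC2D[OF hasC2_coeff])

text \<open>Two integrations by parts, legitimate where \<open>v\<close> is C^2. The support
  \<open>L\<close> is compact in \<open>D'\<close>, so there are no boundary terms; the equation for
  \<open>v\<close> then removes what is left.\<close>

lemma weak_solution_punctured:
  fixes \<psi> :: "real^'n \<Rightarrow> 'b::euclidean_space"
  assumes D': "open D'" "D' \<subseteq> D" and L: "compact L" "L \<subseteq> D'"
    and v: "hasC2 D' v v1 v2" "\<And>x. x \<in> D' \<Longrightarrow> (\<Sum>i\<in>UNIV. \<Sum>j\<in>UNIV. a i j x * v2 j i x) = 0"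
    and \<psi>: "hasC2 D \<psi> \<psi>1 \<psi>2" "\<And>x. x \<notin> L \<Longrightarrow> \<psi> x = 0"
  shows "(LINT x|lborel. (if x \<in> D' then v x *\<^sub>R adj \<psi> \<psi>1 \<psi>2 x else 0)) = 0"
proof -
  define F where "F i j x = a i j x *\<^sub>R \<psi> x" for i j x
  define F1 where "F1 i j l x = a i j x *\<^sub>R \<psi>1 l x + pd l (a i j) x *\<^sub>R \<psi> x" for i j l x
  define F2 where "F2 i j l m x = a i j x *\<^sub>R \<psi>2 l m x + pd m (a i j) x *\<^sub>R \<psi>1 l x
    + (pd l (a i j) x *\<^sub>R \<psi>1 m x + pd m (pd l (a i j)) x *\<^sub>R \<psi> x)" for i j l m x
  have F: "hasC2 D' (F i j) (F1 i j) (F2 i j)" for i j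
    using hasC2_subset[OF hasC2_scaleR[OF hasC2_coeff \<psi>(1)] D'(2)]
    unfolding F_def[abs_def] F1_def[abs_def] F2_def[abs_def] .
  have FL: "F i j x = 0" if "x \<notin> L" for i j x using \<psi>(2)[OF that] by (simp add: F_def)
  \<comment> \<open>\<open>g i j\<close> is the \<open>j\<close>-th partial of \<open>v\<close>
    times the \<open>i\<close>-th partial of \<open>a i j *\<^sub>R \<psi>\<close>, and
    \<open>h i j\<close> is the \<open>i\<close>-th partial of \<open>v1 j\<close> times
    \<open>a i j *\<^sub>R \<psi>\<close>. Both integrate to 0, and the mixed term they share
    cancels in the difference.\<close>
  define g where "g i j x = (if x \<in> D' then v x *\<^sub>R F2 i j i j x + v1 j x *\<^sub>R F1 i j i x else 0)" for i j x
  define h where "h i j x = (if x \<in> D' then v1 j x *\<^sub>R F1 i j i x + v2 j i x *\<^sub>R F i j x else 0)" for i j x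
  have gint: "integrable lborel (g i j)" "(LINT x|lborel. g i j x) = 0" for i j
  proof -
    have z: "(if x \<in> D' then v x *\<^sub>R F1 i j i x else 0) = 0" if "x \<notin> L" for x
      using hasC2_zero_outside(1)[OF F D'(1) compact_imp_closed[OF L(1)] FL] that by simp
    have p: "has_partials (\<lambda>x. if x \<in> D' then v x *\<^sub>R F1 i j i x else 0)
      (\<lambda>l. v x *\<^sub>R F2 i j i l x + v1 l x *\<^sub>R F1 i j i x) x" if "x \<in> D'" for x
      by (rule has_partials_transform[OF has_partials_scaleR[OF hasC2D(1)[OF v(1) that] hasC2D(2)[OF F that]] D'(1) that]) simp
    have c: "continuous_on D' (g i j)"
      by (subst continuous_on_cong[OF refl, of _ _ "\<lambda>x. v x *\<^sub>R F2 i j i j x + v1 j x *\<^sub>R F1 i j i x"])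
        (auto simp: g_def intro!: continuous_intros hasC2D[OF v(1)] hasC2D[OF F])
    show "integrable lborel (g i j)" "(LINT x|lborel. g i j x) = 0"
      by (rule integral_partial_compact_support[where f="\<lambda>x. if x \<in> D' then v x *\<^sub>R F1 i j i x else 0" and l=j,
          OF D'(1) L z _ p _ c]; simp add: g_def)+
  qed
  have hint: "integrable lborel (h i j)" "(LINT x|lborel. h i j x) = 0" for i j
  proof -
    have z: "v1 j x *\<^sub>R F i j x = 0" if "x \<notin> L" for x using FL[OF that] by simp
    have p: "has_partials (\<lambda>x. v1 j x *\<^sub>R F i j x)
      (\<lambda>l. v1 j x *\<^sub>R F1 i j l x + v2 j l x *\<^sub>R F i j x) x" if "x \<in> D'" for x
      by (rule has_partials_scaleR[OF hasC2D(2)[OF v(1) that] hasC2D(1)[OF F that]])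
    have c: "continuous_on D' (h i j)"
      by (subst continuous_on_cong[OF refl, of _ _ "\<lambda>x. v1 j x *\<^sub>R F1 i j i x + v2 j i x *\<^sub>R F i j x"])
        (auto simp: h_def intro!: continuous_intros hasC2D[OF v(1)] hasC2D[OF F])
    show "integrable lborel (h i j)" "(LINT x|lborel. h i j x) = 0"
      by (rule integral_partial_compact_support[where f="\<lambda>x. v1 j x *\<^sub>R F i j x" and l=i,
          OF D'(1) L z _ p _ c]; simp add: h_def)+
  qed
  have eq: "(if x \<in> D' then v x *\<^sub>R adj \<psi> \<psi>1 \<psi>2 x else 0) = (\<Sum>i\<in>UNIV. \<Sum>j\<in>UNIV. g i j x - h i j x)" for x
  proof (cases "x \<in> D'")
    case True
    have "(\<Sum>i\<in>UNIV. \<Sum>j\<in>UNIV. g i j x - h i j x)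
        = (\<Sum>i\<in>UNIV. \<Sum>j\<in>UNIV. v x *\<^sub>R F2 i j i j x - (a i j x * v2 j i x) *\<^sub>R \<psi> x)"
      using True by (intro sum.cong refl) (simp add: g_def h_def F_def mult.commute)
    also have "\<dots> = v x *\<^sub>R (\<Sum>i\<in>UNIV. \<Sum>j\<in>UNIV. F2 i j i j x) - (\<Sum>i\<in>UNIV. \<Sum>j\<in>UNIV. a i j x * v2 j i x) *\<^sub>R \<psi> x"
      by (simp only: sum_subtractf scaleR_sum_right scaleR_sum_left)
    also have "\<dots> = v x *\<^sub>R adj \<psi> \<psi>1 \<psi>2 x"
      unfolding v(2)[OF True] by (simp add: adj_def F2_def)
    finally show ?thesis using True by simp
  next
    case False
    then show ?thesis by (simp add: g_def h_def)
  qed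
  show ?thesis
    unfolding eq
    by (subst Bochner_Integration.integral_sum, auto intro!: Bochner_Integration.integrable_sum Bochner_Integration.integrable_diff gint hint)
      (subst Bochner_Integration.integral_sum, auto intro!: Bochner_Integration.integrable_diff gint hint simp: gint(2) hint(2) Bochner_Integration.integral_diff[OF gint(1) hint(1)])
qed

end

section \<open>Weak solutions across the puncture\<close>

text \<open>Three is the lowest integer power whose truncation at 0 is twice continuously
  differentiable.\<close>

lemma cube_pos_has_derivative:
  "((\<lambda>t::real. (max 0 t) ^ 3) has_real_derivative 3 * (max 0 t)\<^sup>2) (at t)"
  "((\<lambda>t::real. 3 * (max 0 t)\<^sup>2) has_real_derivative 6 * max 0 t) (at t)"
proof -
  have *: "((\<lambda>t::real. c * (max 0 t) ^ Suc (Suc k)) has_real_derivative c * (real (Suc (Suc k)) * (max 0 t) ^ Suc k)) (at t)"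
    for c :: real and k
  proof -
    consider "t < 0" | "t = 0" | "t > 0" by linarith
    then show ?thesis
    proof cases
      case 1
      have "((\<lambda>_. 0) has_real_derivative 0) (at t)" by simp
      then have "((\<lambda>t::real. c * (max 0 t) ^ Suc (Suc k)) has_real_derivative 0) (at t)"
        by (rule has_field_derivative_transform_within_open[of _ _ _ "{..<0}"]) (use 1 in auto)
      then show ?thesis using 1 by simp
    next
      case 2
      have "((\<lambda>y::real. c * (max 0 y) ^ Suc k) \<longlongrightarrow> c * (max 0 0) ^ Suc k) (at 0)"
        by (intro tendsto_intros)
      note lim = this
      have "((\<lambda>t::real. c * (max 0 t) ^ Suc (Suc k)) has_real_derivative 0) (at 0)"
        unfolding has_field_derivative_iff
      proof (rule Lim_transform_eventually[where f="\<lambda>y. c * (max 0 y) ^ Suc k"])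
        from lim show "((\<lambda>y::real. c * (max 0 y) ^ Suc k) \<longlongrightarrow> 0) (at 0)" by simp
        show "\<forall>\<^sub>F y in at 0. c * (max 0 y) ^ Suc k = (c * (max 0 y) ^ Suc (Suc k) - c * (max 0 0) ^ Suc (Suc k)) / (y - 0)"
          by (auto simp: eventually_at_filter max_def)
      qed
      then show ?thesis using 2 by simp
    next
      case 3
      have "((\<lambda>t::real. c * t ^ Suc (Suc k)) has_real_derivative c * (real (Suc (Suc k)) * t ^ Suc k)) (at t)"
        using DERIV_cmult[OF DERIV_pow[of "Suc (Suc k)" t UNIV], of c] by simp
      then have "((\<lambda>t::real. c * (max 0 t) ^ Suc (Suc k)) has_real_derivative c * (real (Suc (Suc k)) * t ^ Suc k)) (at t)"
        by (rule has_field_derivative_transform_within_open[of _ _ _ "{0<..}"]) (use 3 in auto)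
      then show ?thesis using 3 by simp
    qed
  qed
  show "((\<lambda>t::real. (max 0 t) ^ 3) has_real_derivative 3 * (max 0 t)\<^sup>2) (at t)"
    using *[of 1 1] by (simp add: numeral_2_eq_2 numeral_3_eq_3)
  show "((\<lambda>t::real. 3 * (max 0 t)\<^sup>2) has_real_derivative 6 * max 0 t) (at t)"
    using *[of 3 0] by (simp add: numeral_2_eq_2)
qed

lemma C2_step_function:
  obtains h h1 h2 :: "real \<Rightarrow> real" and H :: real where
    "\<And>t. (h has_real_derivative h1 t) (at t)" "\<And>t. (h1 has_real_derivative h2 t) (at t)"
    "continuous_on UNIV h2" "\<And>t. t \<le> 1 \<Longrightarrow> h t = 0" "\<And>t. t \<ge> 2 \<Longrightarrow> h t = 1" "\<And>t. \<bar>h t\<bar> \<le> 1"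
    "\<And>t. \<bar>h1 t\<bar> \<le> H" "\<And>t. \<bar>h2 t\<bar> \<le> H" "H \<ge> 0"
    "\<And>t. t \<notin> {1..2} \<Longrightarrow> h1 t = 0" "\<And>t. t \<notin> {1..2} \<Longrightarrow> h2 t = 0"
proof -
  define c where "c t = (max 0 t) ^ 3" for t :: real
  define c1 where "c1 t = 3 * (max 0 t)\<^sup>2" for t :: real
  define c2 where "c2 t = 6 * max 0 t" for t :: real
  have c: "(c has_real_derivative c1 t) (at t)" "(c1 has_real_derivative c2 t) (at t)" for t
    unfolding c_def[abs_def] c1_def[abs_def] c2_def using cube_pos_has_derivative by blast+
  \<comment> \<open>Applying the truncated cube twice creates both plateaus: for
    \<open>t \<le> 1\<close> the inner value is 0 and \<open>c 1 = 1\<close>; for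
    \<open>t \<ge> 2\<close> the inner value is at least 1, so the outer cube vanishes.\<close>
  define h where "h t = 1 - c (1 - c (t - 1))" for t
  define h1 where "h1 t = c1 (1 - c (t - 1)) * c1 (t - 1)" for t
  define h2 where "h2 t = c1 (1 - c (t - 1)) * c2 (t - 1) - c2 (1 - c (t - 1)) * c1 (t - 1) * c1 (t - 1)" for t
  have sh: "((\<lambda>t. t - 1) has_real_derivative 1) (at t)" for t :: real
    by (auto intro!: derivative_eq_intros)
  have sc: "((\<lambda>t. 1 - c (t - 1)) has_real_derivative - c1 (t - 1)) (at t)" for t
    using DERIV_diff[OF DERIV_const DERIV_chain2[OF c(1) sh], of 1 t] by simp
  have sc1: "((\<lambda>t. c1 (t - 1)) has_real_derivative c2 (t - 1)) (at t)" for t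
    using DERIV_chain2[OF c(2) sh, of t] by simp
  have h: "(h has_real_derivative h1 t) (at t)" for t
    using DERIV_diff[OF DERIV_const DERIV_chain2[OF c(1) sc], of 1 t] unfolding h_def[abs_def] h1_def by simp
  have h1: "(h1 has_real_derivative h2 t) (at t)" for t
    using DERIV_mult[OF DERIV_chain2[OF c(2) sc] sc1, of t] unfolding h1_def[abs_def] h2_def
    by (simp add: algebra_simps)
  have h2: "continuous_on UNIV h2"
    unfolding h2_def[abs_def] c_def c1_def c2_def by (intro continuous_intros)
  have out: "h1 t = 0" "h2 t = 0" if "t \<notin> {1..2}" for t
  proof -
    have "t < 1 \<or> t > 2" using that by auto
    moreover have "c (t - 1) \<ge> 1" if "t > 2" using that by (simp add: c_def one_le_power)
    ultimately have "t < 1 \<or> 1 - c (t - 1) \<le> 0" by auto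
    then show "h1 t = 0" "h2 t = 0" by (auto simp: h1_def h2_def c1_def c2_def)
  qed
  have "continuous_on {1..2} h1" using DERIV_isCont[OF h1] by (simp add: continuous_at_imp_continuous_on)
  moreover have "continuous_on {1..2} h2" using h2 by (rule continuous_on_subset) simp
  ultimately have "bounded (h1 ` {1..2})" "bounded (h2 ` {1..2})"
    by (simp_all add: compact_imp_bounded compact_continuous_image)
  then obtain H1 H2 where H: "\<And>t. t \<in> {1..2} \<Longrightarrow> \<bar>h1 t\<bar> \<le> H1" "\<And>t. t \<in> {1..2} \<Longrightarrow> \<bar>h2 t\<bar> \<le> H2" "H1 > 0" "H2 > 0"
    unfolding bounded_pos by (auto simp del: atLeastAtMost_iff)
  have Hb: "\<bar>h1 t\<bar> \<le> max H1 H2" "\<bar>h2 t\<bar> \<le> max H1 H2" for t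
    using H(1,2)[of t] out[of t] H(3,4) by (cases "t \<in> {1..2}"; simp add: le_max_iff_disj)+
  have le1: "h t = 0" if "t \<le> 1" for t using that by (simp add: h_def c_def)
  have ge2: "h t = 1" if "t \<ge> 2" for t
  proof -
    have "c (t - 1) \<ge> 1" using that by (simp add: c_def one_le_power)
    then show ?thesis by (simp add: h_def c_def)
  qed
  have cb: "0 \<le> c t" for t by (simp add: c_def)
  have "c (1 - c (t - 1)) \<le> 1" for t
    using cb[of "t - 1"] unfolding c_def[of "1 - c (t - 1)"] by (intro power_le_one) auto
  then have "\<bar>h t\<bar> \<le> 1" for t using cb[of "1 - c (t - 1)"] by (simp add: h_def abs_le_iff)
  from that[OF h h1 h2 le1 ge2 this Hb _ out] H(3) show ?thesis by (simp add: le_max_iff_disj)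
qed

lemma hasC2_inner_self:
  "hasC2 D (\<lambda>x::real^'n::finite. c * (x \<bullet> x)) (\<lambda>l x. c * (2 * x$l)) (\<lambda>l m x. c * (if m = l then 2 else 0))"
proof -
  have 1: "has_partials (\<lambda>x::real^'n. c * (x \<bullet> x)) (\<lambda>l. c * (2 * x$l)) x" for x
  proof -
    have "has_partials (\<lambda>x::real^'n. \<Sum>i\<in>UNIV. x$i * x$i)
      (\<lambda>l. \<Sum>i\<in>UNIV. (x$i * (if l = i then 1 else 0) + (if l = i then 1 else 0) * x$i)) x"
      by (intro has_partials_sum has_partials_mult has_partials_component)
    moreover have "(\<Sum>i\<in>UNIV. (x$i * (if l = i then 1 else 0) + (if l = i then 1 else 0) * x$i)) = 2 * x$l" for l
      by (simp add: sum.distrib if_distrib if_distribR cong: if_cong)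
    ultimately have "has_partials (\<lambda>x::real^'n. x \<bullet> x) (\<lambda>l. 2 * x$l) x"
      by (simp add: inner_vec_def)
    from has_partials_linear[OF bounded_linear_mult_right this] show ?thesis .
  qed
  have 2: "has_partials (\<lambda>x::real^'n. c * (2 * x$l)) (\<lambda>m. c * (if m = l then 2 else 0)) x" for x l
    using has_partials_linear[OF bounded_linear_mult_right has_partials_linear[OF bounded_linear_mult_right has_partials_component], of c 2 l x]
    by (simp add: if_distrib cong: if_cong)
  show ?thesis unfolding hasC2_def using 1 2 by auto
qed

context elliptic_operator
begin

text \<open>The commutator of \<open>adj\<close> with multiplication by \<open>e\<close>, as
  \<open>adj_product\<close> shows. Only derivatives of \<open>e\<close> occur, so for a cutoff it
  is supported in the transition layer.\<close>

definition adj_comm :: "(real^'n \<Rightarrow> real) \<Rightarrow> ('n \<Rightarrow> real^'n \<Rightarrow> real) \<Rightarrow> ('n \<Rightarrow> 'n \<Rightarrow> real^'n \<Rightarrow> real)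
    \<Rightarrow> (real^'n \<Rightarrow> 'b::real_normed_vector) \<Rightarrow> ('n \<Rightarrow> real^'n \<Rightarrow> 'b) \<Rightarrow> real^'n \<Rightarrow> 'b" where
  "adj_comm e e1 e2 \<psi> \<psi>1 x = (\<Sum>i\<in>UNIV. \<Sum>j\<in>UNIV. a i j x *\<^sub>R (e1 j x *\<^sub>R \<psi>1 i x + e1 i x *\<^sub>R \<psi>1 j x + e2 i j x *\<^sub>R \<psi> x)
     + pd j (a i j) x *\<^sub>R e1 i x *\<^sub>R \<psi> x + pd i (a i j) x *\<^sub>R e1 j x *\<^sub>R \<psi> x)"

lemma adj_product:
  "adj (\<lambda>x. e x *\<^sub>R \<psi> x) (\<lambda>l x. e x *\<^sub>R \<psi>1 l x + e1 l x *\<^sub>R \<psi> x)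
     (\<lambda>l m x. e x *\<^sub>R \<psi>2 l m x + e1 m x *\<^sub>R \<psi>1 l x + (e1 l x *\<^sub>R \<psi>1 m x + e2 l m x *\<^sub>R \<psi> x)) x
   = e x *\<^sub>R adj \<psi> \<psi>1 \<psi>2 x + adj_comm e e1 e2 \<psi> \<psi>1 x"
  unfolding adj_def adj_comm_def scaleR_sum_right sum.distrib[symmetric]
  by (intro sum.cong refl) (simp add: algebra_simps)

lemma adj_comm_bound:
  assumes "C \<ge> 0" "\<And>i j. \<bar>a i j x\<bar> \<le> C" "\<And>i j l. \<bar>pd l (a i j) x\<bar> \<le> C"
    and "\<And>l. \<bar>e1 l x\<bar> \<le> E1" "\<And>l m. \<bar>e2 l m x\<bar> \<le> E2" "norm (\<psi> x) \<le> P" "\<And>l. norm (\<psi>1 l x) \<le> P1"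
  shows "norm (adj_comm e e1 e2 \<psi> \<psi>1 x) \<le> (real CARD('n))\<^sup>2 * (C * (2 * E1 * P1 + E2 * P + 2 * E1 * P))"
proof -
  have nn: "E1 \<ge> 0" "E2 \<ge> 0" "P \<ge> 0" "P1 \<ge> 0"
    using assms(4)[of undefined] assms(5)[of undefined undefined] norm_ge_zero[of "\<psi> x"] assms(6)
      norm_ge_zero[of "\<psi>1 undefined x"] assms(7)[of undefined] by linarith+
  have t: "norm (a i j x *\<^sub>R (e1 j x *\<^sub>R \<psi>1 i x + e1 i x *\<^sub>R \<psi>1 j x + e2 i j x *\<^sub>R \<psi> x)
     + pd j (a i j) x *\<^sub>R e1 i x *\<^sub>R \<psi> x + pd i (a i j) x *\<^sub>R e1 j x *\<^sub>R \<psi> x)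
     \<le> C * (2 * E1 * P1 + E2 * P + 2 * E1 * P)" (is "norm ?t \<le> _") for i j
  proof -
    have s: "norm (e1 k x *\<^sub>R \<psi>1 l x) \<le> E1 * P1" "norm (e2 i j x *\<^sub>R \<psi> x) \<le> E2 * P" "norm (e1 k x *\<^sub>R \<psi> x) \<le> E1 * P" for k l
      using assms nn by (auto intro!: mult_mono)
    have "norm (e1 j x *\<^sub>R \<psi>1 i x + e1 i x *\<^sub>R \<psi>1 j x + e2 i j x *\<^sub>R \<psi> x) \<le> E1 * P1 + E1 * P1 + E2 * P"
      by (intro norm_add_rule_thm s)
    then have "norm (a i j x *\<^sub>R (e1 j x *\<^sub>R \<psi>1 i x + e1 i x *\<^sub>R \<psi>1 j x + e2 i j x *\<^sub>R \<psi> x)) \<le> C * (E1 * P1 + E1 * P1 + E2 * P)"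
      using assms nn by (simp only: norm_scaleR) (intro mult_mono; simp)
    moreover have "norm (pd k (a i j) x *\<^sub>R e1 l x *\<^sub>R \<psi> x) \<le> C * (E1 * P)" for k l
      using assms(1,3) s(3)[of l] nn by (simp only: norm_scaleR[of "pd k (a i j) x"]) (intro mult_mono; simp)
    ultimately have "norm ?t \<le> C * (E1 * P1 + E1 * P1 + E2 * P) + C * (E1 * P) + C * (E1 * P)"
      by (intro norm_add_rule_thm)
    then show ?thesis by (simp add: algebra_simps)
  qed
  have "norm (adj_comm e e1 e2 \<psi> \<psi>1 x) \<le> (\<Sum>i\<in>(UNIV::'n set). \<Sum>j\<in>(UNIV::'n set). C * (2 * E1 * P1 + E2 * P + 2 * E1 * P))"
    unfolding adj_comm_def by (intro sum_norm_le t)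
  then show ?thesis by (simp add: power2_eq_square mult_ac)
qed

lemma coeff_bounds:
  obtains C where "C \<ge> 0" "\<And>i j x. x \<in> K \<Longrightarrow> \<bar>a i j x\<bar> \<le> C" "\<And>i j l x. x \<in> K \<Longrightarrow> \<bar>pd l (a i j) x\<bar> \<le> C"
    "\<And>i j l m x. x \<in> K \<Longrightarrow> \<bar>pd m (pd l (a i j)) x\<bar> \<le> C"
proof -
  note cont = hasC2D(3-5)[OF hasC2_coeff, THEN continuous_on_subset, OF K(2)]
  obtain C0 where C0: "C0 \<ge> 0" "\<And>ij x. x \<in> K \<Longrightarrow> norm ((case ij of (i, j) \<Rightarrow> a i j) x) \<le> C0"
    by (rule compact_family_norm_bound[OF K(1), of "\<lambda>(i, j). a i j"]) (auto intro: cont)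
  obtain C1 where C1: "C1 \<ge> 0" "\<And>ij x. x \<in> K \<Longrightarrow> norm ((case ij of (i, j, l) \<Rightarrow> pd l (a i j)) x) \<le> C1"
    by (rule compact_family_norm_bound[OF K(1), of "\<lambda>(i, j, l). pd l (a i j)"]) (auto intro: cont)
  obtain C2 where C2: "C2 \<ge> 0" "\<And>ij x. x \<in> K \<Longrightarrow> norm ((case ij of (i, j, l, m) \<Rightarrow> pd m (pd l (a i j))) x) \<le> C2"
    by (rule compact_family_norm_bound[OF K(1), of "\<lambda>(i, j, l, m). pd m (pd l (a i j))"]) (auto intro: cont)
  show ?thesis
  proof (rule that[of "C0 + C1 + C2"])
    fix i j l m x assume "x \<in> K"
    then show "\<bar>a i j x\<bar> \<le> C0 + C1 + C2" "\<bar>pd l (a i j) x\<bar> \<le> C0 + C1 + C2" "\<bar>pd m (pd l (a i j)) x\<bar> \<le> C0 + C1 + C2"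
      using C0(1) C1(1) C2(1) C0(2)[of x "(i, j)"] C1(2)[of x "(i, j, l)"] C2(2)[of x "(i, j, l, m)"] by simp_all
  qed (use C0 C1 C2 in simp)
qed

end

context elliptic_operator
begin

text \<open>A cutoff at scale \<open>\<epsilon>\<close> costs \<open>\<epsilon>\<^sup>-\<^sup>2\<close> on a set of volume \<open>\<epsilon>\<^sup>n\<close>. In dimension two this is too much, unless
  the test function vanishes at the puncture (\<open>k = 1\<close>).\<close>

lemma weak_solution_cutoff:
  fixes \<psi> :: "real^'n \<Rightarrow> 'b::euclidean_space" and k :: nat
  assumes v: "hasC2 (D - {0}) v v1 v2"
      "\<And>x. x \<in> D - {0} \<Longrightarrow> (\<Sum>i\<in>UNIV. \<Sum>j\<in>UNIV. a i j x * v2 j i x) = 0"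
    and V: "integrable lborel V" "V 0 = 0" "\<And>x. x \<in> K \<Longrightarrow> x \<noteq> 0 \<Longrightarrow> V x = v x"
    and \<psi>: "hasC2 D \<psi> \<psi>1 \<psi>2" "\<And>x. x \<notin> K \<Longrightarrow> \<psi> x = 0"
    and k: "k \<le> 1" "\<And>x. x \<in> K \<Longrightarrow> norm (\<psi> x) \<le> B * norm x ^ k"
    and growth: "\<And>c. c > 0 \<Longrightarrow> \<exists>r>0. \<forall>\<epsilon>. 0 < \<epsilon> \<longrightarrow> \<epsilon> < r \<longrightarrow>
      (\<forall>x\<in>K. \<epsilon> \<le> norm x \<longrightarrow> norm x \<le> 2 * \<epsilon> \<longrightarrow> \<bar>v x\<bar> \<le> c * \<epsilon> powr (2 - real k - real CARD('n)))"
  shows "(LINT x|lborel. V x *\<^sub>R (if x \<in> D then adj \<psi> \<psi>1 \<psi>2 x else 0)) = 0"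
proof -
  obtain h h1 h2 :: "real \<Rightarrow> real" and H where
    h: "\<And>t. (h has_real_derivative h1 t) (at t)" "\<And>t. (h1 has_real_derivative h2 t) (at t)"
    "continuous_on UNIV h2" "\<And>t. t \<le> 1 \<Longrightarrow> h t = 0" "\<And>t. t \<ge> 2 \<Longrightarrow> h t = 1" "\<And>t. \<bar>h t\<bar> \<le> 1"
    "\<And>t. \<bar>h1 t\<bar> \<le> H" "\<And>t. \<bar>h2 t\<bar> \<le> H" "H \<ge> 0"
    "\<And>t. t \<notin> {1..2} \<Longrightarrow> h1 t = 0" "\<And>t. t \<notin> {1..2} \<Longrightarrow> h2 t = 0"
    by (rule C2_step_function) (rule that)
  obtain C where C: "C \<ge> 0" "\<And>i j x. x \<in> K \<Longrightarrow> \<bar>a i j x\<bar> \<le> C" "\<And>i j l x. x \<in> K \<Longrightarrow> \<bar>pd l (a i j) x\<bar> \<le> C"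
    by (rule coeff_bounds) blast
  obtain P1 where P1: "P1 \<ge> 0" "\<And>l x. x \<in> K \<Longrightarrow> norm (\<psi>1 l x) \<le> P1"
    by (rule compact_family_norm_bound[OF K(1), of \<psi>1]) (use continuous_on_subset[OF hasC2D(4)[OF \<psi>(1)] K(2)] in auto)
  define B' where "B' = \<bar>B\<bar>"
  have B': "B' \<ge> 0" "\<And>x. x \<in> K \<Longrightarrow> norm (\<psi> x) \<le> B' * norm x ^ k"
  proof -
    show "norm (\<psi> x) \<le> B' * norm x ^ k" if "x \<in> K" for x
      by (rule order.trans[OF k(2)[OF that]]) (auto simp: B'_def intro!: mult_right_mono)
  qed (simp add: B'_def)
  \<comment> \<open>The cutoff is \<open>h\<close> of \<bar>x\<bar>^2 / \<epsilon>^2, which is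
    smooth also at 0. It vanishes for \<open>norm x \<le> \<epsilon>\<close> and is 1 for
    \<open>norm x > 2 * \<epsilon>\<close>, so its derivatives live in the annulus where the growth
    hypothesis is stated.\<close>
  define q where "q \<epsilon> x = inverse (\<epsilon>\<^sup>2) * (x \<bullet> x)" for \<epsilon> :: real and x :: "real^'n"
  define q1 where "q1 \<epsilon> l x = inverse (\<epsilon>\<^sup>2) * (2 * x$l)" for \<epsilon> :: real and l and x :: "real^'n"
  define q2 where "q2 \<epsilon> l m x = inverse (\<epsilon>\<^sup>2) * (if m = l then 2 else 0)" for \<epsilon> :: real and l m :: 'n and x :: "real^'n"
  define e where "e \<epsilon> x = h (q \<epsilon> x)" for \<epsilon> x
  define e1 where "e1 \<epsilon> l x = q1 \<epsilon> l x * h1 (q \<epsilon> x)" for \<epsilon> l x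
  define e2 where "e2 \<epsilon> l m x = q1 \<epsilon> l x * (q1 \<epsilon> m x * h2 (q \<epsilon> x)) + q2 \<epsilon> l m x * h1 (q \<epsilon> x)" for \<epsilon> l m x
  have "hasC2 D (\<lambda>x. inverse (\<epsilon>\<^sup>2) * (x \<bullet> x)) (q1 \<epsilon>) (q2 \<epsilon>)" for \<epsilon>
    using hasC2_inner_self[of D "inverse (\<epsilon>\<^sup>2)"] by (simp add: q1_def[abs_def] q2_def[abs_def])
  then have "hasC2 D (q \<epsilon>) (q1 \<epsilon>) (q2 \<epsilon>)" for \<epsilon> by (simp add: q_def[abs_def])
  from hasC2_chain[OF this h(1,2) continuous_on_subset[OF h(3)]]
  have e: "hasC2 D (e \<epsilon>) (e1 \<epsilon>) (e2 \<epsilon>)" for \<epsilon>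
    by (simp add: e_def[abs_def] e1_def[abs_def] e2_def[abs_def])
  define R where "R \<epsilon> = adj_comm (e \<epsilon>) (e1 \<epsilon>) (e2 \<epsilon>) \<psi> \<psi>1" for \<epsilon>
  define A where "A \<epsilon> = adj (\<lambda>x. e \<epsilon> x *\<^sub>R \<psi> x) (\<lambda>l x. e \<epsilon> x *\<^sub>R \<psi>1 l x + e1 \<epsilon> l x *\<^sub>R \<psi> x)
     (\<lambda>l m x. e \<epsilon> x *\<^sub>R \<psi>2 l m x + e1 \<epsilon> m x *\<^sub>R \<psi>1 l x + (e1 \<epsilon> l x *\<^sub>R \<psi>1 m x + e2 \<epsilon> l m x *\<^sub>R \<psi> x))" for \<epsilon>
  have AR: "A \<epsilon> x = e \<epsilon> x *\<^sub>R adj \<psi> \<psi>1 \<psi>2 x + R \<epsilon> x" for \<epsilon> x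
    unfolding A_def R_def by (rule adj_product)
  have e\<psi>: "hasC2 D (\<lambda>x. e \<epsilon> x *\<^sub>R \<psi> x) (\<lambda>l x. e \<epsilon> x *\<^sub>R \<psi>1 l x + e1 \<epsilon> l x *\<^sub>R \<psi> x)
     (\<lambda>l m x. e \<epsilon> x *\<^sub>R \<psi>2 l m x + e1 \<epsilon> m x *\<^sub>R \<psi>1 l x + (e1 \<epsilon> l x *\<^sub>R \<psi>1 m x + e2 \<epsilon> l m x *\<^sub>R \<psi> x))" for \<epsilon>
    by (rule hasC2_scaleR[OF e \<psi>(1)])
  have qsmall: "q \<epsilon> x < 1" if "\<epsilon> > 0" "norm x < \<epsilon>" for \<epsilon> x
  proof -
    have "(norm x)\<^sup>2 < \<epsilon>\<^sup>2" using that by (intro power_strict_mono) auto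
    then show ?thesis using that by (simp add: q_def power2_norm_eq_inner divide_inverse_commute[symmetric])
  qed
  have qlarge: "q \<epsilon> x > 2" if "\<epsilon> > 0" "norm x > 2 * \<epsilon>" for \<epsilon> x
  proof -
    have "(2 * \<epsilon>)\<^sup>2 < (norm x)\<^sup>2" using that by (intro power_strict_mono) auto
    moreover have "2 * \<epsilon>\<^sup>2 < (2 * \<epsilon>)\<^sup>2" using that by (simp add: power_mult_distrib)
    ultimately have "2 * \<epsilon>\<^sup>2 < (norm x)\<^sup>2" by (rule less_trans[rotated])
    then have "2 * \<epsilon>\<^sup>2 < x \<bullet> x" by (simp only: power2_norm_eq_inner)
    then show ?thesis using that by (simp add: q_def divide_inverse_commute[symmetric] less_divide_eq)
  qed
  have adjK: "adj \<psi> \<psi>1 \<psi>2 x = 0" if "x \<in> D" "x \<notin> K" for x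
    by (rule adj_zero_outside[OF \<psi> compact_imp_closed[OF K(1)] that])
  have AK: "A \<epsilon> x = 0" if "x \<in> D" "x \<notin> K" for x \<epsilon>
    unfolding A_def
    by (rule adj_zero_outside[OF e\<psi> _ compact_imp_closed[OF K(1)] that]) (simp add: \<psi>(2))
  \<comment> \<open>The product \<open>e \<epsilon> x *\<^sub>R \<psi> x\<close> is supported in
    \<open>K - ball 0 \<epsilon>\<close>, away from the puncture, so the identity off the
    singularity applies.\<close>
  have zero: "(LINT x|lborel. (if x \<in> D then V x *\<^sub>R A \<epsilon> x else 0)) = 0" if \<epsilon>: "\<epsilon> > 0" for \<epsilon>
  proof -
    have "(LINT x|lborel. (if x \<in> D - {0} then v x *\<^sub>R A \<epsilon> x else 0)) = 0"
      unfolding A_def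
    proof (rule weak_solution_punctured[OF _ _ _ _ v e\<psi>])
      show "open (D - {0})" using D by (simp add: open_delete)
      show "compact (K - ball 0 \<epsilon>)" using K(1) by (simp add: compact_diff)
      show "K - ball 0 \<epsilon> \<subseteq> D - {0}" using K(2) \<epsilon> by auto
      show "e \<epsilon> x *\<^sub>R \<psi> x = 0" if "x \<notin> K - ball 0 \<epsilon>" for x
      proof (cases "x \<in> K")
        case True
        then have "q \<epsilon> x < 1" using that \<epsilon> by (intro qsmall) auto
        then show ?thesis using h(4) by (simp add: e_def)
      qed (simp add: \<psi>(2))
    qed auto
    moreover have "(if x \<in> D - {0} then v x *\<^sub>R A \<epsilon> x else 0) = (if x \<in> D then V x *\<^sub>R A \<epsilon> x else 0)" for x
      using V(2,3) AK[of x] by (cases "x \<in> K") auto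
    ultimately show ?thesis by simp
  qed
  define g where "g x = (if x \<in> D then V x *\<^sub>R adj \<psi> \<psi>1 \<psi>2 x else 0)" for x
  have g: "integrable lborel g"
    unfolding g_def[abs_def]
    by (rule integrable_mult_compact_support[OF V(1) adj_continuous[OF \<psi>(1)] adjK])
  have Aint: "integrable lborel (\<lambda>x. if x \<in> D then V x *\<^sub>R A \<epsilon> x else 0)" for \<epsilon>
    by (rule integrable_mult_compact_support[OF V(1) _ AK]) (simp_all add: A_def adj_continuous[OF e\<psi>])
  have e_cont: "continuous_on UNIV (e \<epsilon>)" for \<epsilon>
  proof -
    have "continuous_on UNIV h" using DERIV_isCont[OF h(1)] by (simp add: continuous_at_imp_continuous_on)
    then show ?thesis unfolding e_def[abs_def] q_def
      by (rule continuous_on_compose2) (auto intro!: continuous_intros)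
  qed
  then have [measurable]: "e \<epsilon> \<in> borel_measurable borel" for \<epsilon>
    by (rule borel_measurable_continuous_onI)
  have [measurable]: "g \<in> borel_measurable borel" using borel_measurable_integrable[OF g] by simp
  have egint: "integrable lborel (\<lambda>x. e \<epsilon> x *\<^sub>R g x)" for \<epsilon>
  proof (rule Bochner_Integration.integrable_bound[OF g])
    show "AE x in lborel. norm (e \<epsilon> x *\<^sub>R g x) \<le> norm (g x)"
      using h(6) by (auto simp: e_def intro!: AE_I2 mult_left_le_one_le)
  qed measurable
  \<comment> \<open>\<open>VR\<close> is the commutator error. Since the full integral vanishes, its
    integral is minus that of \<open>e \<epsilon> x *\<^sub>R g x\<close>, which tends to minus the
    integral of \<open>g\<close> by dominated convergence. It remains to make the error
    small.\<close>
  define VR where "VR \<epsilon> x = (if x \<in> D then V x *\<^sub>R R \<epsilon> x else 0)" for \<epsilon> x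
  have VR_eq: "VR \<epsilon> x = (if x \<in> D then V x *\<^sub>R A \<epsilon> x else 0) - e \<epsilon> x *\<^sub>R g x" for \<epsilon> x
    by (simp add: VR_def AR g_def scaleR_add_right mult.commute)
  have VR_int: "integrable lborel (VR \<epsilon>)" for \<epsilon>
    unfolding VR_eq[abs_def] by (intro Bochner_Integration.integrable_diff Aint egint)
  have VR: "(LINT x|lborel. VR \<epsilon> x) = - (LINT x|lborel. e \<epsilon> x *\<^sub>R g x)" if "\<epsilon> > 0" for \<epsilon>
    unfolding VR_eq using zero[OF that] by (subst Bochner_Integration.integral_diff[OF Aint egint]) simp
  \<comment> \<open>From \<open>adj_comm_bound\<close> with \<bar>e1\<bar> at most 4H/\<epsilon>,
    \<bar>e2\<bar> at most 18H/\<epsilon>^2 (16 from \<open>h2\<close>, 2 from \<open>h1\<close>)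
    and \<open>norm (\<psi> x)\<close> at most \<open>2 * B' * \<epsilon> ^ k\<close>: the term with
    \<open>\<psi>1\<close> gives 8, and 52 = 2 * 18 + 2 * 4 * 2.\<close>
  define Q where "Q = (real CARD('n))\<^sup>2 * (C * (8 * H * P1 + 52 * H * B'))"
  have Q: "Q \<ge> 0" unfolding Q_def using C(1) h(9) P1(1) B'(1) by simp
  have Rout: "R \<epsilon> x = 0" if "\<epsilon> > 0" "\<not> (\<epsilon> \<le> norm x \<and> norm x \<le> 2 * \<epsilon>)" for \<epsilon> x
  proof -
    have "q \<epsilon> x \<notin> {1..2}" using qsmall[OF that(1), of x] qlarge[OF that(1), of x] that(2) by fastforce
    then have "e1 \<epsilon> l x = 0" "e2 \<epsilon> l m x = 0" for l m using h(10,11) by (simp_all add: e1_def e2_def)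
    then show ?thesis by (simp add: R_def adj_comm_def)
  qed
  have Rbound: "norm (R \<epsilon> x) \<le> Q * \<epsilon> powr (real k - 2)"
    if \<epsilon>: "0 < \<epsilon>" "\<epsilon> < 1" and x: "x \<in> K" "\<epsilon> \<le> norm x" "norm x \<le> 2 * \<epsilon>" for \<epsilon> x
  proof -
    have q1b: "\<bar>q1 \<epsilon> l x\<bar> \<le> 4 / \<epsilon>" for l
    proof -
      have "\<bar>x$l\<bar> \<le> 2 * \<epsilon>" using component_le_norm_cart[of x l] x(3) by linarith
      then have "inverse (\<epsilon>\<^sup>2) * (2 * \<bar>x$l\<bar>) \<le> inverse (\<epsilon>\<^sup>2) * (2 * (2 * \<epsilon>))"
        by (intro mult_left_mono) auto
      then show ?thesis using \<epsilon> by (simp add: q1_def abs_mult power2_eq_square field_simps)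
    qed
    have e1b: "\<bar>e1 \<epsilon> l x\<bar> \<le> 4 * H / \<epsilon>" for l
    proof -
      have "\<bar>q1 \<epsilon> l x\<bar> * \<bar>h1 (q \<epsilon> x)\<bar> \<le> 4 / \<epsilon> * H" by (intro mult_mono q1b h) (use \<epsilon> in auto)
      then show ?thesis by (simp add: e1_def abs_mult)
    qed
    have e2b: "\<bar>e2 \<epsilon> l m x\<bar> \<le> 18 * H / \<epsilon>\<^sup>2" for l m
    proof -
      have "\<bar>q1 \<epsilon> l x\<bar> * (\<bar>q1 \<epsilon> m x\<bar> * \<bar>h2 (q \<epsilon> x)\<bar>) \<le> 4 / \<epsilon> * (4 / \<epsilon> * H)"
        by (intro mult_mono q1b h) (use \<epsilon> in auto)
      moreover have "\<bar>q2 \<epsilon> l m x\<bar> * \<bar>h1 (q \<epsilon> x)\<bar> \<le> inverse (\<epsilon>\<^sup>2) * 2 * H"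
        by (intro mult_mono h) (auto simp: q2_def)
      moreover have "4 / \<epsilon> * (4 / \<epsilon> * H) + inverse (\<epsilon>\<^sup>2) * 2 * H = 18 * H / \<epsilon>\<^sup>2"
        using \<epsilon> by (simp add: power2_eq_square field_simps)
      moreover have "\<bar>e2 \<epsilon> l m x\<bar> \<le> \<bar>q1 \<epsilon> l x\<bar> * (\<bar>q1 \<epsilon> m x\<bar> * \<bar>h2 (q \<epsilon> x)\<bar>) + \<bar>q2 \<epsilon> l m x\<bar> * \<bar>h1 (q \<epsilon> x)\<bar>"
        unfolding e2_def using abs_triangle_ineq[of "q1 \<epsilon> l x * (q1 \<epsilon> m x * h2 (q \<epsilon> x))" "q2 \<epsilon> l m x * h1 (q \<epsilon> x)"]
        by (simp add: abs_mult)
      ultimately show ?thesis by linarith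
    qed
    have Pb: "norm (\<psi> x) \<le> B' * (2 * \<epsilon> ^ k)"
    proof -
      have "norm x ^ k \<le> (2 * \<epsilon>) ^ k" using x(3) by (intro power_mono) auto
      also have "\<dots> \<le> 2 * \<epsilon> ^ k" using k(1) \<epsilon> by (cases k) auto
      finally have "B' * norm x ^ k \<le> B' * (2 * \<epsilon> ^ k)" using B'(1) by (intro mult_left_mono)
      then show ?thesis using B'(2)[OF x(1)] by linarith
    qed
    define W where "W = \<epsilon> powr (real k - 2)"
    have W: "\<epsilon> ^ k / \<epsilon>\<^sup>2 = W"
      using \<epsilon> by (simp add: W_def powr_diff powr_realpow)
    \<comment> \<open>First derivatives of \<open>\<psi>\<close> need not vanish at 0, so their term
      is only of size 1/\<epsilon>; it stays below \<epsilon>^(k-2) because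
      \<open>k \<le> 1\<close>.\<close>
    have W1: "1 / \<epsilon> \<le> W"
    proof -
      have "\<epsilon> powr (-1) \<le> \<epsilon> powr (real k - 2)" using \<epsilon> k(1) by (intro powr_mono') auto
      then show ?thesis using \<epsilon> by (simp add: W_def powr_minus divide_inverse)
    qed
    have W2: "\<epsilon> ^ k / \<epsilon> \<le> W"
    proof -
      have "\<epsilon> ^ k \<le> 1" using \<epsilon> by (simp add: power_le_one)
      then have "\<epsilon> ^ k / \<epsilon> \<le> 1 / \<epsilon>" using \<epsilon> by (simp add: divide_right_mono)
      then show ?thesis using W1 by linarith
    qed
    have "norm (R \<epsilon> x) \<le> (real CARD('n))\<^sup>2 * (C * (2 * (4 * H / \<epsilon>) * P1 + 18 * H / \<epsilon>\<^sup>2 * (B' * (2 * \<epsilon> ^ k)) + 2 * (4 * H / \<epsilon>) * (B' * (2 * \<epsilon> ^ k))))"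
      unfolding R_def by (intro adj_comm_bound C(1) C(2)[OF x(1)] C(3)[OF x(1)] e1b e2b Pb P1(2)[OF x(1)])
    also have "\<dots> = (real CARD('n))\<^sup>2 * (C * (8 * H * P1 * (1 / \<epsilon>) + 36 * H * B' * (\<epsilon> ^ k / \<epsilon>\<^sup>2) + 16 * H * B' * (\<epsilon> ^ k / \<epsilon>)))"
      by (simp add: field_simps)
    also have "\<dots> \<le> (real CARD('n))\<^sup>2 * (C * (8 * H * P1 * W + 36 * H * B' * W + 16 * H * B' * W))"
      using C(1) h(9) P1(1) B'(1) W W1 W2 by (intro mult_left_mono add_mono) auto
    also have "\<dots> = Q * W" by (simp add: Q_def algebra_simps)
    finally show ?thesis by (simp add: W_def)
  qed
  \<comment> \<open>The powers of \<epsilon> cancel: 2 - k - n from the growth of \<open>v\<close>,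
    k - 2 from the commutator, n from the volume. The arbitrary constant \<open>c\<close> remains as
    the only small factor.\<close>
  have main: "norm (LINT x|lborel. g x) \<le> c * (Q * (2 ^ CARD('n) * unit_ball_vol (real CARD('n))))" if c: "c > 0" for c
  proof -
    obtain r where r: "r > 0" "\<And>\<epsilon> x. 0 < \<epsilon> \<Longrightarrow> \<epsilon> < r \<Longrightarrow> x \<in> K \<Longrightarrow> \<epsilon> \<le> norm x \<Longrightarrow> norm x \<le> 2 * \<epsilon> \<Longrightarrow>
        \<bar>v x\<bar> \<le> c * \<epsilon> powr (2 - real k - real CARD('n))"
      using growth[OF c] by blast
    have est: "norm (LINT x|lborel. e \<epsilon> x *\<^sub>R g x) \<le> c * (Q * (2 ^ CARD('n) * unit_ball_vol (real CARD('n))))"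
      if \<epsilon>: "0 < \<epsilon>" "\<epsilon> < min 1 r" for \<epsilon>
    proof -
      define b where "b = c * Q * \<epsilon> powr (- real CARD('n))"
      have b0: "b \<ge> 0" unfolding b_def using c Q by simp
      have pw: "norm (VR \<epsilon> x) \<le> b * indicator (cball 0 (2 * \<epsilon>)) x" for x
      proof (cases "x \<in> K \<and> \<epsilon> \<le> norm x \<and> norm x \<le> 2 * \<epsilon>")
        case True
        then have x: "x \<in> K" "\<epsilon> \<le> norm x" "norm x \<le> 2 * \<epsilon>" "x \<noteq> 0" using \<epsilon> by auto
        have "norm (VR \<epsilon> x) \<le> \<bar>v x\<bar> * norm (R \<epsilon> x)" using V(3)[OF x(1,4)] by (simp add: VR_def)
        also have "\<dots> \<le> (c * \<epsilon> powr (2 - real k - real CARD('n))) * (Q * \<epsilon> powr (real k - 2))"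
          using r(2)[of \<epsilon> x] Rbound[of \<epsilon> x] \<epsilon> x c by (intro mult_mono) auto
        also have "\<dots> = c * Q * (\<epsilon> powr (2 - real k - real CARD('n)) * \<epsilon> powr (real k - 2))" by simp
        also have "\<dots> = b" unfolding b_def powr_add[symmetric] by simp
        finally show ?thesis using x by simp
      next
        case False
        have "VR \<epsilon> x = 0"
        proof (cases "x \<in> D \<and> x \<notin> K")
          case True
          then show ?thesis using AK[of x \<epsilon>] adjK[of x] by (simp add: VR_eq g_def)
        next
          case f: False
          then show ?thesis using False Rout[OF \<epsilon>(1), of x] by (auto simp: VR_def)
        qed
        then show ?thesis using b0 by simp
      qed
      have "norm (LINT x|lborel. e \<epsilon> x *\<^sub>R g x) = norm (LINT x|lborel. VR \<epsilon> x)" using VR[OF \<epsilon>(1)] by simp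
      also have "\<dots> \<le> (LINT x|lborel. norm (VR \<epsilon> x))" by (rule integral_norm_bound)
      also have "\<dots> \<le> (LINT x|lborel. b * indicator (cball 0 (2 * \<epsilon>)) (x::real^'n))"
        by (rule integral_mono) (use VR_int pw in \<open>auto intro!: integrable_real_indicator emeasure_lborel_cball_finite\<close>)
      also have "\<dots> = b * measure lborel (cball (0::real^'n) (2 * \<epsilon>))" by simp
      also have "measure lborel (cball (0::real^'n) (2 * \<epsilon>)) = unit_ball_vol (real CARD('n)) * (2 * \<epsilon>) ^ CARD('n)"
        using content_cball[of "2 * \<epsilon>" "0::real^'n"] \<epsilon> by simp
      also have "b * (unit_ball_vol (real CARD('n)) * (2 * \<epsilon>) ^ CARD('n)) = c * (Q * (2 ^ CARD('n) * unit_ball_vol (real CARD('n)))) * (\<epsilon> powr (- real CARD('n)) * \<epsilon> ^ CARD('n))"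
        by (simp add: b_def power_mult_distrib)
      also have "\<epsilon> powr (- real CARD('n)) * \<epsilon> ^ CARD('n) = 1"
        using \<epsilon> by (simp add: powr_realpow[symmetric] powr_add[symmetric])
      finally show ?thesis by simp
    qed
    have lim: "(\<lambda>m. LINT x|lborel. e (inverse (real (Suc m))) x *\<^sub>R g x) \<longlonglongrightarrow> (LINT x|lborel. g x)"
    proof (rule integral_dominated_convergence[where w="\<lambda>x. norm (g x)"])
      show "integrable lborel (\<lambda>x. norm (g x))" using g by (rule integrable_norm)
      show "AE x in lborel. norm (e (inverse (real (Suc m))) x *\<^sub>R g x) \<le> norm (g x)" for m
        using h(6) by (auto simp: e_def intro!: AE_I2 mult_left_le_one_le)
      have "(\<lambda>m. e (inverse (real (Suc m))) x *\<^sub>R g x) \<longlonglongrightarrow> g x" for x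
      proof (cases "x = 0")
        case True
        then show ?thesis using V(2) by (simp add: g_def)
      next
        case False
        then have "norm x / 2 > 0" by simp
        from order_tendstoD(2)[OF LIMSEQ_inverse_real_of_nat this]
        have "\<forall>\<^sub>F m in sequentially. e (inverse (real (Suc m))) x *\<^sub>R g x = g x"
        proof eventually_elim
          case (elim m)
          then have "q (inverse (real (Suc m))) x > 2" by (intro qlarge) auto
          then show ?case using h(5) by (simp add: e_def)
        qed
        then show ?thesis by (rule tendsto_eventually)
      qed
      then show "AE x in lborel. (\<lambda>m. e (inverse (real (Suc m))) x *\<^sub>R g x) \<longlonglongrightarrow> g x" by (intro AE_I2)
    qed measurable
    have "min 1 r > 0" using r(1) by simp
    from order_tendstoD(2)[OF LIMSEQ_inverse_real_of_nat this]
    have "\<forall>\<^sub>F m in sequentially. norm (LINT x|lborel. e (inverse (real (Suc m))) x *\<^sub>R g x) \<le> c * (Q * (2 ^ CARD('n) * unit_ball_vol (real CARD('n))))"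
      by eventually_elim (intro est, auto)
    then show ?thesis by (rule tendsto_upperbound[OF tendsto_norm[OF lim]]) simp
  qed
  have "norm (LINT x|lborel. g x) \<le> 0"
  proof (rule field_le_epsilon)
    fix d :: real assume d: "d > 0"
    define T where "T = Q * (2 ^ CARD('n) * unit_ball_vol (real CARD('n)))"
    have T: "T \<ge> 0" unfolding T_def using Q by (intro mult_nonneg_nonneg) auto
    have "norm (LINT x|lborel. g x) \<le> d / (T + 1) * T" unfolding T_def by (rule main) (use d T in \<open>simp add: T_def\<close>)
    also have "\<dots> \<le> 0 + d" using d T by (simp add: field_simps)
    finally show "norm (LINT x|lborel. g x) \<le> 0 + d" .
  qed
  moreover have "g x = V x *\<^sub>R (if x \<in> D then adj \<psi> \<psi>1 \<psi>2 x else 0)" for x by (simp add: g_def)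
  ultimately show ?thesis by simp
qed

end

section \<open>The logarithmic cutoff in dimension two\<close>

text \<open>Applied to an \<open>s\<close> bounded below by a multiple of \<bar>x\<bar>^2; the
  exponent -1/2 then turns the bound into a multiple of 1/\<bar>x\<bar>.\<close>

lemma abs_ln_le_inverse:
  fixes s :: real
  assumes "s > 0"
  shows "\<bar>ln s\<bar> \<le> s + 2 * s powr (- 1 / 2)"
proof -
  have "ln s \<le> s" using assms ln_le_minus_one[of s] by linarith
  moreover have "- ln s \<le> 2 * s powr (- 1 / 2)"
  proof -
    have "ln (s powr (- 1 / 2)) \<le> s powr (- 1 / 2)"
      using assms ln_le_minus_one[of "s powr (- 1 / 2)"] by simp
    then show ?thesis using assms by (simp add: ln_powr)
  qed
  moreover have "0 \<le> s powr (- 1 / 2)" by simp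
  ultimately show ?thesis using assms by linarith
qed

text \<open>This exchanges log \<bar>x\<bar> for log \<tau> under the integral. The price \<tau>/s
  is affordable: times the mass at scale \<tau> it is dominated by
  \<open>kernel_product (1/2) \<tau>\<close>, whose integral does not depend on \<tau>.\<close>

lemma abs_ln_le_scaled:
  fixes s \<tau> :: real
  assumes "0 < s" "s \<le> 1" "0 < \<tau>" "\<tau> \<le> 1"
  shows "\<bar>ln s\<bar> \<le> \<bar>ln \<tau>\<bar> + \<tau> / s"
proof -
  have "ln (\<tau> / s) \<le> \<tau> / s" using assms ln_le_minus_one[of "\<tau> / s"] by simp
  moreover have "ln (\<tau> / s) = ln \<tau> - ln s" using assms by (simp add: ln_div)
  moreover have "ln s \<le> 0" "ln \<tau> \<le> 0" using assms by auto
  ultimately show ?thesis by linarith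
qed

lemma hasC2_quadratic_form:
  fixes H :: "real^'n::finite^'n"
  assumes "\<And>i j. H$i$j = H$j$i"
  shows "hasC2 D (\<lambda>x. x \<bullet> (H *v x)) (\<lambda>l x. 2 * (H *v x)$l) (\<lambda>l m x. 2 * H$l$m)"
proof -
  have comp: "has_partials (\<lambda>x. (H *v x)$l) (\<lambda>m. H$l$m) x" for l and x :: "real^'n"
  proof -
    have "has_partials (\<lambda>x. \<Sum>j\<in>UNIV. H$l$j * x$j) (\<lambda>m. \<Sum>j\<in>UNIV. H$l$j * (if m = j then 1 else 0)) x"
      by (intro has_partials_sum has_partials_linear[OF bounded_linear_mult_right] has_partials_component)
    then show ?thesis by (simp add: matrix_vector_mult_def if_distrib cong: if_cong)
  qed
  have 1: "has_partials (\<lambda>x. x \<bullet> (H *v x)) (\<lambda>l. 2 * (H *v x)$l) x" for x :: "real^'n"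
  proof -
    have "has_partials (\<lambda>x. \<Sum>i\<in>UNIV. x$i * (H *v x)$i)
      (\<lambda>l. \<Sum>i\<in>UNIV. (x$i * H$i$l + (if l = i then 1 else 0) * (H *v x)$i)) x"
      by (intro has_partials_sum has_partials_mult has_partials_component comp)
    moreover have "(\<Sum>i\<in>UNIV. (x$i * H$i$l + (if l = i then 1 else 0) * (H *v x)$i)) = 2 * (H *v x)$l" for l
    proof -
      have "(\<Sum>i\<in>UNIV. x$i * H$i$l) = (H *v x)$l"
        by (simp add: matrix_vector_mult_def assms[of _ l] mult.commute)
      moreover have "(\<Sum>i\<in>UNIV. (if l = i then 1 else 0) * (H *v x)$i) = (H *v x)$l"
      proof -
        have "(\<Sum>i\<in>UNIV. (if l = i then 1 else 0) * (H *v x)$i) = (\<Sum>i\<in>UNIV. if l = i then (H *v x)$i else 0)"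
          by (intro sum.cong) auto
        then show ?thesis by simp
      qed
      ultimately show ?thesis by (simp only: sum.distrib mult_2)
    qed
    ultimately show ?thesis by (simp add: inner_vec_def)
  qed
  have 2: "has_partials (\<lambda>x. 2 * (H *v x)$l) (\<lambda>m. 2 * H$l$m) x" for l and x :: "real^'n"
    by (rule has_partials_linear[OF bounded_linear_mult_right comp])
  show ?thesis unfolding hasC2_def using 1 2 by auto
qed

context elliptic_operator
begin

text \<open>The mean value inequality on the convex set \<open>K\<close>. It serves to freeze
  coefficients at 0, and to provide the linear vanishing of test functions with value 0
  there.\<close>

lemma hasC2_lipschitz_at_0:
  fixes \<psi> :: "real^'n \<Rightarrow> 'b::euclidean_space"
  assumes K0: "convex K" "0 \<in> K" and \<psi>: "hasC2 D \<psi> \<psi>1 \<psi>2"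
  obtains B where "B \<ge> 0" "\<And>x. x \<in> K \<Longrightarrow> norm (\<psi> x - \<psi> 0) \<le> B * norm x"
proof -
  obtain P1 where P1: "P1 \<ge> 0" "\<And>l x. x \<in> K \<Longrightarrow> norm (\<psi>1 l x) \<le> P1"
    by (rule compact_family_norm_bound[OF K(1), of \<psi>1]) (use continuous_on_subset[OF hasC2D(4)[OF \<psi>] K(2)] in auto)
  have "norm (\<psi> x - \<psi> 0) \<le> (real CARD('n) * P1) * norm (x - 0)" if "x \<in> K" for x
  proof (rule differentiable_bound[OF K0(1) _ _ that K0(2)])
    fix y assume y: "y \<in> K"
    show "(\<psi> has_derivative (\<lambda>h. \<Sum>l\<in>UNIV. h$l *\<^sub>R \<psi>1 l y)) (at y within K)"
      using hasC2D(1)[OF \<psi>, of y] y K(2) unfolding has_partials_def by (auto intro: has_derivative_at_withinI)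
    show "onorm (\<lambda>h. \<Sum>l\<in>UNIV. h$l *\<^sub>R \<psi>1 l y) \<le> real CARD('n) * P1"
    proof (rule onorm_le)
      fix h :: "real^'n"
      have "norm (\<Sum>l\<in>UNIV. h$l *\<^sub>R \<psi>1 l y) \<le> (\<Sum>l\<in>(UNIV::'n set). norm h * P1)"
        using component_le_norm_cart[of h] P1(2)[OF y] by (intro sum_norm_le) (auto intro!: mult_mono)
      then show "norm (\<Sum>l\<in>UNIV. h$l *\<^sub>R \<psi>1 l y) \<le> real CARD('n) * P1 * norm h" by (simp add: mult_ac)
    qed
  qed
  then show ?thesis using P1(1) that[of "real CARD('n) * P1"] by simp
qed

text \<open>The logarithm of a regularized quadratic form adapted to the frozen operator serves as a
  cutoff of vanishing capacity in dimension two: the frozen operator applied to it is the bounded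
  mass \<open>4d\<tau>\<^sup>2/(q+\<tau>\<^sup>2)\<^sup>2\<close>, and freezing costs only \<open>O(1/|x|)\<close>.\<close>

lemma log_commutator_bound:
  fixes H :: "real^'n^'n" and \<eta> :: "real^'n \<Rightarrow> real"
  assumes dim: "CARD('n) = 2" and zero: "0 \<in> D" and Kball: "convex K" "0 \<in> K" "K \<subseteq> cball 0 1"
    and H: "\<And>i j. H$i$j = H$j$i" "\<And>i k. (\<Sum>j\<in>UNIV. a i j 0 * H$j$k) = (if i = k then d else 0)"
      "0 < m" "m \<le> 1" "\<And>x. m * (norm x)\<^sup>2 \<le> x \<bullet> (H *v x)"
    and \<eta>: "hasC2 D \<eta> \<eta>1 \<eta>2"
  shows "\<exists>C\<ge>0. \<forall>\<tau> c. 0 < \<tau> \<longrightarrow> \<tau> \<le> 1 \<longrightarrow> (\<exists>L1 L2. hasC2 D (\<lambda>x. ln (x \<bullet> (H *v x) + \<tau>\<^sup>2) + c) L1 L2 \<and>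
    (\<forall>x\<in>K. x \<noteq> 0 \<longrightarrow> \<bar>ln (x \<bullet> (H *v x) + \<tau>\<^sup>2) * adj \<eta> \<eta>1 \<eta>2 x
        + adj_comm (\<lambda>x. ln (x \<bullet> (H *v x) + \<tau>\<^sup>2) + c) L1 L2 \<eta> \<eta>1 x\<bar>
      \<le> C * (norm x powr (- 1) + (\<tau> / ((norm x)\<^sup>2 + \<tau>\<^sup>2))\<^sup>2)))"
proof -
  obtain A where A: "A \<ge> 0" "\<And>i j x. x \<in> K \<Longrightarrow> \<bar>a i j x\<bar> \<le> A" "\<And>i j l x. x \<in> K \<Longrightarrow> \<bar>pd l (a i j) x\<bar> \<le> A"
    by (rule coeff_bounds) blast
  obtain P where P: "P \<ge> 0" "\<And>x. x \<in> K \<Longrightarrow> norm (\<eta> x) \<le> P"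
    by (rule compact_norm_bound[OF K(1) continuous_on_subset[OF hasC2D(3)[OF \<eta>] K(2)]]) (rule that)
  obtain P1 where P1: "P1 \<ge> 0" "\<And>l x. x \<in> K \<Longrightarrow> norm (\<eta>1 l x) \<le> P1"
    by (rule compact_family_norm_bound[OF K(1), of \<eta>1]) (use continuous_on_subset[OF hasC2D(4)[OF \<eta>] K(2)] in auto)
  obtain P2 where P2: "P2 \<ge> 0" "\<And>x. x \<in> K \<Longrightarrow> norm (adj \<eta> \<eta>1 \<eta>2 x) \<le> P2"
    by (rule compact_norm_bound[OF K(1) continuous_on_subset[OF adj_continuous[OF \<eta>] K(2)]]) (rule that)
  have "\<exists>B\<ge>0. \<forall>x\<in>K. \<bar>a i j x - a i j 0\<bar> \<le> B * norm x" for i j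
    by (rule hasC2_lipschitz_at_0[OF Kball(1,2) hasC2_coeff[of i j]]) auto
  then obtain B0 where B0: "\<And>i j. B0 i j \<ge> 0" "\<And>i j x. x \<in> K \<Longrightarrow> \<bar>a i j x - a i j 0\<bar> \<le> B0 i j * norm x" by metis
  define B where "B = (\<Sum>i\<in>UNIV. \<Sum>j\<in>UNIV. B0 i j)"
  have B: "B \<ge> 0" unfolding B_def by (intro sum_nonneg B0)
  have aB: "\<bar>a i j x - a i j 0\<bar> \<le> B * norm x" if "x \<in> K" for i j x
  proof -
    have "B0 i j \<le> (\<Sum>j\<in>UNIV. B0 i j)" using B0(1) by (intro member_le_sum) auto
    also have "\<dots> \<le> B" unfolding B_def using B0(1) by (intro member_le_sum) (auto intro!: sum_nonneg)
    finally have "B0 i j * norm x \<le> B * norm x" by (intro mult_right_mono) auto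
    then show ?thesis using B0(2)[OF that, of i j] by linarith
  qed
  define h where "h = (\<Sum>i\<in>UNIV. \<Sum>j\<in>UNIV. \<bar>H$i$j\<bar>)"
  have h0: "h \<ge> 0" unfolding h_def by (intro sum_nonneg) auto
  have hH: "\<bar>H$i$j\<bar> \<le> h" for i j
  proof -
    have "\<bar>H$i$j\<bar> \<le> (\<Sum>j\<in>UNIV. \<bar>H$i$j\<bar>)" by (intro member_le_sum) auto
    also have "\<dots> \<le> h" unfolding h_def by (intro member_le_sum) (auto intro!: sum_nonneg)
    finally show ?thesis .
  qed
  have Hx: "\<bar>(H *v x)$l\<bar> \<le> 2 * h * norm x" for l x
  proof -
    have "\<bar>\<Sum>j\<in>UNIV. H$l$j * x$j\<bar> \<le> (\<Sum>j\<in>(UNIV::'n set). h * norm x)"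
      using hH component_le_norm_cart[of x] h0 by (intro order.trans[OF sum_abs] sum_mono) (auto simp: abs_mult intro!: mult_mono)
    then show ?thesis by (simp add: matrix_vector_mult_def dim)
  qed
  define q where "q x = x \<bullet> (H *v x)" for x
  have q: "m * (norm x)\<^sup>2 \<le> q x" "0 \<le> q x" for x
  proof -
    show "m * (norm x)\<^sup>2 \<le> q x" using H(5) by (simp add: q_def)
    then show "0 \<le> q x" by (rule order.trans[rotated]) (use H(3) in simp)
  qed
  have s_low: "m * ((norm x)\<^sup>2 + \<tau>\<^sup>2) \<le> q x + \<tau>\<^sup>2" for x \<tau>
    using q(1)[of x] mult_right_mono[OF H(4), of "\<tau>\<^sup>2"] by (simp add: distrib_left)
  have q_up: "q x \<le> 4 * h * (norm x)\<^sup>2" for x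
  proof -
    have "q x \<le> (\<Sum>i\<in>(UNIV::'n set). norm x * (2 * h * norm x))"
      unfolding q_def inner_vec_def
    proof (rule sum_mono)
      fix i
      have "x$i * (H *v x)$i \<le> \<bar>x$i\<bar> * \<bar>(H *v x)$i\<bar>" by (metis abs_ge_self abs_mult)
      also have "\<dots> \<le> norm x * (2 * h * norm x)"
        using Hx[of x i] component_le_norm_cart[of x i] by (intro mult_mono) auto
      finally show "x$i \<bullet> (H *v x)$i \<le> norm x * (2 * h * norm x)" by simp
    qed
    then show ?thesis by (simp add: dim power2_eq_square mult_ac)
  qed
  define k1 where "k1 = 4 * h / m"
  define k2 where "k2 = 16 * h\<^sup>2 / m\<^sup>2 + 2 * h / m"
  define C1 where "C1 = 4 * (2 * A * k1 * P1 + B * k2 * P + 2 * A * k1 * P)"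
  define C2 where "C2 = P2 * (4 * h + 1 + 2 * m powr (- 1 / 2))"
  define C3 where "C3 = 4 * \<bar>d\<bar> / m\<^sup>2 * P"
  define C where "C = C1 + C2 + C3"
  have k: "k1 \<ge> 0" "k2 \<ge> 0" unfolding k1_def k2_def using h0 H(3) by auto
  have Cnn: "C1 \<ge> 0" "C2 \<ge> 0" "C3 \<ge> 0"
    unfolding C1_def C2_def C3_def using k A(1) B P(1) P1(1) P2(1) h0 H(3) by auto
  define L1 where "L1 \<tau> l x = 2 * (H *v x)$l * (1 / (q x + \<tau>\<^sup>2))" for \<tau> l x
  define L2 where "L2 \<tau> l n x = 2 * (H *v x)$l * (2 * (H *v x)$n * (- (1 / (q x + \<tau>\<^sup>2)\<^sup>2))) + 2 * H$l$n * (1 / (q x + \<tau>\<^sup>2))" for \<tau> l n x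
  have L: "hasC2 D (\<lambda>x. ln (x \<bullet> (H *v x) + \<tau>\<^sup>2) + c) (L1 \<tau>) (L2 \<tau>)" if "\<tau> > 0" for \<tau> c
  proof -
    have pos: "q x + \<tau>\<^sup>2 > 0" for x using q(2)[of x] that by (simp add: add_nonneg_pos)
    have "hasC2 D (\<lambda>x. (\<lambda>t. ln (t + \<tau>\<^sup>2) + c) (x \<bullet> (H *v x))) (\<lambda>l x. 2 * (H *v x)$l * (\<lambda>t. 1 / (t + \<tau>\<^sup>2)) (x \<bullet> (H *v x)))
       (\<lambda>l n x. 2 * (H *v x)$l * (2 * (H *v x)$n * (\<lambda>t. - (1 / (t + \<tau>\<^sup>2)\<^sup>2)) (x \<bullet> (H *v x))) + 2 * H$l$n * (\<lambda>t. 1 / (t + \<tau>\<^sup>2)) (x \<bullet> (H *v x)))"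
    proof (rule hasC2_chain[OF hasC2_quadratic_form[OF H(1)]])
      show "((\<lambda>t. ln (t + \<tau>\<^sup>2) + c) has_real_derivative 1 / (x \<bullet> (H *v x) + \<tau>\<^sup>2)) (at (x \<bullet> (H *v x)))" for x
        using pos[of x] by (auto intro!: derivative_eq_intros simp: q_def)
      show "((\<lambda>t. 1 / (t + \<tau>\<^sup>2)) has_real_derivative - (1 / (x \<bullet> (H *v x) + \<tau>\<^sup>2)\<^sup>2)) (at (x \<bullet> (H *v x)))" for x
        using pos[of x] by (auto intro!: derivative_eq_intros simp: q_def power2_eq_square)
      show "continuous_on ((\<lambda>x. x \<bullet> (H *v x)) ` D) (\<lambda>t. - (1 / (t + \<tau>\<^sup>2)\<^sup>2))"
        using less_imp_neq[OF pos, THEN not_sym] by (intro continuous_intros) (auto simp: q_def)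
    qed
    then show ?thesis by (simp add: L1_def[abs_def] L2_def[abs_def] q_def)
  qed
  \<comment> \<open>Since \<open>a\<close> at 0 times \<open>H\<close> is \<open>d\<close> times the
    identity, the trace part gives 4d/s and the gradient part -4dq/s^2. In dimension two these
    cancel up to 4d(s - q)/s^2, and s - q is \<open>\<tau>\<^sup>2\<close>.\<close>
  have frozen: "(\<Sum>i\<in>UNIV. \<Sum>j\<in>UNIV. a i j 0 * L2 \<tau> i j x) = 4 * d * \<tau>\<^sup>2 / (q x + \<tau>\<^sup>2)\<^sup>2" if "\<tau> > 0" for \<tau> x
  proof -
    define s where "s = q x + \<tau>\<^sup>2"
    have s: "s > 0" using q(2)[of x] that by (simp add: s_def add_nonneg_pos)
    have "(\<Sum>i\<in>UNIV. \<Sum>j\<in>UNIV. a i j 0 * H$i$j) = (\<Sum>i\<in>UNIV. \<Sum>j\<in>UNIV. a i j 0 * H$j$i)"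
      using H(1) by simp
    also have "\<dots> = 2 * d" by (simp add: H(2) dim)
    finally have t1: "(\<Sum>i\<in>UNIV. \<Sum>j\<in>UNIV. a i j 0 * H$i$j) = 2 * d" .
    have aH: "(\<Sum>j\<in>UNIV. a i j 0 * (H *v x)$j) = d * x$i" for i
    proof -
      have "(\<Sum>j\<in>UNIV. a i j 0 * (H *v x)$j) = (\<Sum>j\<in>UNIV. \<Sum>k\<in>UNIV. a i j 0 * H$j$k * x$k)"
        by (simp add: matrix_vector_mult_def sum_distrib_left mult.assoc)
      also have "\<dots> = (\<Sum>k\<in>UNIV. (\<Sum>j\<in>UNIV. a i j 0 * H$j$k) * x$k)"
        by (subst sum.swap) (simp add: sum_distrib_right)
      also have "\<dots> = (\<Sum>k\<in>UNIV. if i = k then d * x$k else 0)" by (intro sum.cong) (auto simp: H(2))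
      finally show ?thesis by simp
    qed
    have t2: "(\<Sum>i\<in>UNIV. \<Sum>j\<in>UNIV. a i j 0 * ((H *v x)$i * (H *v x)$j)) = d * q x"
    proof -
      have "(\<Sum>i\<in>UNIV. \<Sum>j\<in>UNIV. a i j 0 * ((H *v x)$i * (H *v x)$j)) = (\<Sum>i\<in>UNIV. (H *v x)$i * (\<Sum>j\<in>UNIV. a i j 0 * (H *v x)$j))"
        by (simp add: sum_distrib_left mult_ac)
      also have "\<dots> = d * q x" unfolding aH by (simp add: q_def inner_vec_def sum_distrib_left mult_ac)
      finally show ?thesis .
    qed
    have "(\<Sum>i\<in>UNIV. \<Sum>j\<in>UNIV. a i j 0 * L2 \<tau> i j x)
      = (\<Sum>i\<in>UNIV. \<Sum>j\<in>UNIV. (- (4 / s\<^sup>2)) * (a i j 0 * ((H *v x)$i * (H *v x)$j)) + (2 / s) * (a i j 0 * H$i$j))"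
      by (intro sum.cong refl) (simp add: L2_def s_def[symmetric] algebra_simps)
    also have "\<dots> = (- (4 / s\<^sup>2)) * (d * q x) + (2 / s) * (2 * d)"
      unfolding t1[symmetric] t2[symmetric] by (simp only: sum.distrib sum_distrib_left)
    also have "\<dots> = 4 * d * (s - q x) / s\<^sup>2" using s by (simp add: field_simps power2_eq_square)
    finally show ?thesis by (simp add: s_def)
  qed
  show ?thesis
  proof (intro exI[of _ C] conjI allI impI)
    show "C \<ge> 0" using Cnn by (simp add: C_def)
    fix \<tau> c :: real assume \<tau>: "0 < \<tau>" "\<tau> \<le> 1"
    show "\<exists>L1 L2. hasC2 D (\<lambda>x. ln (x \<bullet> (H *v x) + \<tau>\<^sup>2) + c) L1 L2 \<and>
      (\<forall>x\<in>K. x \<noteq> 0 \<longrightarrow> \<bar>ln (x \<bullet> (H *v x) + \<tau>\<^sup>2) * adj \<eta> \<eta>1 \<eta>2 x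
        + adj_comm (\<lambda>x. ln (x \<bullet> (H *v x) + \<tau>\<^sup>2) + c) L1 L2 \<eta> \<eta>1 x\<bar>
      \<le> C * (norm x powr (- 1) + (\<tau> / ((norm x)\<^sup>2 + \<tau>\<^sup>2))\<^sup>2))"
    proof (intro exI conjI ballI impI)
      show "hasC2 D (\<lambda>x. ln (x \<bullet> (H *v x) + \<tau>\<^sup>2) + c) (L1 \<tau>) (L2 \<tau>)" by (rule L[OF \<tau>(1)])
      fix x assume x: "x \<in> K" "x \<noteq> 0"
      define N where "N = norm x"
      define s where "s = q x + \<tau>\<^sup>2"
      define w where "w = (\<tau> / (N\<^sup>2 + \<tau>\<^sup>2))\<^sup>2"
      have N: "0 < N" "N \<le> 1" using x Kball(3) by (auto simp: N_def)
      have s1: "m * (N\<^sup>2 + \<tau>\<^sup>2) \<le> s" using s_low by (simp add: s_def N_def)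
      have mN: "m * N\<^sup>2 > 0" using H(3) N by simp
      have s2: "m * N\<^sup>2 \<le> s" using q(1)[of x] by (simp add: s_def N_def add_increasing2)
      have s0: "s > 0" using mN s2 by linarith
      have s3: "s \<le> 4 * h + 1"
      proof -
        have "4 * h * N\<^sup>2 \<le> 4 * h * 1" using N h0 by (intro mult_left_mono) (auto simp: power_le_one)
        moreover have "\<tau>\<^sup>2 \<le> 1" using \<tau> by (simp add: power_le_one)
        ultimately show ?thesis using q_up[of x] by (simp add: s_def N_def)
      qed
      have inv_s: "1 / s \<le> 1 / (m * N\<^sup>2)" using s2 mN by (intro divide_left_mono) auto
      have L1b: "\<bar>L1 \<tau> l x\<bar> \<le> k1 / N" for l
      proof -
        have "\<bar>L1 \<tau> l x\<bar> = 2 * \<bar>(H *v x)$l\<bar> * (1 / s)" using s0 by (simp add: L1_def s_def[symmetric] abs_mult)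
        also have "\<dots> \<le> 2 * (2 * h * N) * (1 / (m * N\<^sup>2))"
          using Hx[of x l] inv_s s0 h0 N by (intro mult_mono) (auto simp: N_def)
        also have "\<dots> = k1 / N" using N H(3) by (simp add: k1_def power2_eq_square)
        finally show ?thesis .
      qed
      have L2b: "\<bar>L2 \<tau> l n x\<bar> \<le> k2 / N\<^sup>2" for l n
      proof -
        have "\<bar>L2 \<tau> l n x\<bar> \<le> \<bar>2 * (H *v x)$l * (2 * (H *v x)$n * (- (1 / s\<^sup>2)))\<bar> + \<bar>2 * H$l$n * (1 / s)\<bar>"
          unfolding L2_def s_def[symmetric] by (rule abs_triangle_ineq)
        also have "\<dots> = 4 * \<bar>(H *v x)$l\<bar> * \<bar>(H *v x)$n\<bar> * (1 / s)\<^sup>2 + 2 * \<bar>H$l$n\<bar> * (1 / s)"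
          using s0 by (simp add: abs_mult power_divide)
        also have "\<dots> \<le> 4 * (2 * h * N) * (2 * h * N) * (1 / (m * N\<^sup>2))\<^sup>2 + 2 * h * (1 / (m * N\<^sup>2))"
          using Hx[of x l] Hx[of x n] hH[of l n] inv_s s0 h0 N
          by (intro add_mono mult_mono power_mono) (auto simp: N_def)
        also have "\<dots> = k2 / N\<^sup>2"
          using N H(3) by (simp add: k2_def power2_eq_square field_simps)
        finally show ?thesis .
      qed
      define rest where "rest i j = a i j x * (L1 \<tau> j x * \<eta>1 i x + L1 \<tau> i x * \<eta>1 j x) + (a i j x - a i j 0) * L2 \<tau> i j x * \<eta> x
        + (pd j (a i j) x * L1 \<tau> i x * \<eta> x + pd i (a i j) x * L1 \<tau> j x * \<eta> x)" for i j
      have comm: "adj_comm (\<lambda>x. ln (x \<bullet> (H *v x) + \<tau>\<^sup>2) + c) (L1 \<tau>) (L2 \<tau>) \<eta> \<eta>1 x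
        = 4 * d * \<tau>\<^sup>2 / s\<^sup>2 * \<eta> x + (\<Sum>i\<in>UNIV. \<Sum>j\<in>UNIV. rest i j)"
      proof -
        have "adj_comm (\<lambda>x. ln (x \<bullet> (H *v x) + \<tau>\<^sup>2) + c) (L1 \<tau>) (L2 \<tau>) \<eta> \<eta>1 x
          = (\<Sum>i\<in>UNIV. \<Sum>j\<in>UNIV. a i j 0 * L2 \<tau> i j x * \<eta> x + rest i j)"
          unfolding adj_comm_def rest_def by (intro sum.cong refl) (simp add: algebra_simps)
        also have "\<dots> = (\<Sum>i\<in>UNIV. \<Sum>j\<in>UNIV. a i j 0 * L2 \<tau> i j x) * \<eta> x + (\<Sum>i\<in>UNIV. \<Sum>j\<in>UNIV. rest i j)"
          by (simp only: sum.distrib sum_distrib_right)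
        finally show ?thesis unfolding frozen[OF \<tau>(1)] s_def .
      qed
      have restb: "\<bar>rest i j\<bar> \<le> (2 * A * k1 * P1 + B * k2 * P + 2 * A * k1 * P) * (1 / N)" for i j
      proof -
        have z: "\<bar>u * v * w\<bar> \<le> U * V * W" if "\<bar>u\<bar> \<le> U" "\<bar>v\<bar> \<le> V" "\<bar>w\<bar> \<le> W" for u v w U V W :: real
          unfolding abs_mult using that by (intro mult_mono) auto
        have "\<bar>a i j x * L1 \<tau> j x * \<eta>1 i x\<bar> \<le> A * (k1 / N) * P1" "\<bar>a i j x * L1 \<tau> i x * \<eta>1 j x\<bar> \<le> A * (k1 / N) * P1"
          by (rule z[OF A(2)[OF x(1)] L1b P1(2)[OF x(1), unfolded real_norm_def]])+
        moreover have "\<bar>(a i j x - a i j 0) * L2 \<tau> i j x * \<eta> x\<bar> \<le> B * N * (k2 / N\<^sup>2) * P"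
          using aB[OF x(1)] L2b P(2)[OF x(1)] by (intro z) (auto simp: N_def)
        moreover have "\<bar>pd j (a i j) x * L1 \<tau> i x * \<eta> x\<bar> \<le> A * (k1 / N) * P" "\<bar>pd i (a i j) x * L1 \<tau> j x * \<eta> x\<bar> \<le> A * (k1 / N) * P"
          by (rule z[OF A(3)[OF x(1)] L1b P(2)[OF x(1), unfolded real_norm_def]])+
        moreover have "rest i j = a i j x * L1 \<tau> j x * \<eta>1 i x + a i j x * L1 \<tau> i x * \<eta>1 j x + (a i j x - a i j 0) * L2 \<tau> i j x * \<eta> x
          + (pd j (a i j) x * L1 \<tau> i x * \<eta> x + pd i (a i j) x * L1 \<tau> j x * \<eta> x)" by (simp add: rest_def algebra_simps)
        ultimately have "\<bar>rest i j\<bar> \<le> A * (k1 / N) * P1 + A * (k1 / N) * P1 + B * N * (k2 / N\<^sup>2) * P + (A * (k1 / N) * P + A * (k1 / N) * P)"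
          by (simp only: norm_add_rule_thm[where 'a=real, unfolded real_norm_def])
        also have "\<dots> = (2 * A * k1 * P1 + B * k2 * P + 2 * A * k1 * P) * (1 / N)"
          using N by (simp add: power2_eq_square field_simps)
        finally show ?thesis .
      qed
      have restsum: "\<bar>\<Sum>i\<in>UNIV. \<Sum>j\<in>UNIV. rest i j\<bar> \<le> C1 * (1 / N)"
      proof -
        have "norm (\<Sum>i\<in>UNIV. \<Sum>j\<in>UNIV. rest i j) \<le> (\<Sum>i\<in>(UNIV::'n set). \<Sum>j\<in>(UNIV::'n set). (2 * A * k1 * P1 + B * k2 * P + 2 * A * k1 * P) * (1 / N))"
          using restb by (intro sum_norm_le) auto
        then show ?thesis by (simp add: C1_def dim algebra_simps)
      qed
      have main: "\<bar>4 * d * \<tau>\<^sup>2 / s\<^sup>2 * \<eta> x\<bar> \<le> C3 * w"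
      proof -
        have "(m * (N\<^sup>2 + \<tau>\<^sup>2))\<^sup>2 \<le> s\<^sup>2" using s1 H(3) by (intro power_mono) (auto simp: add_nonneg_nonneg)
        moreover have "0 < (m * (N\<^sup>2 + \<tau>\<^sup>2))\<^sup>2" using H(3) N by (intro zero_less_power mult_pos_pos) (auto simp: add_pos_nonneg)
        ultimately have "\<tau>\<^sup>2 / s\<^sup>2 \<le> \<tau>\<^sup>2 / (m * (N\<^sup>2 + \<tau>\<^sup>2))\<^sup>2"
          using s0 by (intro divide_left_mono mult_pos_pos) auto
        then have t: "\<tau>\<^sup>2 / s\<^sup>2 \<le> w / m\<^sup>2" by (simp add: w_def power_divide power_mult_distrib mult.commute)
        have "\<bar>4 * d * \<tau>\<^sup>2 / s\<^sup>2 * \<eta> x\<bar> = 4 * \<bar>d\<bar> * (\<tau>\<^sup>2 / s\<^sup>2) * \<bar>\<eta> x\<bar>" by (simp add: abs_mult)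
        also have "\<dots> \<le> 4 * \<bar>d\<bar> * (w / m\<^sup>2) * P"
          using t P(2)[OF x(1)] P(1) by (intro mult_mono) (auto simp: w_def)
        also have "\<dots> = C3 * w" by (simp add: C3_def)
        finally show ?thesis .
      qed
      have logb: "\<bar>ln s * adj \<eta> \<eta>1 \<eta>2 x\<bar> \<le> C2 * (1 / N)"
      proof -
        have "s powr (- 1 / 2) \<le> (m * N\<^sup>2) powr (- 1 / 2)" using s2 mN by (intro powr_mono2') auto
        also have "\<dots> = m powr (- 1 / 2) * (N\<^sup>2) powr (- 1 / 2)" using H(3) N by (simp add: powr_mult)
        also have "(N\<^sup>2) powr (- 1 / 2) = 1 / N"
        proof -
          have "(N\<^sup>2) powr (- 1 / 2) = 1 / ((N\<^sup>2) powr (1 / 2))"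
            using powr_minus_divide[of "N\<^sup>2" "1 / 2"] by simp
          also have "(N\<^sup>2) powr (1 / 2) = N" using N by (simp add: powr_half_sqrt)
          finally show ?thesis .
        qed
        finally have "s powr (- 1 / 2) \<le> m powr (- 1 / 2) * (1 / N)" .
        moreover have "s \<le> (4 * h + 1) * (1 / N)"
        proof -
          have "(4 * h + 1) * 1 \<le> (4 * h + 1) * (1 / N)" using N h0 by (intro mult_left_mono) auto
          then have "4 * h + 1 \<le> (4 * h + 1) * (1 / N)" by (simp only: mult_1_right)
          then show ?thesis by (rule order.trans[OF s3])
        qed
        ultimately have "\<bar>ln s\<bar> \<le> (4 * h + 1 + 2 * m powr (- 1 / 2)) * (1 / N)"
          using abs_ln_le_inverse[OF s0] by (simp add: distrib_right add_divide_distrib)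
        then have "\<bar>ln s\<bar> * \<bar>adj \<eta> \<eta>1 \<eta>2 x\<bar> \<le> ((4 * h + 1 + 2 * m powr (- 1 / 2)) * (1 / N)) * P2"
          using P2(2)[OF x(1)] by (intro mult_mono) auto
        then show ?thesis by (simp add: abs_mult C2_def mult_ac)
      qed
      have "\<bar>ln s * adj \<eta> \<eta>1 \<eta>2 x + (4 * d * \<tau>\<^sup>2 / s\<^sup>2 * \<eta> x + (\<Sum>i\<in>UNIV. \<Sum>j\<in>UNIV. rest i j))\<bar>
        \<le> C2 * (1 / N) + (C3 * w + C1 * (1 / N))"
        using logb main restsum by linarith
      also have "\<dots> \<le> C * (1 / N + w)"
      proof -
        have "0 \<le> C3 * (1 / N)" "0 \<le> (C1 + C2) * w" using Cnn N by (auto simp: w_def)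
        then show ?thesis by (simp add: C_def algebra_simps add_divide_distrib)
      qed
      also have "1 / N = norm x powr (- 1)" using N by (simp add: N_def powr_minus divide_inverse)
      finally show "\<bar>ln (x \<bullet> (H *v x) + \<tau>\<^sup>2) * adj \<eta> \<eta>1 \<eta>2 x
        + adj_comm (\<lambda>x. ln (x \<bullet> (H *v x) + \<tau>\<^sup>2) + c) (L1 \<tau>) (L2 \<tau>) \<eta> \<eta>1 x\<bar>
        \<le> C * (norm x powr (- 1) + (\<tau> / ((norm x)\<^sup>2 + \<tau>\<^sup>2))\<^sup>2)"
        unfolding comm by (simp only: s_def q_def w_def N_def)
    qed
  qed
qed

text \<open>The test function is \<eta> times ln(q + \<tau>^2) - ln(\<tau>^2), whose subtracted
  constant makes it vanish at 0, so \<open>vanish\<close> applies and yields ln(\<tau>^2) I as the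
  integral of \<open>V * G\<close> over \<open>D\<close>, with \<open>I\<close> the integral in
  question. By the commutator bound and the growth of \<open>V\<close> the right side is at most a
  constant plus \<open>C * \<delta> * c0\<close> times \<bar>ln \<tau>\<bar>. Dividing by \<bar>ln
  \<tau>\<bar>, with \<tau> tending to 0 and \<delta> arbitrary, forces
  \<open>I = 0\<close>.\<close>

lemma weak_solution_log:
  fixes H :: "real^'n^'n" and \<eta> :: "real^'n \<Rightarrow> real"
  assumes dim: "CARD('n) = 2" and zero: "0 \<in> D" and Kball: "convex K" "0 \<in> K" "K \<subseteq> cball 0 1"
    and H: "\<And>i j. H$i$j = H$j$i" "\<And>i k. (\<Sum>j\<in>UNIV. a i j 0 * H$j$k) = (if i = k then d else 0)"
      "0 < m" "m \<le> 1" "\<And>x. m * (norm x)\<^sup>2 \<le> x \<bullet> (H *v x)"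
    and \<eta>: "hasC2 D \<eta> \<eta>1 \<eta>2" "\<And>x. x \<notin> K \<Longrightarrow> \<eta> x = 0" "\<eta> 0 = 1"
    and V: "integrable lborel V" "V 0 = 0" "\<And>x. x \<notin> K \<Longrightarrow> V x = 0"
    and Vb: "\<And>x. x \<in> K \<Longrightarrow> \<bar>V x\<bar> \<le> M * norm x powr (- 1 / 2)"
    and growth: "\<And>\<delta>. \<delta> > 0 \<Longrightarrow> \<exists>r>0. \<forall>x\<in>K. 0 < norm x \<longrightarrow> norm x < r \<longrightarrow> \<bar>V x\<bar> \<le> \<delta> * \<bar>ln (norm x)\<bar>"
    and vanish: "\<And>(\<psi>::real^'n \<Rightarrow> real) \<psi>1 \<psi>2. hasC2 D \<psi> \<psi>1 \<psi>2 \<Longrightarrow> (\<And>x. x \<notin> K \<Longrightarrow> \<psi> x = 0) \<Longrightarrow> \<psi> 0 = 0 \<Longrightarrow>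
      (LINT x|lborel. V x *\<^sub>R (if x \<in> D then adj \<psi> \<psi>1 \<psi>2 x else 0)) = 0"
  shows "(LINT x|lborel. V x *\<^sub>R (if x \<in> D then adj \<eta> \<eta>1 \<eta>2 x else 0)) = 0"
proof -
  obtain C where C: "C \<ge> 0" and Cb: "\<And>\<tau> c. 0 < \<tau> \<Longrightarrow> \<tau> \<le> 1 \<Longrightarrow> \<exists>L1 L2. hasC2 D (\<lambda>x. ln (x \<bullet> (H *v x) + \<tau>\<^sup>2) + c) L1 L2 \<and>
    (\<forall>x\<in>K. x \<noteq> 0 \<longrightarrow> \<bar>ln (x \<bullet> (H *v x) + \<tau>\<^sup>2) * adj \<eta> \<eta>1 \<eta>2 x
        + adj_comm (\<lambda>x. ln (x \<bullet> (H *v x) + \<tau>\<^sup>2) + c) L1 L2 \<eta> \<eta>1 x\<bar>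
      \<le> C * (norm x powr (- 1) + (\<tau> / ((norm x)\<^sup>2 + \<tau>\<^sup>2))\<^sup>2))"
    using log_commutator_bound[OF dim zero Kball H \<eta>(1)] by blast
  have [measurable]: "V \<in> borel_measurable borel" using borel_measurable_integrable[OF V(1)] by simp
  define I where "I = (LINT x|lborel. V x * (if x \<in> D then adj \<eta> \<eta>1 \<eta>2 x else 0))"
  have adjK: "adj \<eta> \<eta>1 \<eta>2 x = 0" if "x \<in> D" "x \<notin> K" for x
    by (rule adj_zero_outside[OF \<eta>(1,2) compact_imp_closed[OF K(1)] that])
  \<comment> \<open>The part of \<open>G\<close> of size 1/\<bar>x\<bar> costs a bounded amount:
    \<bar>V\<bar>/\<bar>x\<bar> is at most a multiple of \<bar>x\<bar>^(-3/2), integrable on the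
    unit ball of the plane.\<close>
  define J where "J x = \<bar>V x\<bar> * norm x powr (- 1)" for x
  define M' where "M' = \<bar>M\<bar>"
  have M': "M' \<ge> 0" "\<And>x. x \<in> K \<Longrightarrow> \<bar>V x\<bar> \<le> M' * norm x powr (- 1 / 2)"
  proof -
    show "\<bar>V x\<bar> \<le> M' * norm x powr (- 1 / 2)" if "x \<in> K" for x
      by (rule order.trans[OF Vb[OF that]]) (auto simp: M'_def intro!: mult_right_mono)
  qed (simp add: M'_def)
  have J: "integrable lborel J"
  proof (rule Bochner_Integration.integrable_bound)
    show "integrable lborel (\<lambda>x::real^'n. M' * (indicator (cball 0 1) x * norm x powr (- (3 / 2))))"
      by (intro integrable_mult_right integrable_norm_powr_ball) (simp_all add: dim)
    show "J \<in> borel_measurable lborel" unfolding J_def[abs_def] by measurable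
    have "J x \<le> M' * (indicator (cball 0 1) x * norm x powr (- (3 / 2)))" for x
    proof (cases "x \<in> K")
      case True
      have 1: "J x \<le> M' * norm x powr (- 1 / 2) * norm x powr (- 1)"
        unfolding J_def using M'(2)[OF True] by (intro mult_right_mono) auto
      have "norm x powr (- 1 / 2) * norm x powr (- 1) = norm x powr (- (3 / 2))"
        unfolding powr_add[symmetric] by simp
      then have "M' * norm x powr (- 1 / 2) * norm x powr (- 1) = M' * norm x powr (- (3 / 2))"
        by (simp only: mult.assoc)
      with 1 have "J x \<le> M' * norm x powr (- (3 / 2))" by (simp only:)
      then show ?thesis using True Kball(3) by (simp add: subset_iff)
    next
      case False
      then show ?thesis using M'(1) by (simp add: J_def V(3))
    qed
    moreover have "0 \<le> J x" for x by (simp add: J_def)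
    ultimately show "AE x in lborel. norm (J x) \<le> norm (M' * (indicator (cball 0 1) x * norm x powr (- (3 / 2))))"
      by (intro AE_I2) (simp only: real_norm_def, rule order.trans[OF _ abs_ge_self], simp)
  qed
  define c0 where "c0 = (LINT t|lborel. kern 0 t) ^ CARD('n)"
  define c1 where "c1 = (LINT t|lborel. kern (1/2) t) ^ CARD('n)"
  have cnn: "c0 \<ge> 0" "c1 \<ge> 0" unfolding c0_def c1_def by (auto intro!: zero_le_power integral_nonneg_AE simp: kern_nonneg)
  have kp_nonneg: "0 \<le> kernel_product s \<tau> x" if "\<tau> > 0" for s \<tau> and x :: "real^'n"
    unfolding kernel_product_def using that by (intro prod_nonneg) (auto simp: kern_nonneg)
  have main: "\<exists>T. \<forall>\<tau>. 0 < \<tau> \<longrightarrow> \<tau> \<le> 1 \<longrightarrow> 2 * \<bar>ln \<tau>\<bar> * \<bar>I\<bar> \<le> T + C * \<delta> * c0 * \<bar>ln \<tau>\<bar>" if \<delta>: "\<delta> > 0" for \<delta>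
  proof -
    obtain r where r: "r > 0" "\<And>x. x \<in> K \<Longrightarrow> 0 < norm x \<Longrightarrow> norm x < r \<Longrightarrow> \<bar>V x\<bar> \<le> \<delta> * \<bar>ln (norm x)\<bar>"
      using growth[OF \<delta>] by blast
    define A where "A = M' * r powr (- 1 / 2)"
    have A0: "A \<ge> 0" using M'(1) by (simp add: A_def)
    have "2 * \<bar>ln \<tau>\<bar> * \<bar>I\<bar> \<le> C * ((LINT x|lborel. J x) + A * c0 + \<delta> * c1) + C * \<delta> * c0 * \<bar>ln \<tau>\<bar>"
      if \<tau>: "0 < \<tau>" "\<tau> \<le> 1" for \<tau>
    proof -
      obtain L1 L2 where L: "hasC2 D (\<lambda>x. ln (x \<bullet> (H *v x) + \<tau>\<^sup>2) + (- ln (\<tau>\<^sup>2))) L1 L2"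
        "\<And>x. x \<in> K \<Longrightarrow> x \<noteq> 0 \<Longrightarrow> \<bar>ln (x \<bullet> (H *v x) + \<tau>\<^sup>2) * adj \<eta> \<eta>1 \<eta>2 x
          + adj_comm (\<lambda>x. ln (x \<bullet> (H *v x) + \<tau>\<^sup>2) + (- ln (\<tau>\<^sup>2))) L1 L2 \<eta> \<eta>1 x\<bar>
        \<le> C * (norm x powr (- 1) + (\<tau> / ((norm x)\<^sup>2 + \<tau>\<^sup>2))\<^sup>2)"
        using Cb[OF \<tau>, of "- ln (\<tau>\<^sup>2)"] by blast
      define e where "e x = ln (x \<bullet> (H *v x) + \<tau>\<^sup>2) + (- ln (\<tau>\<^sup>2))" for x
      define G where "G x = ln (x \<bullet> (H *v x) + \<tau>\<^sup>2) * adj \<eta> \<eta>1 \<eta>2 x + adj_comm e L1 L2 \<eta> \<eta>1 x" for x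
      have e: "hasC2 D e L1 L2" using L(1) by (simp add: e_def[abs_def])
      note e\<eta> = hasC2_scaleR[OF e \<eta>(1)]
      have e0: "e 0 = 0" by (simp add: e_def)
      have P: "adj (\<lambda>x. e x *\<^sub>R \<eta> x) (\<lambda>l x. e x *\<^sub>R \<eta>1 l x + L1 l x *\<^sub>R \<eta> x)
          (\<lambda>l m x. e x *\<^sub>R \<eta>2 l m x + L1 m x *\<^sub>R \<eta>1 l x + (L1 l x *\<^sub>R \<eta>1 m x + L2 l m x *\<^sub>R \<eta> x)) x
        = G x - ln (\<tau>\<^sup>2) * adj \<eta> \<eta>1 \<eta>2 x" for x
      proof -
        have l: "ln (x \<bullet> (H *v x) + \<tau>\<^sup>2) = e x + ln (\<tau>\<^sup>2)" by (simp add: e_def)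
        show ?thesis unfolding adj_product G_def l by (simp add: algebra_simps)
      qed
      have zz: "(LINT x|lborel. V x *\<^sub>R (if x \<in> D then G x - ln (\<tau>\<^sup>2) * adj \<eta> \<eta>1 \<eta>2 x else 0)) = 0"
        unfolding P[symmetric] by (rule vanish[OF e\<eta>]) (simp_all add: \<eta>(2) e0)
      have i1: "integrable lborel (\<lambda>x. if x \<in> D then V x *\<^sub>R (G x - ln (\<tau>\<^sup>2) * adj \<eta> \<eta>1 \<eta>2 x) else 0)"
        unfolding P[symmetric]
        by (rule integrable_mult_compact_support[OF V(1) adj_continuous[OF e\<eta>]])
          (rule adj_zero_outside[OF e\<eta> _ compact_imp_closed[OF K(1)]]; simp add: \<eta>(2))
      have i2: "integrable lborel (\<lambda>x. if x \<in> D then V x *\<^sub>R adj \<eta> \<eta>1 \<eta>2 x else 0)"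
        by (rule integrable_mult_compact_support[OF V(1) adj_continuous[OF \<eta>(1)] adjK])
      have VG: "(if x \<in> D then V x * G x else 0) = (if x \<in> D then V x *\<^sub>R (G x - ln (\<tau>\<^sup>2) * adj \<eta> \<eta>1 \<eta>2 x) else 0)
          + ln (\<tau>\<^sup>2) * (if x \<in> D then V x *\<^sub>R adj \<eta> \<eta>1 \<eta>2 x else 0)" for x
        by (simp add: algebra_simps)
      have i3: "integrable lborel (\<lambda>x. if x \<in> D then V x * G x else 0)"
        unfolding VG by (intro Bochner_Integration.integrable_add integrable_mult_right i1 i2)
      have "(LINT x|lborel. (if x \<in> D then V x * G x else 0)) = ln (\<tau>\<^sup>2) * I"
      proof -
        have "(LINT x|lborel. (if x \<in> D then V x * G x else 0))
          = (LINT x|lborel. (if x \<in> D then V x *\<^sub>R (G x - ln (\<tau>\<^sup>2) * adj \<eta> \<eta>1 \<eta>2 x) else 0))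
          + ln (\<tau>\<^sup>2) * (LINT x|lborel. (if x \<in> D then V x *\<^sub>R adj \<eta> \<eta>1 \<eta>2 x else 0))"
          unfolding VG by (subst Bochner_Integration.integral_add[OF i1 integrable_mult_right[OF i2]]) simp
        moreover have "(LINT x|lborel. (if x \<in> D then V x *\<^sub>R (G x - ln (\<tau>\<^sup>2) * adj \<eta> \<eta>1 \<eta>2 x) else 0)) = 0"
          by (rule trans[OF _ zz]) (intro Bochner_Integration.integral_cong; simp)
        moreover have "(LINT x|lborel. (if x \<in> D then V x *\<^sub>R adj \<eta> \<eta>1 \<eta>2 x else 0)) = I"
          unfolding I_def by (intro Bochner_Integration.integral_cong) auto
        ultimately show ?thesis by simp
      qed
      moreover have "\<bar>ln (\<tau>\<^sup>2)\<bar> = 2 * \<bar>ln \<tau>\<bar>" using \<tau> by (simp add: ln_realpow abs_mult)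
      ultimately have "2 * \<bar>ln \<tau>\<bar> * \<bar>I\<bar> = \<bar>LINT x|lborel. (if x \<in> D then V x * G x else 0)\<bar>" by (simp add: abs_mult)
      also have "\<dots> \<le> (LINT x|lborel. \<bar>(if x \<in> D then V x * G x else 0)\<bar>)"
        using integral_norm_bound[of lborel "\<lambda>x. if x \<in> D then V x * G x else 0"] by simp
      also have "\<dots> \<le> (LINT x|lborel. C * (J x + (\<delta> * \<bar>ln \<tau>\<bar> + A) * kernel_product 0 \<tau> x + \<delta> * kernel_product (1/2) \<tau> x))"
      proof (rule integral_mono_AE)
        show "integrable lborel (\<lambda>x. \<bar>if x \<in> D then V x * G x else 0\<bar>)" using i3 by (rule integrable_abs)
        show "integrable lborel (\<lambda>x. C * (J x + (\<delta> * \<bar>ln \<tau>\<bar> + A) * kernel_product 0 \<tau> x + \<delta> * kernel_product (1/2) \<tau> x))"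
          by (intro integrable_mult_right Bochner_Integration.integrable_add J kernel_product_integral(1)) (use \<tau> in auto)
        show "AE x in lborel. \<bar>if x \<in> D then V x * G x else 0\<bar>
          \<le> C * (J x + (\<delta> * \<bar>ln \<tau>\<bar> + A) * kernel_product 0 \<tau> x + \<delta> * kernel_product (1/2) \<tau> x)"
          using AE_components_nonzero
        proof eventually_elim
          fix x :: "real^'n" assume x: "\<forall>i. x$i \<noteq> 0"
          then have x0: "x \<noteq> 0" by auto
          define w where "w = (\<tau> / ((norm x)\<^sup>2 + \<tau>\<^sup>2))\<^sup>2"
          have rhs0: "0 \<le> C * (J x + (\<delta> * \<bar>ln \<tau>\<bar> + A) * kernel_product 0 \<tau> x + \<delta> * kernel_product (1/2) \<tau> x)"
            using C \<delta> A0 kp_nonneg[OF \<tau>(1)] by (auto intro!: mult_nonneg_nonneg add_nonneg_nonneg simp: J_def)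
          show "\<bar>if x \<in> D then V x * G x else 0\<bar>
            \<le> C * (J x + (\<delta> * \<bar>ln \<tau>\<bar> + A) * kernel_product 0 \<tau> x + \<delta> * kernel_product (1/2) \<tau> x)"
          proof (cases "x \<in> K")
            case True
            then have N: "0 < norm x" "norm x \<le> 1" and xD: "x \<in> D" using x0 Kball(3) K(2) by auto
            have w0: "w \<le> kernel_product 0 \<tau> x"
              using radial_le_kernel_product[of \<tau> 0 x] \<tau> x N by (simp add: dim w_def)
            \<comment> \<open>In dimension two the exponent 1/2 in each coordinate adds up to the
              single power of \<open>\<tau> / norm x\<close>.\<close>
            have w1: "\<tau> / norm x * w \<le> kernel_product (1/2) \<tau> x"
              using radial_le_kernel_product[of \<tau> "1/2" x] \<tau> x N by (simp add: dim w_def powr_minus)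
            have "\<bar>V x\<bar> \<le> \<delta> * (\<bar>ln \<tau>\<bar> + \<tau> / norm x) + A"
            proof (cases "norm x < r")
              case lt: True
              have "\<bar>V x\<bar> \<le> \<delta> * \<bar>ln (norm x)\<bar>" by (rule r(2)[OF True N(1) lt])
              also have "\<dots> \<le> \<delta> * (\<bar>ln \<tau>\<bar> + \<tau> / norm x)"
                using \<delta> abs_ln_le_scaled[OF N \<tau>] by (intro mult_left_mono) auto
              finally show ?thesis using A0 by linarith
            next
              case ge: False
              have "norm x powr (- 1 / 2) \<le> r powr (- 1 / 2)" using ge r(1) by (intro powr_mono2') auto
              then have "M' * norm x powr (- 1 / 2) \<le> A" unfolding A_def using M'(1) by (intro mult_left_mono)
              moreover have "0 \<le> \<delta> * (\<bar>ln \<tau>\<bar> + \<tau> / norm x)"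
                by (intro mult_nonneg_nonneg add_nonneg_nonneg) (use \<delta> \<tau> in auto)
              ultimately show ?thesis using M'(2)[OF True] by linarith
            qed
            then have "\<bar>V x\<bar> * w \<le> (\<delta> * (\<bar>ln \<tau>\<bar> + \<tau> / norm x) + A) * w" by (intro mult_right_mono) (auto simp: w_def)
            also have "\<dots> = (\<delta> * \<bar>ln \<tau>\<bar> + A) * w + \<delta> * (\<tau> / norm x * w)" by (simp add: algebra_simps)
            also have "\<dots> \<le> (\<delta> * \<bar>ln \<tau>\<bar> + A) * kernel_product 0 \<tau> x + \<delta> * kernel_product (1/2) \<tau> x"
              using w0 w1 \<delta> A0 by (intro add_mono mult_left_mono) auto
            finally have vw: "\<bar>V x\<bar> * w \<le> (\<delta> * \<bar>ln \<tau>\<bar> + A) * kernel_product 0 \<tau> x + \<delta> * kernel_product (1/2) \<tau> x" .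
            have "\<bar>G x\<bar> \<le> C * (norm x powr (- 1) + w)"
              using L(2)[OF True x0] by (simp add: G_def w_def e_def[abs_def])
            then have "\<bar>V x\<bar> * \<bar>G x\<bar> \<le> \<bar>V x\<bar> * (C * (norm x powr (- 1) + w))" by (intro mult_left_mono) auto
            also have "\<dots> = C * (J x + \<bar>V x\<bar> * w)" by (simp add: J_def algebra_simps)
            also have "\<dots> \<le> C * (J x + ((\<delta> * \<bar>ln \<tau>\<bar> + A) * kernel_product 0 \<tau> x + \<delta> * kernel_product (1/2) \<tau> x))"
              using C vw by (intro mult_left_mono add_left_mono) auto
            finally show ?thesis using xD by (simp add: abs_mult add.assoc)
          next
            case False
            then show ?thesis using rhs0 by (simp add: V(3))
          qed
        qed
      qed
      also have "\<dots> = C * ((LINT x|lborel. J x) + (\<delta> * \<bar>ln \<tau>\<bar> + A) * c0 + \<delta> * c1)"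
      proof -
        note k0 = kernel_product_integral[of 0 \<tau>, where 'n='n, OF order.refl zero_less_one \<tau>(1)]
        have k1: "integrable lborel (kernel_product (1/2) \<tau> :: real^'n \<Rightarrow> real)"
          "(LINT x|lborel. kernel_product (1/2) \<tau> (x::real^'n)) = c1"
          using kernel_product_integral[of "1/2" \<tau>, where 'n='n] \<tau>(1) by (simp_all add: c1_def)
        have a: "integrable lborel (\<lambda>x::real^'n. (\<delta> * \<bar>ln \<tau>\<bar> + A) * kernel_product 0 \<tau> x)"
          "integrable lborel (\<lambda>x::real^'n. \<delta> * kernel_product (1/2) \<tau> x)"
          by (rule integrable_mult_right[OF k0(1)], rule integrable_mult_right[OF k1(1)])
        show ?thesis
          by (simp only: integral_mult_right_zero Bochner_Integration.integral_add[OF Bochner_Integration.integrable_add[OF J a(1)] a(2)]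
              Bochner_Integration.integral_add[OF J a(1)] k0(2) k1(2) c0_def)
      qed
      also have "\<dots> = C * ((LINT x|lborel. J x) + A * c0 + \<delta> * c1) + C * \<delta> * c0 * \<bar>ln \<tau>\<bar>"
        by (simp add: algebra_simps)
      finally show ?thesis .
    qed
    then show ?thesis by blast
  qed
  have "\<bar>I\<bar> \<le> 0"
  proof (rule field_le_epsilon)
    fix \<epsilon> :: real assume \<epsilon>: "\<epsilon> > 0"
    define \<delta> where "\<delta> = \<epsilon> / (C * c0 + 1)"
    have Cc: "0 \<le> C * c0" using C cnn by simp
    have \<delta>: "\<delta> > 0" using \<epsilon> Cc by (simp add: \<delta>_def)
    obtain T where T: "\<And>\<tau>. 0 < \<tau> \<Longrightarrow> \<tau> \<le> 1 \<Longrightarrow> 2 * \<bar>ln \<tau>\<bar> * \<bar>I\<bar> \<le> T + C * \<delta> * c0 * \<bar>ln \<tau>\<bar>"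
      using main[OF \<delta>] by blast
    \<comment> \<open>\<open>y\<close> plays the role of \<bar>ln \<tau>\<bar> for
      \<open>\<tau> = exp (- y)\<close>, and is large enough for
      \<open>T \<le> \<epsilon> * y\<close>.\<close>
    define y where "y = \<bar>T\<bar> / \<epsilon> + 1"
    have y: "y > 0" using \<epsilon> by (simp add: y_def add_nonneg_pos)
    have "2 * y * \<bar>I\<bar> \<le> T + C * \<delta> * c0 * y"
      using T[of "exp (- y)"] y by simp
    moreover have "C * \<delta> * c0 \<le> \<epsilon>"
    proof -
      have "C * c0 * \<epsilon> \<le> (C * c0 + 1) * \<epsilon>" using \<epsilon> by (intro mult_right_mono) auto
      then show ?thesis using Cc by (simp add: \<delta>_def divide_le_eq mult_ac add_nonneg_pos)
    qed
    then have "C * \<delta> * c0 * y \<le> \<epsilon> * y" using y by (intro mult_right_mono) auto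
    moreover have "T \<le> \<epsilon> * y"
    proof -
      have "T \<le> \<bar>T\<bar> + \<epsilon>" using \<epsilon> by linarith
      also have "\<dots> = \<epsilon> * y" using \<epsilon> by (simp add: y_def field_simps)
      finally show ?thesis .
    qed
    ultimately have "2 * y * \<bar>I\<bar> \<le> \<epsilon> * y + \<epsilon> * y" by linarith
    also have "\<dots> = 2 * y * \<epsilon>" by simp
    finally have "2 * y * \<bar>I\<bar> \<le> 2 * y * \<epsilon>" .
    then show "\<bar>I\<bar> \<le> 0 + \<epsilon>" using y by simp
  qed
  then show ?thesis by (simp add: I_def)
qed

end

section \<open>Removable singularities of elliptic equations\<close>

context elliptic_operator
begin

text \<open>Used with \<open>z\<close> equal to minus the value of \<psi> at 0, which reduces a
  complex test function to one vanishing at the puncture.\<close>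

lemma adj_diff_scaleR:
  fixes \<eta> :: "real^'n \<Rightarrow> real"
  shows "adj (\<lambda>x. \<psi> x + \<eta> x *\<^sub>R z) (\<lambda>l x. \<psi>1 l x + \<eta>1 l x *\<^sub>R z) (\<lambda>l m x. \<psi>2 l m x + \<eta>2 l m x *\<^sub>R z) x
    = adj \<psi> \<psi>1 \<psi>2 x + adj \<eta> \<eta>1 \<eta>2 x *\<^sub>R z"
proof -
  have "adj (\<lambda>x. \<psi> x + \<eta> x *\<^sub>R z) (\<lambda>l x. \<psi>1 l x + \<eta>1 l x *\<^sub>R z) (\<lambda>l m x. \<psi>2 l m x + \<eta>2 l m x *\<^sub>R z) x
    = (\<Sum>i\<in>UNIV. \<Sum>j\<in>UNIV. (a i j x *\<^sub>R \<psi>2 i j x + pd j (a i j) x *\<^sub>R \<psi>1 i x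
     + (pd i (a i j) x *\<^sub>R \<psi>1 j x + pd j (pd i (a i j)) x *\<^sub>R \<psi> x))
     + (a i j x *\<^sub>R \<eta>2 i j x + pd j (a i j) x *\<^sub>R \<eta>1 i x
     + (pd i (a i j) x *\<^sub>R \<eta>1 j x + pd j (pd i (a i j)) x *\<^sub>R \<eta> x)) *\<^sub>R z)"
    unfolding adj_def by (intro sum.cong refl) (simp add: algebra_simps)
  also have "\<dots> = adj \<psi> \<psi>1 \<psi>2 x + adj \<eta> \<eta>1 \<eta>2 x *\<^sub>R z"
    unfolding adj_def by (simp only: sum.distrib scaleR_sum_left scaleR_add_left)
  finally show ?thesis .
qed

end

text \<open>\<open>H\<close> is the matrix of the quadratic form adapted to the operator frozen at
  0, as the relation with \<open>d\<close> expresses. The conclusion gives a C^2 extension on the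
  half ball only, where the cutoff is positive; the equation at 0 follows later from
  continuity.\<close>

theorem (in elliptic_operator) removable_singularity:
  assumes D_ball: "D = ball 0 \<rho>" "K = cball 0 (\<rho> / 2)" "0 < \<rho>" "\<rho> \<le> 1"
    and dim: "CARD('n) \<ge> 2"
    and v: "hasC2 (D - {0}) v v1 v2"
      "\<And>x. x \<in> D - {0} \<Longrightarrow> (\<Sum>i\<in>UNIV. \<Sum>j\<in>UNIV. a i j x * v2 j i x) = 0"
    and growth3: "\<And>c. CARD('n) \<ge> 3 \<Longrightarrow> c > 0 \<Longrightarrow>
      \<exists>r>0. \<forall>x. 0 < norm x \<longrightarrow> norm x < r \<longrightarrow> \<bar>v x\<bar> \<le> c * norm x powr (2 - real CARD('n))"
    and growth2: "\<And>c. CARD('n) = 2 \<Longrightarrow> c > 0 \<Longrightarrow>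
      \<exists>r>0. \<forall>x. 0 < norm x \<longrightarrow> norm x < r \<longrightarrow> \<bar>v x\<bar> \<le> c * \<bar>ln (norm x)\<bar>"
    and H: "\<And>i j. H$i$j = H$j$i" "\<And>i k. (\<Sum>j\<in>UNIV. a i j 0 * H$j$k) = (if i = k then d else 0)"
      "0 < m" "m \<le> 1" "\<And>x. m * (norm x)\<^sup>2 \<le> x \<bullet> (H *v x)"
  shows "\<exists>w w1 w2. hasC2 (ball 0 (\<rho> / 2)) w w1 w2 \<and> (\<forall>x\<in>ball 0 (\<rho> / 2) - {0}. v x = w x)"
proof -
  have zero: "0 \<in> D" "0 \<in> K" "convex K" "K \<subseteq> cball 0 1" using D_ball by auto
  \<comment> \<open>Truncation to \<open>K\<close> makes \<open>V\<close> integrable on the whole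
    space and changes no pairing, since the test functions are supported in \<open>K\<close>. The
    value at 0 is set to 0.\<close>
  define V where "V x = (if x \<in> K - {0} then v x else 0)" for x
  have V: "V 0 = 0" "\<And>x. x \<in> K \<Longrightarrow> x \<noteq> 0 \<Longrightarrow> V x = v x" "\<And>x. x \<notin> K \<Longrightarrow> V x = 0"
    by (auto simp: V_def)
  have cont_v: "continuous_on (D - {0}) v" by (rule hasC2D[OF v(1)])
  \<comment> \<open>The exponent of an integrable majorant, below the dimension in both cases. For
    \<open>CARD('n) = 2\<close> any small positive power beats the logarithm; 1/2 is the one that
    \<open>weak_solution_log\<close> expects.\<close>
  define s where "s = (if CARD('n) = 2 then 1 / 2 else real CARD('n) - 2)"
  have s: "0 \<le> s" "s < real CARD('n)" using dim by (auto simp: s_def)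
  obtain M where M: "M \<ge> 0" "\<And>x. x \<in> K \<Longrightarrow> \<bar>V x\<bar> \<le> M * norm x powr (- s)"
  proof -
    obtain r where r: "r > 0" "\<And>x. x \<in> K \<Longrightarrow> 0 < norm x \<Longrightarrow> norm x < r \<Longrightarrow> \<bar>v x\<bar> \<le> 2 * norm x powr (- s)"
    proof (cases "CARD('n) = 2")
      case True
      obtain r where r: "r > 0" "\<And>x. 0 < norm x \<Longrightarrow> norm x < r \<Longrightarrow> \<bar>v x\<bar> \<le> 1 * \<bar>ln (norm x)\<bar>"
        using growth2[OF True, of 1] by auto
      have "\<bar>v x\<bar> \<le> 2 * norm x powr (- s)" if "x \<in> K" "0 < norm x" "norm x < r" for x
      proof -
        have n1: "norm x \<le> 1" using that(1) zero(4) by auto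
        have "ln (norm x powr (- 1 / 2)) \<le> norm x powr (- 1 / 2)"
          using ln_le_minus_one[of "norm x powr (- 1 / 2)"] that(2) by simp
        then have "- ln (norm x) \<le> 2 * norm x powr (- 1 / 2)" using that(2) by (simp add: ln_powr)
        moreover have "\<bar>ln (norm x)\<bar> = - ln (norm x)" using n1 that(2) by (simp add: abs_of_nonpos)
        ultimately show ?thesis using r(2)[OF that(2,3)] True by (simp add: s_def)
      qed
      then show ?thesis using r(1) that by blast
    next
      case False
      then have "CARD('n) \<ge> 3" using dim by simp
      from growth3[OF this, of 2] obtain r where r: "r > 0" "\<And>x. 0 < norm x \<Longrightarrow> norm x < r \<Longrightarrow> \<bar>v x\<bar> \<le> 2 * norm x powr (2 - real CARD('n))"
        by auto
      moreover have "- s = 2 - real CARD('n)" using False by (simp add: s_def)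
      ultimately show ?thesis using that[of r] by simp
    qed
    have "compact (K - ball 0 r)" using K(1) by (simp add: compact_diff)
    moreover have "continuous_on (K - ball 0 r) v" using r(1) K(2) by (intro continuous_on_subset[OF cont_v]) auto
    ultimately obtain B where B: "B \<ge> 0" "\<And>x. x \<in> K - ball 0 r \<Longrightarrow> norm (v x) \<le> B"
      using compact_norm_bound by blast
    \<comment> \<open>The 2 covers radii below \<open>r\<close>. At larger radii \<open>v\<close> is
      bounded by \<open>B\<close>, which the negative power of \<open>norm x \<le> 1\<close> can
      only increase.\<close>
    show ?thesis
    proof (rule that[of "2 + B"])
      fix x assume x: "x \<in> K"
      show "\<bar>V x\<bar> \<le> (2 + B) * norm x powr (- s)"
      proof (cases "x = 0")
        case True
        then show ?thesis by (simp add: V(1))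
      next
        case x0: False
        have n1: "0 < norm x" "norm x \<le> 1" using x zero(4) x0 by auto
        have p1: "1 \<le> norm x powr (- s)" using powr_mono'[of "- s" 0 "norm x"] n1 s by simp
        show ?thesis
        proof (cases "norm x < r")
          case True
          have "0 \<le> B * norm x powr (- s)" using B(1) by simp
          then show ?thesis using r(2)[OF x n1(1) True] V(2)[OF x x0] by (simp add: distrib_right)
        next
          case False
          then have "\<bar>v x\<bar> \<le> B" using B(2)[of x] x by auto
          also have "B * 1 \<le> B * norm x powr (- s)" using p1 B(1) by (intro mult_left_mono)
          then have "B \<le> (2 + B) * norm x powr (- s)" by (simp add: distrib_right add_increasing)
          finally show ?thesis using V(2)[OF x x0] by simp
        qed
      qed
    qed (use B in simp)
  qed
  have Vint: "integrable lborel V"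
  proof (rule Bochner_Integration.integrable_bound)
    show "integrable lborel (\<lambda>x::real^'n. M * (indicator (cball 0 1) x * norm x powr (- s)))"
      by (intro integrable_mult_right integrable_norm_powr_ball s)
    have "(\<lambda>x. indicator (K - {0}) x *\<^sub>R v x) \<in> borel_measurable borel"
      using K by (intro borel_measurable_continuous_on_indicator continuous_on_subset[OF cont_v]) (auto simp: compact_imp_closed)
    moreover have "V = (\<lambda>x. indicator (K - {0}) x *\<^sub>R v x)" by (auto simp: V_def fun_eq_iff indicator_def)
    ultimately show "V \<in> borel_measurable lborel" by simp
    have "\<bar>V x\<bar> \<le> M * (indicator (cball 0 1) x * norm x powr (- s))" for x
      using M(2)[of x] V(3)[of x] M(1) zero(4) by (cases "x \<in> K") (auto simp: subset_iff)
    then show "AE x in lborel. norm (V x) \<le> norm (M * (indicator (cball 0 1) x * norm x powr (- s)))"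
      by (intro AE_I2) (simp only: real_norm_def, rule order.trans[OF _ abs_ge_self], simp)
  qed
  have weak3: "(LINT x|lborel. V x *\<^sub>R (if x \<in> D then adj \<psi> \<psi>1 \<psi>2 x else 0)) = 0"
    if n3: "CARD('n) \<ge> 3" and \<psi>: "hasC2 D \<psi> \<psi>1 \<psi>2" "\<And>x. x \<notin> K \<Longrightarrow> \<psi> x = 0" for \<psi> :: "real^'n \<Rightarrow> complex" and \<psi>1 \<psi>2
  proof -
    obtain B where B: "B \<ge> 0" "\<And>x. x \<in> K \<Longrightarrow> norm (\<psi> x) \<le> B"
      by (rule compact_norm_bound[OF K(1) continuous_on_subset[OF hasC2D(3)[OF \<psi>(1)] K(2)]]) (rule that)
    show ?thesis
    proof (rule weak_solution_cutoff[where k=0 and B=B, OF v Vint V(1,2) \<psi>])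
      fix c :: real assume "c > 0"
      then obtain r where r: "r > 0" "\<And>x. 0 < norm x \<Longrightarrow> norm x < r \<Longrightarrow> \<bar>v x\<bar> \<le> c * norm x powr (2 - real CARD('n))"
        using growth3[OF n3] by blast
      have "\<bar>v x\<bar> \<le> c * \<epsilon> powr (2 - real 0 - real CARD('n))" if "0 < \<epsilon>" "\<epsilon> < r / 2" "\<epsilon> \<le> norm x" "norm x \<le> 2 * \<epsilon>" for \<epsilon> x
      proof -
        have "norm x powr (2 - real CARD('n)) \<le> \<epsilon> powr (2 - real CARD('n))"
          using that n3 by (intro powr_mono2') auto
        then have "c * norm x powr (2 - real CARD('n)) \<le> c * \<epsilon> powr (2 - real 0 - real CARD('n))"
          using \<open>c > 0\<close> by (simp add: mult_left_mono)
        moreover have "\<bar>v x\<bar> \<le> c * norm x powr (2 - real CARD('n))" by (rule r(2)) (use that in auto)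
        ultimately show ?thesis by linarith
      qed
      then show "\<exists>r>0. \<forall>\<epsilon>. 0 < \<epsilon> \<longrightarrow> \<epsilon> < r \<longrightarrow>
        (\<forall>x\<in>K. \<epsilon> \<le> norm x \<longrightarrow> norm x \<le> 2 * \<epsilon> \<longrightarrow> \<bar>v x\<bar> \<le> c * \<epsilon> powr (2 - real 0 - real CARD('n)))"
        using r(1) by (intro exI[of _ "r / 2"]) auto
    qed (use B in auto)
  qed
  have weak2: "(LINT x|lborel. V x *\<^sub>R (if x \<in> D then adj \<psi> \<psi>1 \<psi>2 x else 0)) = 0"
    if n2: "CARD('n) = 2" and \<psi>: "hasC2 D \<psi> \<psi>1 \<psi>2" "\<And>x. x \<notin> K \<Longrightarrow> \<psi> x = 0" "\<psi> 0 = 0"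
    for \<psi> :: "real^'n \<Rightarrow> 'b::euclidean_space" and \<psi>1 \<psi>2
  proof -
    obtain B where B: "\<And>x. x \<in> K \<Longrightarrow> norm (\<psi> x) \<le> B * norm x"
      by (rule hasC2_lipschitz_at_0[OF zero(3,2) \<psi>(1)]) (use \<psi>(3) in auto)
    \<comment> \<open>With \<open>k = 1\<close> and dimension two the required bound is
      \<open>c\<close> times \<epsilon>^(-1), and on the annulus the logarithm is at most
      \<open>inverse \<epsilon>\<close>.\<close>
    show ?thesis
    proof (rule weak_solution_cutoff[where k=1 and B=B, OF v Vint V(1,2) \<psi>(1,2)])
      fix c :: real assume "c > 0"
      then obtain r where r: "r > 0" "\<And>x. 0 < norm x \<Longrightarrow> norm x < r \<Longrightarrow> \<bar>v x\<bar> \<le> c * \<bar>ln (norm x)\<bar>"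
        using growth2[OF n2] by blast
      have "\<bar>v x\<bar> \<le> c * \<epsilon> powr (2 - real 1 - real CARD('n))"
        if "0 < \<epsilon>" "\<epsilon> < r / 2" "x \<in> K" "\<epsilon> \<le> norm x" "norm x \<le> 2 * \<epsilon>" for \<epsilon> x
      proof -
        have n1: "0 < norm x" "norm x \<le> 1" using that zero(4) by auto
        have "ln \<epsilon> \<le> ln (norm x)" using ln_le_cancel_iff[OF that(1) n1(1)] that(4) by simp
        moreover have "ln (norm x) \<le> 0" using n1 by simp
        moreover have "- ln \<epsilon> \<le> inverse \<epsilon>" using ln_le_minus_one[of "inverse \<epsilon>"] that(1) by (simp add: ln_inverse)
        ultimately have "\<bar>ln (norm x)\<bar> \<le> inverse \<epsilon>" by linarith
        then have "c * \<bar>ln (norm x)\<bar> \<le> c * inverse \<epsilon>" using \<open>c > 0\<close> by (intro mult_left_mono) auto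
        moreover have "\<bar>v x\<bar> \<le> c * \<bar>ln (norm x)\<bar>" by (rule r(2)) (use that in auto)
        moreover have "\<epsilon> powr (2 - real 1 - real CARD('n)) = inverse \<epsilon>" using that(1) by (simp add: n2 powr_minus)
        ultimately show ?thesis by simp
      qed
      then show "\<exists>r>0. \<forall>\<epsilon>. 0 < \<epsilon> \<longrightarrow> \<epsilon> < r \<longrightarrow>
        (\<forall>x\<in>K. \<epsilon> \<le> norm x \<longrightarrow> norm x \<le> 2 * \<epsilon> \<longrightarrow> \<bar>v x\<bar> \<le> c * \<epsilon> powr (2 - real 1 - real CARD('n)))"
        using r(1) by (intro exI[of _ "r / 2"]) auto
    qed (use B in auto)
  qed
  have "\<rho> / 2 > 0" using D_ball(3) by simp
  then obtain \<eta>0 :: "real^'n \<Rightarrow> real" where \<eta>0: "smooth_on \<eta>0 UNIV"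
    "\<And>x. x \<in> ball 0 (\<rho> / 2) \<Longrightarrow> \<eta>0 x > 0" "\<And>x. x \<notin> ball 0 (\<rho> / 2) \<Longrightarrow> \<eta>0 x = 0"
    by (rule smooth_bump) (rule that)
  have \<eta>00: "\<eta>0 0 > 0" by (rule \<eta>0(2)) (use D_ball(3) in simp)
  \<comment> \<open>Normalized to 1 at 0, so that subtracting \<psi>(0) times \<eta> from \<psi>
    gives a test function vanishing at the puncture.\<close>
  define \<eta> where "\<eta> x = inverse (\<eta>0 0) * \<eta>0 x" for x
  have \<eta>: "smooth_on \<eta> UNIV" "\<And>x. x \<in> ball 0 (\<rho> / 2) \<Longrightarrow> \<eta> x > 0" "\<And>x. x \<notin> K \<Longrightarrow> \<eta> x = 0" "\<eta> 0 = 1"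
  proof -
    show "smooth_on \<eta> UNIV"
      unfolding \<eta>_def[abs_def] by (intro smooth_on_mult smooth_on_const \<eta>0(1)) simp
    show "\<eta> x > 0" if "x \<in> ball 0 (\<rho> / 2)" for x using \<eta>0(2)[OF that] \<eta>00 by (simp add: \<eta>_def)
    show "\<eta> x = 0" if "x \<notin> K" for x using \<eta>0(3)[of x] that D_ball(2) by (auto simp: \<eta>_def)
    show "\<eta> 0 = 1" using \<eta>00 by (simp add: \<eta>_def)
  qed
  define \<eta>1 where "\<eta>1 l = pd l \<eta>" for l
  define \<eta>2 where "\<eta>2 l m = pd m (pd l \<eta>)" for l m
  have \<eta>C2: "hasC2 S \<eta> \<eta>1 \<eta>2" for S
    using hasC2_subset[OF smooth_on_hasC2[OF \<eta>(1)]] unfolding \<eta>1_def[abs_def] \<eta>2_def[abs_def] by simp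
  have weak: "(LINT x|lborel. V x *\<^sub>R (if x \<in> D then adj \<psi> \<psi>1 \<psi>2 x else 0)) = 0"
    if \<psi>: "hasC2 D \<psi> \<psi>1 \<psi>2" "\<And>x. x \<notin> K \<Longrightarrow> \<psi> x = 0" for \<psi> :: "real^'n \<Rightarrow> complex" and \<psi>1 \<psi>2
  proof (cases "CARD('n) = 2")
    case n2: True
    have log: "(LINT x|lborel. V x *\<^sub>R (if x \<in> D then adj \<eta> \<eta>1 \<eta>2 x else 0)) = 0"
    proof (rule weak_solution_log[OF n2 zero(1,3,2,4) H \<eta>C2 \<eta>(3,4) Vint V(1,3)])
      show "\<bar>V x\<bar> \<le> M * norm x powr (- 1 / 2)" if "x \<in> K" for x using M(2)[OF that] n2 by (simp add: s_def)
      fix \<delta> :: real assume "\<delta> > 0"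
      from growth2[OF n2 this] show "\<exists>r>0. \<forall>x\<in>K. 0 < norm x \<longrightarrow> norm x < r \<longrightarrow> \<bar>V x\<bar> \<le> \<delta> * \<bar>ln (norm x)\<bar>"
        using V(2) by (metis norm_eq_zero order_less_irrefl)
    next
      show "(LINT x|lborel. V x *\<^sub>R (if x \<in> D then adj \<psi> \<psi>1 \<psi>2 x else 0)) = 0"
        if "hasC2 D \<psi> \<psi>1 \<psi>2" "\<And>x. x \<notin> K \<Longrightarrow> \<psi> x = 0" "\<psi> 0 = 0" for \<psi> :: "real^'n \<Rightarrow> real" and \<psi>1 \<psi>2
        by (rule weak2[OF n2 that])
    qed
    \<comment> \<open>\<psi> is split into \<psi> - \<psi>(0)\<eta>, treated by the cutoff argument
      with \<open>k = 1\<close>, and \<psi>(0)\<eta>, treated by the logarithmic test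
      function.\<close>
    let ?z = "- \<psi> 0"
    let ?\<psi> = "\<lambda>x. \<psi> x + \<eta> x *\<^sub>R ?z"
    have d: "hasC2 D ?\<psi> (\<lambda>l x. \<psi>1 l x + \<eta>1 l x *\<^sub>R ?z) (\<lambda>l m x. \<psi>2 l m x + \<eta>2 l m x *\<^sub>R ?z)"
    proof -
      have "hasC2 D (\<lambda>x. \<eta> x *\<^sub>R ?z) (\<lambda>l x. \<eta>1 l x *\<^sub>R ?z) (\<lambda>l m x. \<eta>2 l m x *\<^sub>R ?z)"
        unfolding hasC2_def
        by (intro conjI ballI allI has_partials_linear[OF bounded_linear_scaleR_left] continuous_intros hasC2D[OF \<eta>C2]; assumption)
      from hasC2_add[OF \<psi>(1) this] show ?thesis .
    qed
    have "(LINT x|lborel. V x *\<^sub>R (if x \<in> D then adj \<psi> \<psi>1 \<psi>2 x + adj \<eta> \<eta>1 \<eta>2 x *\<^sub>R ?z else 0)) = 0"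
      unfolding adj_diff_scaleR[symmetric] by (rule weak2[OF n2 d]) (simp_all add: \<psi>(2) \<eta>(3,4))
    moreover have "V x *\<^sub>R (if x \<in> D then adj \<psi> \<psi>1 \<psi>2 x + adj \<eta> \<eta>1 \<eta>2 x *\<^sub>R ?z else 0)
      = (if x \<in> D then V x *\<^sub>R adj \<psi> \<psi>1 \<psi>2 x else 0) + (if x \<in> D then V x *\<^sub>R adj \<eta> \<eta>1 \<eta>2 x else 0) *\<^sub>R ?z" for x
      by (simp add: scaleR_add_right scaleR_diff_right)
    moreover have i1: "integrable lborel (\<lambda>x. if x \<in> D then V x *\<^sub>R adj \<psi> \<psi>1 \<psi>2 x else 0)"
      by (rule integrable_mult_compact_support[OF Vint adj_continuous[OF \<psi>(1)]])
        (rule adj_zero_outside[OF \<psi> compact_imp_closed[OF K(1)]])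
    moreover have i2: "integrable lborel (\<lambda>x. (if x \<in> D then V x *\<^sub>R adj \<eta> \<eta>1 \<eta>2 x else 0))"
      by (rule integrable_mult_compact_support[OF Vint adj_continuous[OF \<eta>C2]])
        (rule adj_zero_outside[OF \<eta>C2 \<eta>(3) compact_imp_closed[OF K(1)]])
    ultimately have "(LINT x|lborel. (if x \<in> D then V x *\<^sub>R adj \<psi> \<psi>1 \<psi>2 x else 0))
        + (LINT x|lborel. (if x \<in> D then V x *\<^sub>R adj \<eta> \<eta>1 \<eta>2 x else 0)) *\<^sub>R ?z = 0"
      by (simp only: Bochner_Integration.integral_add[OF i1 integrable_scaleR_left[OF i2]] integral_scaleR_left[OF i2])
    moreover have "(if x \<in> D then V x *\<^sub>R adj \<eta> \<eta>1 \<eta>2 x else 0) = V x *\<^sub>R (if x \<in> D then adj \<eta> \<eta>1 \<eta>2 x else 0)" for x by simp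
    moreover have "(if x \<in> D then V x *\<^sub>R adj \<psi> \<psi>1 \<psi>2 x else 0) = V x *\<^sub>R (if x \<in> D then adj \<psi> \<psi>1 \<psi>2 x else 0)" for x by simp
    ultimately show ?thesis using log by (simp only: scaleR_zero_left add_0_right)
  next
    case False
    then show ?thesis using dim by (intro weak3 \<psi>) auto
  qed
  obtain w0 w01 w02 where w0: "hasC2 UNIV w0 w01 w02" "\<And>y. isCont (\<lambda>x. V x * \<eta> x) y \<Longrightarrow> V y * \<eta> y = w0 y"
    using weak_solution_C2[OF Vint weak smooth_on_subset[OF \<eta>(1) subset_UNIV] \<eta>(3)] by blast
  let ?b = "ball 0 (\<rho> / 2) :: (real^'n) set"
  \<comment> \<open>On the half ball the cutoff is positive and its reciprocal is C^2, so the
    localization can be undone by division.\<close>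
  have inv: "hasC2 ?b (\<lambda>x. inverse (\<eta> x)) (\<lambda>l x. \<eta>1 l x * - (inverse (\<eta> x) ^ 2))
    (\<lambda>l m x. \<eta>1 l x * (\<eta>1 m x * (2 * inverse (\<eta> x) ^ 3)) + \<eta>2 l m x * - (inverse (\<eta> x) ^ 2))"
  proof (rule hasC2_chain[OF \<eta>C2])
    fix x assume "x \<in> ?b"
    then have "\<eta> x \<noteq> 0" using \<eta>(2) by force
    then show "(inverse has_real_derivative - (inverse (\<eta> x) ^ 2)) (at (\<eta> x))"
      "((\<lambda>t. - (inverse t ^ 2)) has_real_derivative 2 * inverse (\<eta> x) ^ 3) (at (\<eta> x))"
      by (auto intro!: derivative_eq_intros simp: power2_eq_square power3_eq_cube)
  next
    show "continuous_on (\<eta> ` ?b) (\<lambda>t. 2 * inverse t ^ 3)"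
      using \<eta>(2) by (intro continuous_intros) force
  qed
  have "\<forall>x\<in>?b - {0}. v x = inverse (\<eta> x) *\<^sub>R w0 x"
  proof
    fix x assume x: "x \<in> ?b - {0}"
    have op: "open (?b - {0})" by (simp add: open_delete)
    have "isCont v x" using cont_v continuous_on_eq_continuous_at[of "D - {0}" v] D x D_ball by (auto simp: open_delete)
    moreover have "isCont \<eta> x" using hasC2D(1)[OF \<eta>C2, of x UNIV] by (auto intro: has_partials_continuous)
    ultimately have "isCont (\<lambda>x. v x * \<eta> x) x" by (intro continuous_intros)
    moreover have "\<forall>\<^sub>F y in nhds x. v y * \<eta> y = V y * \<eta> y"
      using eventually_nhds_in_open[OF op x] by eventually_elim (use D_ball(2) in \<open>auto simp: V_def\<close>)
    ultimately have "isCont (\<lambda>x. V x * \<eta> x) x" by (simp add: isCont_cong)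
    from w0(2)[OF this] have "v x * \<eta> x = w0 x" using x D_ball(2) by (auto simp: V_def)
    moreover have "\<eta> x > 0" using \<eta>(2) x by auto
    ultimately show "v x = inverse (\<eta> x) *\<^sub>R w0 x" by (auto simp: field_simps)
  qed
  then show ?thesis using hasC2_scaleR[OF inv hasC2_subset[OF w0(1) subset_UNIV]] by blast
qed

section \<open>The linearized Monge-Ampere equation\<close>

lemma has_partials_axis_derivative:
  fixes f :: "real^'n::finite \<Rightarrow> real"
  assumes "has_partials f g (p + t *\<^sub>R axis l 1)"
  shows "((\<lambda>t. f (p + t *\<^sub>R axis l 1)) has_real_derivative g l) (at t)"
proof -
  have "((\<lambda>t. p + t *\<^sub>R axis l 1) has_derivative (\<lambda>h. h *\<^sub>R axis l 1)) (at t)"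
    by (auto intro!: derivative_eq_intros)
  from has_derivative_compose[OF this assms[unfolded has_partials_def]]
  have "((\<lambda>t. f (p + t *\<^sub>R axis l 1)) has_derivative (\<lambda>h. \<Sum>k\<in>UNIV. (h *\<^sub>R axis l 1) $ k *\<^sub>R g k)) (at t)" .
  moreover have "(\<Sum>k\<in>UNIV. (h *\<^sub>R axis l 1) $ k *\<^sub>R g k) = g l * h" for h
    by (simp add: axis_def if_distrib[where f="\<lambda>c. c * _"] if_distrib[where f="\<lambda>c. _ * c"] mult.commute cong: if_cong)
  ultimately show ?thesis unfolding has_field_derivative_def by simp
qed

text \<open>The mean value theorem, once in each direction. The second difference is symmetric in
  \<open>i\<close> and \<open>j\<close> while \<open>f2\<close> is evaluated in one order, which
  yields the symmetry of mixed derivatives; \<open>2 * h < r\<close> keeps the whole parallelogram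
  in the ball.\<close>

lemma second_difference_mean_value:
  fixes f :: "real^'n::finite \<Rightarrow> real"
  assumes f: "hasC2 S f f1 f2" and S: "ball x r \<subseteq> S" and h: "0 < h" "2 * h < r"
  shows "\<exists>y. dist x y < r \<and> f (x + h *\<^sub>R axis i 1 + h *\<^sub>R axis j 1) - f (x + h *\<^sub>R axis i 1)
     - f (x + h *\<^sub>R axis j 1) + f x = h * h * f2 i j y"
proof -
  have near: "dist x (x + s *\<^sub>R axis i 1 + t *\<^sub>R axis j 1) < r" if "0 \<le> s" "s \<le> h" "0 \<le> t" "t \<le> h" for s t
  proof -
    have "norm (s *\<^sub>R axis i 1 + t *\<^sub>R axis j (1::real)) \<le> s + t"
      using norm_triangle_ineq[of "s *\<^sub>R axis i 1" "t *\<^sub>R axis j (1::real)"] that by (simp add: norm_axis_1)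
    then show ?thesis using that h by (simp add: dist_norm norm_minus_commute ac_simps)
  qed
  have inS: "x + s *\<^sub>R axis i 1 + t *\<^sub>R axis j 1 \<in> S" if "0 \<le> s" "s \<le> h" "0 \<le> t" "t \<le> h" for s t
    using near[OF that] S by auto
  define \<phi> where "\<phi> s = f (x + s *\<^sub>R axis i 1 + h *\<^sub>R axis j 1) - f (x + s *\<^sub>R axis i 1)" for s
  have d: "(\<phi> has_real_derivative (f1 i (x + s *\<^sub>R axis i 1 + h *\<^sub>R axis j 1) - f1 i (x + s *\<^sub>R axis i 1))) (at s)"
    if "0 \<le> s" "s \<le> h" for s
  proof -
    have 1: "x + s *\<^sub>R axis i 1 + h *\<^sub>R axis j 1 = (x + h *\<^sub>R axis j 1) + s *\<^sub>R axis i 1" for s by simp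
    have "((\<lambda>s. f ((x + h *\<^sub>R axis j 1) + s *\<^sub>R axis i 1)) has_real_derivative f1 i ((x + h *\<^sub>R axis j 1) + s *\<^sub>R axis i 1)) (at s)"
      by (rule has_partials_axis_derivative, rule hasC2D(1)[OF f]) (use inS[OF that, of h] h in \<open>simp add: 1\<close>)
    moreover have "((\<lambda>s. f (x + s *\<^sub>R axis i 1)) has_real_derivative f1 i (x + s *\<^sub>R axis i 1)) (at s)"
      by (rule has_partials_axis_derivative, rule hasC2D(1)[OF f]) (use inS[OF that, of 0] h in simp)
    ultimately show ?thesis unfolding \<phi>_def[abs_def] 1 by (rule DERIV_diff)
  qed
  obtain s where s: "0 < s" "s < h" "\<phi> h - \<phi> 0 = (h - 0) * (f1 i (x + s *\<^sub>R axis i 1 + h *\<^sub>R axis j 1) - f1 i (x + s *\<^sub>R axis i 1))"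
    using MVT2[OF h(1) d] by blast
  have "((\<lambda>t. f1 i (x + s *\<^sub>R axis i 1 + t *\<^sub>R axis j 1)) has_real_derivative f2 i j (x + s *\<^sub>R axis i 1 + t *\<^sub>R axis j 1)) (at t)"
    if "0 \<le> t" "t \<le> h" for t
    by (rule has_partials_axis_derivative, rule hasC2D(2)[OF f]) (use inS[of s t] s that in simp)
  from MVT2[OF h(1) this] obtain t where t: "0 < t" "t < h"
    "f1 i (x + s *\<^sub>R axis i 1 + h *\<^sub>R axis j 1) - f1 i (x + s *\<^sub>R axis i 1 + 0 *\<^sub>R axis j 1) = (h - 0) * f2 i j (x + s *\<^sub>R axis i 1 + t *\<^sub>R axis j 1)"
    by blast
  have "\<phi> h - \<phi> 0 = h * h * f2 i j (x + s *\<^sub>R axis i 1 + t *\<^sub>R axis j 1)" using s(3) t(3) by simp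
  then show ?thesis
    using near[of s t] s t by (intro exI[of _ "x + s *\<^sub>R axis i 1 + t *\<^sub>R axis j 1"]) (simp add: \<phi>_def)
qed

lemma hasC2_symmetric:
  fixes f :: "real^'n::finite \<Rightarrow> real"
  assumes f: "hasC2 S f f1 f2" and S: "open S" "x \<in> S"
  shows "f2 i j x = f2 j i x"
proof (rule ccontr)
  assume ne: "f2 i j x \<noteq> f2 j i x"
  define e where "e = \<bar>f2 i j x - f2 j i x\<bar> / 2"
  have e: "e > 0" using ne by (simp add: e_def)
  have "isCont (f2 k l) x" for k l
    using hasC2D(5)[OF f] S by (simp add: continuous_on_eq_continuous_at)
  then obtain r1 r2 where r: "r1 > 0" "\<And>y. dist y x < r1 \<Longrightarrow> dist (f2 i j y) (f2 i j x) < e"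
    "r2 > 0" "\<And>y. dist y x < r2 \<Longrightarrow> dist (f2 j i y) (f2 j i x) < e"
    using e unfolding continuous_at_eps_delta by metis
  obtain r0 where r0: "r0 > 0" "ball x r0 \<subseteq> S" using S by (meson openE)
  define r where "r = min r0 (min r1 r2)"
  have rr: "r > 0" "ball x r \<subseteq> S" using r r0 by (auto simp: r_def)
  obtain y where y: "dist x y < r" "f (x + (r/3) *\<^sub>R axis i 1 + (r/3) *\<^sub>R axis j 1) - f (x + (r/3) *\<^sub>R axis i 1)
     - f (x + (r/3) *\<^sub>R axis j 1) + f x = (r/3) * (r/3) * f2 i j y"
    using second_difference_mean_value[OF f rr(2), of "r/3" i j] rr(1) by auto
  obtain z where z: "dist x z < r" "f (x + (r/3) *\<^sub>R axis j 1 + (r/3) *\<^sub>R axis i 1) - f (x + (r/3) *\<^sub>R axis j 1)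
     - f (x + (r/3) *\<^sub>R axis i 1) + f x = (r/3) * (r/3) * f2 j i z"
    using second_difference_mean_value[OF f rr(2), of "r/3" j i] rr(1) by auto
  have "x + (r/3) *\<^sub>R axis i 1 + (r/3) *\<^sub>R axis j 1 = x + (r/3) *\<^sub>R axis j 1 + (r/3) *\<^sub>R axis i 1" by simp
  then have E: "f (x + (r/3) *\<^sub>R axis i 1 + (r/3) *\<^sub>R axis j 1) = f (x + (r/3) *\<^sub>R axis j 1 + (r/3) *\<^sub>R axis i 1)"
    by (rule arg_cong)
  have "(r/3) * (r/3) * f2 i j y = (r/3) * (r/3) * f2 j i z"
    unfolding y(2)[symmetric] z(2)[symmetric] E by simp
  then have "f2 i j y = f2 j i z" using rr(1) by simp
  moreover have "dist (f2 i j y) (f2 i j x) < e" by (rule r(2)) (use y(1) in \<open>simp add: r_def dist_commute\<close>)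
  moreover have "dist (f2 j i z) (f2 j i x) < e" by (rule r(4)) (use z(1) in \<open>simp add: r_def dist_commute\<close>)
  moreover have False if "p = q" "\<bar>p - a\<bar> < \<bar>a - b\<bar> / 2" "\<bar>q - b\<bar> < \<bar>a - b\<bar> / 2" for a b p q :: real
    using abs_triangle_ineq4[of "p - b" "p - a"] that by simp
  ultimately show False unfolding e_def dist_real_def by blast
qed

lemma hasC2_taylor:
  fixes f :: "real^'n::finite \<Rightarrow> real"
  assumes f: "hasC2 S f f1 f2" and S: "ball 0 r \<subseteq> S" and x: "norm x < r"
  shows "\<exists>t. 0 < t \<and> t < 1 \<and> f x = f 0 + (\<Sum>l\<in>UNIV. x$l * f1 l 0)
     + (\<Sum>l\<in>UNIV. \<Sum>m\<in>UNIV. x$l * x$m * f2 l m (t *\<^sub>R x)) / 2"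
proof -
  have inS: "t *\<^sub>R x \<in> S" if "0 \<le> t" "t \<le> 1" for t
  proof -
    have "norm (t *\<^sub>R x) \<le> norm x" using that by (simp add: mult_left_le_one_le)
    then show ?thesis using x S by auto
  qed
  have line: "((\<lambda>t. g (t *\<^sub>R x)) has_real_derivative (\<Sum>k\<in>UNIV. x$k * G k)) (at t)"
    if "has_partials g G (t *\<^sub>R x)" for g :: "real^'n \<Rightarrow> real" and G t
  proof -
    have "((\<lambda>t. t *\<^sub>R x) has_derivative (\<lambda>h. h *\<^sub>R x)) (at t)" by (auto intro!: derivative_eq_intros)
    from has_derivative_compose[OF this that[unfolded has_partials_def]]
    show ?thesis unfolding has_field_derivative_def
      by (rule has_derivative_eq_rhs) (auto simp: sum_distrib_left mult_ac)
  qed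
  define d where "d = (\<lambda>k::nat. if k = 0 then (\<lambda>t. f (t *\<^sub>R x)) else if k = 1 then (\<lambda>t. \<Sum>l\<in>UNIV. x$l * f1 l (t *\<^sub>R x))
     else (\<lambda>t. \<Sum>l\<in>UNIV. \<Sum>m\<in>UNIV. x$l * x$m * f2 l m (t *\<^sub>R x)))"
  have "\<exists>t. 0 < t \<and> t < 1 \<and> d 0 1 = (\<Sum>k<2. d k 0 / fact k * 1 ^ k) + d 2 t / fact 2 * 1 ^ 2"
  proof (rule Maclaurin)
    show "\<forall>k t. k < 2 \<and> 0 \<le> t \<and> t \<le> 1 \<longrightarrow> (d k has_real_derivative d (Suc k) t) (at t)"
    proof (intro allI impI, elim conjE)
      fix k :: nat and t :: real assume k: "k < 2" and t: "0 \<le> t" "t \<le> 1"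
      consider "k = 0" | "k = 1" using k by linarith
      then show "(d k has_real_derivative d (Suc k) t) (at t)"
      proof cases
        case 1
        then show ?thesis using line[OF hasC2D(1)[OF f inS[OF t]]] by (simp add: d_def)
      next
        case 2
        have "((\<lambda>t. \<Sum>l\<in>UNIV. x$l * f1 l (t *\<^sub>R x)) has_real_derivative (\<Sum>l\<in>UNIV. x$l * (\<Sum>m\<in>UNIV. x$m * f2 l m (t *\<^sub>R x)))) (at t)"
          by (intro DERIV_sum DERIV_cmult line hasC2D(2)[OF f inS[OF t]])
        then show ?thesis using 2 by (simp add: d_def sum_distrib_left mult.assoc)
      qed
    qed
  qed auto
  then show ?thesis by (auto simp: d_def numeral_2_eq_2)
qed

section \<open>Cofactor matrices and positive definiteness of the Hessian\<close>

lemma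
  fixes A :: "real^'n::finite^'n"
  assumes "det A \<noteq> 0"
  shows matrix_inv_right: "A ** matrix_inv A = mat 1" and matrix_inv_left: "matrix_inv A ** A = mat 1"
proof -
  have "\<exists>B. A ** B = mat 1 \<and> B ** A = mat 1"
    using assms by (simp add: invertible_det_nz[symmetric] invertible_def)
  from someI_ex[OF this] show "A ** matrix_inv A = mat 1" "matrix_inv A ** A = mat 1"
    unfolding matrix_inv_def by auto
qed

text \<open>Cramer's rule for the columns of the inverse. It exhibits each cofactor as a polynomial
  in the entries of \<open>A\<close>, from which smoothness of U is immediate.\<close>

lemma cofactor_entry:
  fixes A :: "real^'n::finite^'n"
  assumes "det A \<noteq> 0"
  shows "(det A *\<^sub>R matrix_inv A) $ i $ j = det (\<chi> k l. if l = i then (axis j 1 :: real^'n) $ k else A $ k $ l)"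
proof -
  have inv: "A ** matrix_inv A = mat 1"
    by (rule matrix_inv_right[OF assms])
  define x where "x = matrix_inv A *v axis j 1"
  have "A *v x = axis j 1" by (simp add: x_def matrix_vector_mul_assoc inv)
  then have "x = (\<chi> k. det (\<chi> i l. if l = k then (axis j 1 :: real^'n) $ i else A $ i $ l) / det A)"
    using cramer[OF assms] by simp
  then have "x $ i = det (\<chi> k l. if l = i then (axis j 1 :: real^'n) $ k else A $ k $ l) / det A" by simp
  moreover have "x $ i = matrix_inv A $ i $ j"
    by (simp add: x_def matrix_vector_mult_def axis_def if_distrib cong: if_cong)
  ultimately show ?thesis using assms by simp
qed

lemma smooth_on_det:
  assumes "open S" "\<And>i j. smooth_on (\<lambda>x. M x $ i $ j) S"
  shows "smooth_on (\<lambda>x. det (M x :: real^'n::finite^'n)) S"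
  unfolding det_def
  by (intro smooth_on_sum smooth_on_mult smooth_on_const smooth_on_prod assms)

lemma smooth_on_hessian:
  assumes "smooth_on u S"
  shows "smooth_on (\<lambda>x. hessian u x $ i $ j) S"
  using smooth_on_pd[OF smooth_on_pd[OF assms]] by (simp add: hessian_def partial_eq_pd)

lemma smooth_on_cofactor_hessian:
  assumes "open S" "smooth_on u S" "\<And>x. x \<in> S \<Longrightarrow> det (hessian u x) \<noteq> 0"
  shows "smooth_on (\<lambda>x. cofactor_hessian u x $ i $ j) S"
proof (rule smooth_on_cong[OF assms(1)])
  show "smooth_on (\<lambda>x. det (\<chi> k l. if l = i then (axis j 1 :: real^'a) $ k else hessian u x $ k $ l)) S"
  proof (rule smooth_on_det[OF assms(1)])
    fix k l
    show "smooth_on (\<lambda>x. (\<chi> k l. if l = i then (axis j 1 :: real^'a) $ k else hessian u x $ k $ l) $ k $ l) S"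
      by (cases "l = i") (simp_all add: smooth_on_const smooth_on_hessian[OF assms(2)])
  qed
qed (unfold cofactor_hessian_def, rule cofactor_entry[OF assms(3), symmetric])

text \<open>If the form vanishes at \<open>x\<close>, then \<open>x\<close> minimizes it and the
  variation in direction \<open>H *v x\<close> shows \<open>H *v x = 0\<close>; invertibility gives
  \<open>x = 0\<close>. The constant is the minimum on the unit sphere.\<close>

lemma positive_definite_bound:
  fixes H :: "real^'n::finite^'n"
  assumes sym: "\<And>i j. H$i$j = H$j$i" and psd: "\<And>x. 0 \<le> x \<bullet> (H *v x)" and det: "det H \<noteq> 0"
  shows "\<exists>m>0. \<forall>x. m * (norm x)\<^sup>2 \<le> x \<bullet> (H *v x)"
proof -
  have adj: "y \<bullet> (H *v x) = x \<bullet> (H *v y)" for x y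
  proof -
    have "transpose H = H" using sym by (simp add: transpose_def vec_eq_iff)
    then show ?thesis using dot_lmul_matrix[of x H y] by (metis inner_commute transpose_matrix_vector)
  qed
  have pd: "0 < x \<bullet> (H *v x)" if "x \<noteq> 0" for x
  proof (rule ccontr)
    assume "\<not> 0 < x \<bullet> (H *v x)"
    then have x0: "x \<bullet> (H *v x) = 0" using psd[of x] by simp
    define z where "z = H *v x"
    have quad: "2 * (z \<bullet> z) \<le> t * (z \<bullet> (H *v z))" if t: "t > 0" for t
    proof -
      have "0 \<le> (x - t *\<^sub>R z) \<bullet> (H *v (x - t *\<^sub>R z))" by (rule psd)
      also have "\<dots> = x \<bullet> (H *v x) - t * (x \<bullet> (H *v z)) - t * (z \<bullet> (H *v x)) + t * (t * (z \<bullet> (H *v z)))"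
        by (simp add: matrix_vector_mult_diff_distrib matrix_vector_mult_scaleR inner_diff_left inner_diff_right algebra_simps)
      also have "\<dots> = t * (t * (z \<bullet> (H *v z)) - 2 * (z \<bullet> z))"
        using x0 adj[of x z] by (simp add: z_def algebra_simps)
      finally show ?thesis using t by (simp add: zero_le_mult_iff)
    qed
    have "z \<bullet> z \<le> 0"
    proof (rule ccontr)
      assume "\<not> z \<bullet> z \<le> 0"
      then have zz: "z \<bullet> z > 0" by (simp only: not_le)
      \<comment> \<open>With \<open>t = (z \<bullet> z) / (c + 1)\<close> the right side of
        \<open>quad\<close> is at most \<open>z \<bullet> z\<close>; the added 1 keeps the
        denominator positive.\<close>
      define c where "c = z \<bullet> (H *v z)"
      have c: "c \<ge> 0" using psd by (simp add: c_def)
      have "2 * (z \<bullet> z) \<le> ((z \<bullet> z) / (c + 1)) * c" using quad[of "(z \<bullet> z) / (c + 1)"] zz c by (simp add: c_def)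
      also have "\<dots> \<le> z \<bullet> z" using zz c by (simp add: divide_le_eq mult_left_mono)
      finally show False using zz by simp
    qed
    then have "z \<bullet> z = 0" using inner_ge_zero[of z] by (rule order.antisym)
    then have "H *v x = 0" by (simp add: z_def)
    then have "matrix_inv H *v (H *v x) = 0" by simp
    then have "x = 0" by (simp add: matrix_vector_mul_assoc matrix_inv_left[OF det])
    then show False using that by simp
  qed
  have cont: "continuous_on (sphere 0 1) (\<lambda>x. x \<bullet> (H *v x))"
    by (intro continuous_intros linear_continuous_on matrix_vector_mul_bounded_linear)
  have "sphere (0::real^'n) 1 \<noteq> {}"
  proof -
    have "axis undefined 1 \<in> sphere (0::real^'n) 1" by (simp add: norm_axis_1)
    then show ?thesis by blast
  qed
  then obtain y where y: "y \<in> sphere 0 1" "\<And>x. x \<in> sphere 0 1 \<Longrightarrow> y \<bullet> (H *v y) \<le> x \<bullet> (H *v x)"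
    using continuous_attains_inf[OF compact_sphere _ cont] by blast
  have "y \<noteq> 0" using y(1) by auto
  show ?thesis
  proof (intro exI[of _ "y \<bullet> (H *v y)"] conjI allI)
    show "0 < y \<bullet> (H *v y)" by (rule pd[OF \<open>y \<noteq> 0\<close>])
    fix x :: "real^'n"
    show "y \<bullet> (H *v y) * (norm x)\<^sup>2 \<le> x \<bullet> (H *v x)"
    proof (cases "x = 0")
      case False
      define z where "z = (1 / norm x) *\<^sub>R x"
      have "y \<bullet> (H *v y) \<le> z \<bullet> (H *v z)" using y(2)[of z] False by (simp add: z_def)
      also have "\<dots> = (x \<bullet> (H *v x)) / (norm x)\<^sup>2"
        using False by (simp add: z_def matrix_vector_mult_scaleR power2_eq_square)
      finally show ?thesis using False by (simp add: le_divide_eq)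
    qed simp
  qed
qed

text \<open>Midpoint convexity between sx and -sx: in the two Taylor expansions the linear terms
  cancel, and by continuity both remainders would be negative if the form were negative at
  0.\<close>

lemma convex_second_derivative_nonneg:
  fixes u :: "real^'n::finite \<Rightarrow> real"
  assumes u: "hasC2 S u u1 u2" and S: "open S" "0 \<in> S" and convex: "convex_on S u"
  shows "0 \<le> (\<Sum>l\<in>UNIV. \<Sum>m\<in>UNIV. x$l * x$m * u2 l m 0)"
proof (rule ccontr)
  define Q where "Q y = (\<Sum>l\<in>UNIV. \<Sum>m\<in>UNIV. x$l * x$m * u2 l m y)" for y
  assume "\<not> ?thesis"
  then have neg: "Q 0 < 0" by (simp add: Q_def)
  have "continuous_on S Q" unfolding Q_def[abs_def] by (intro continuous_intros hasC2D[OF u])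
  then have "isCont Q 0" using S by (simp add: continuous_on_eq_continuous_at)
  then have "\<forall>\<^sub>F y in at 0. Q y < 0" using neg unfolding isCont_def by (rule order_tendstoD)
  then obtain r1 where r1: "r1 > 0" "\<And>y. norm y < r1 \<Longrightarrow> Q y < 0"
    using neg unfolding eventually_at by (metis dist_0_norm dist_commute UNIV_I)
  obtain r0 where r0: "r0 > 0" "ball 0 r0 \<subseteq> S" using S by (meson openE)
  define s where "s = min r0 r1 / (2 * (norm x + 1))"
  have s: "s > 0" using r0 r1 by (simp add: s_def add_nonneg_pos)
  have sx: "norm (s *\<^sub>R x) < min r0 r1"
  proof -
    have "norm x < 2 * (norm x + 1)" using norm_ge_zero[of x] unfolding distrib_left by linarith
    then have "s * norm x < s * (2 * (norm x + 1))" using s by (rule mult_strict_left_mono)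
    also have "\<dots> = min r0 r1" by (simp add: s_def add_nonneg_eq_0_iff)
    finally show ?thesis using s by simp
  qed
  obtain t1 where t1: "0 < t1" "t1 < 1" "u (s *\<^sub>R x) = u 0 + (\<Sum>l\<in>UNIV. (s *\<^sub>R x)$l * u1 l 0)
     + (\<Sum>l\<in>UNIV. \<Sum>m\<in>UNIV. (s *\<^sub>R x)$l * (s *\<^sub>R x)$m * u2 l m (t1 *\<^sub>R (s *\<^sub>R x))) / 2"
    using hasC2_taylor[OF u r0(2), of "s *\<^sub>R x"] sx by auto
  obtain t2 where t2: "0 < t2" "t2 < 1" "u (- s *\<^sub>R x) = u 0 + (\<Sum>l\<in>UNIV. (- s *\<^sub>R x)$l * u1 l 0)
     + (\<Sum>l\<in>UNIV. \<Sum>m\<in>UNIV. (- s *\<^sub>R x)$l * (- s *\<^sub>R x)$m * u2 l m (t2 *\<^sub>R (- s *\<^sub>R x))) / 2"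
    using hasC2_taylor[OF u r0(2), of "- s *\<^sub>R x"] sx by auto
  have q1: "(\<Sum>l\<in>UNIV. \<Sum>m\<in>UNIV. (s *\<^sub>R x)$l * (s *\<^sub>R x)$m * u2 l m y) = s\<^sup>2 * Q y" for y
    by (simp add: Q_def sum_distrib_left power2_eq_square mult_ac)
  have q2: "(\<Sum>l\<in>UNIV. \<Sum>m\<in>UNIV. (- s *\<^sub>R x)$l * (- s *\<^sub>R x)$m * u2 l m y) = s\<^sup>2 * Q y" for y
    by (simp add: Q_def sum_distrib_left power2_eq_square mult_ac)
  have lin: "(\<Sum>l\<in>UNIV. (- s *\<^sub>R x)$l * u1 l 0) = - (\<Sum>l\<in>UNIV. (s *\<^sub>R x)$l * u1 l 0)"
    by (simp add: sum_negf)
  have "u ((1 - 1/2) *\<^sub>R (s *\<^sub>R x) + (1/2) *\<^sub>R (- s *\<^sub>R x)) \<le> (1 - 1/2) * u (s *\<^sub>R x) + (1/2) * u (- s *\<^sub>R x)"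
  proof (rule convex_onD[OF convex])
    show "s *\<^sub>R x \<in> S" "- s *\<^sub>R x \<in> S" using sx by (auto intro!: subsetD[OF r0(2)])
  qed auto
  then have "2 * u 0 \<le> u (s *\<^sub>R x) + u (- s *\<^sub>R x)" by simp
  then have "0 \<le> s\<^sup>2 * (Q (t1 *\<^sub>R (s *\<^sub>R x)) + Q (t2 *\<^sub>R (- s *\<^sub>R x)))"
    unfolding t1(3) t2(3) q1 q2 lin by (simp add: distrib_left)
  moreover have Qneg: "Q (t *\<^sub>R (c *\<^sub>R x)) < 0" if "0 < t" "t < 1" "\<bar>c\<bar> = s" for t c
  proof (rule r1(2))
    have "t * (s * norm x) \<le> 1 * (s * norm x)" using that s by (intro mult_right_mono) auto
    then have "norm (t *\<^sub>R (c *\<^sub>R x)) \<le> norm (s *\<^sub>R x)" using that s by (simp add: abs_mult mult.assoc)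
    then show "norm (t *\<^sub>R (c *\<^sub>R x)) < r1" using sx by simp
  qed
  then have "Q (t1 *\<^sub>R (s *\<^sub>R x)) + Q (t2 *\<^sub>R (- s *\<^sub>R x)) < 0"
    by (intro add_neg_neg Qneg[OF t1(1,2)] Qneg[OF t2(1,2)]) (use s in auto)
  then have "s\<^sup>2 * (Q (t1 *\<^sub>R (s *\<^sub>R x)) + Q (t2 *\<^sub>R (- s *\<^sub>R x))) < 0"
    using s by (intro mult_pos_neg) auto
  ultimately show False by linarith
qed

text \<open>Converts a condition on boundaries of sections into a pointwise one: a point
  \<open>x\<close> near 0 lies on the boundary of the section of height \<open>\<phi> x\<close>. It
  is not in that section, the inequality being strict, while the points tx with t < 1 are, since
  convexity and \<open>\<phi> 0 = 0\<close> give \<phi>(tx) \<le> t\<phi>(x).\<close>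

lemma section_boundary_growth:
  fixes \<Omega> :: "(real^'n::finite) set" and u v :: "real^'n \<Rightarrow> real"
  defines "\<phi> \<equiv> \<lambda>x. u x - u 0 - gradient u 0 \<bullet> x"
  assumes \<Omega>: "open \<Omega>" "0 \<in> \<Omega>" and convex: "convex_on \<Omega> u"
    and phi: "0 < m" "0 < \<rho>" "ball 0 \<rho> \<subseteq> \<Omega>"
      "\<And>x. norm x < \<rho> \<Longrightarrow> m * (norm x)\<^sup>2 \<le> \<phi> x" "\<And>x. norm x < \<rho> \<Longrightarrow> \<phi> x \<le> M * (norm x)\<^sup>2"
    and growth: "small_o_on_boundaries v (MA_section \<Omega> u 0) g" and c: "c > 0"
  shows "\<exists>r>0. \<forall>x. 0 < norm x \<longrightarrow> norm x < r \<longrightarrow> \<bar>v x\<bar> \<le> c * \<bar>g (\<phi> x)\<bar>"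
proof -
  obtain b where b: "b > 0" "\<And>t. 0 < t \<Longrightarrow> t < b \<Longrightarrow> \<forall>x\<in>frontier (MA_section \<Omega> u 0 t). \<bar>v x\<bar> \<le> c * \<bar>g t\<bar>"
    using growth c unfolding small_o_on_boundaries_def eventually_at_right_field by blast
  have sec: "MA_section \<Omega> u 0 t = {x \<in> closure \<Omega>. \<phi> x < t}" for t
    by (auto simp: MA_section_def \<phi>_def)
  have bdry: "x \<in> frontier (MA_section \<Omega> u 0 (\<phi> x))" if x: "norm x < \<rho>" "\<phi> x > 0" for x
  proof -
    have "x \<notin> MA_section \<Omega> u 0 (\<phi> x)" by (simp add: sec)
    then have 1: "x \<notin> interior (MA_section \<Omega> u 0 (\<phi> x))" using interior_subset by blast
    have "x \<in> closure (MA_section \<Omega> u 0 (\<phi> x))"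
      unfolding closure_sequential
    proof (intro exI conjI allI)
      let ?t = "\<lambda>n. 1 - inverse (real (Suc n))"
      have t: "0 \<le> ?t n" "?t n < 1" for n by (auto simp: field_simps)
      show "(\<lambda>n. ?t n *\<^sub>R x) \<longlonglongrightarrow> x"
        using tendsto_scaleR[OF tendsto_diff[OF tendsto_const LIMSEQ_inverse_real_of_nat] tendsto_const, of 1 x] by simp
      fix n
      have inb: "?t n *\<^sub>R x \<in> \<Omega>" "x \<in> \<Omega>"
      proof -
        have "?t n * norm x \<le> 1 * norm x" using t[of n] by (intro mult_right_mono) auto
        then have "norm (?t n *\<^sub>R x) < \<rho>" using x(1) t[of n] by (simp only: norm_scaleR abs_of_nonneg mult_1)
        then show "?t n *\<^sub>R x \<in> \<Omega>" using phi(3) by (auto simp del: of_nat_Suc)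
        show "x \<in> \<Omega>" using phi(3) x(1) by auto
      qed
      have "u ((1 - ?t n) *\<^sub>R 0 + ?t n *\<^sub>R x) \<le> (1 - ?t n) * u 0 + ?t n * u x"
        by (rule convex_onD[OF convex]) (use t[of n] inb \<Omega> in auto)
      then have "\<phi> (?t n *\<^sub>R x) \<le> ?t n * \<phi> x"
        by (simp add: \<phi>_def algebra_simps del: of_nat_Suc)
      also have "\<dots> < \<phi> x" using t[of n] x(2) by (simp del: of_nat_Suc)
      finally show "?t n *\<^sub>R x \<in> MA_section \<Omega> u 0 (\<phi> x)"
        using inb closure_subset by (auto simp: sec simp del: of_nat_Suc)
    qed
    then show ?thesis using 1 by (simp add: frontier_def)
  qed
  \<comment> \<open>For \<open>norm x < 1\<close> the bound M\<bar>x\<bar>^2 is at most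
    (\<bar>M\<bar> + 1)\<bar>x\<bar>, so the last entry keeps the height \<open>\<phi> x\<close>
    below \<open>b\<close>.\<close>
  define r where "r = min \<rho> (min 1 (b / (\<bar>M\<bar> + 1)))"
  have r: "r > 0" using phi(2) b(1) by (simp add: r_def)
  have "\<bar>v x\<bar> \<le> c * \<bar>g (\<phi> x)\<bar>" if x: "0 < norm x" "norm x < r" for x
  proof -
    have x\<rho>: "norm x < \<rho>" "norm x < 1" "norm x < b / (\<bar>M\<bar> + 1)" using x by (auto simp: r_def)
    have "0 < m * (norm x)\<^sup>2" using phi(1) x by simp
    then have pos: "\<phi> x > 0" using phi(4)[OF x\<rho>(1)] by linarith
    have "\<phi> x \<le> M * (norm x)\<^sup>2" by (rule phi(5)[OF x\<rho>(1)])
    also have "\<dots> \<le> (\<bar>M\<bar> + 1) * norm x"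
    proof -
      have "(norm x)\<^sup>2 \<le> norm x" using x x\<rho>(2) by (simp add: power2_eq_square mult_left_le)
      then show ?thesis by (intro mult_mono) auto
    qed
    also have "\<dots> < b" using x\<rho>(3) by (simp add: less_divide_eq mult.commute)
    finally show ?thesis using b(2)[OF pos] bdry[OF x\<rho>(1) pos] by blast
  qed
  then show ?thesis using r by blast
qed

text \<open>ln y differs from 2 ln s by at most \<open>L\<close>, and for s < exp(-L) this
  difference is absorbed by a third copy of \<bar>ln s\<bar>.\<close>

lemma abs_ln_comparable:
  assumes "0 < m" "0 < M"
  shows "\<exists>r>0. \<forall>s y. 0 < s \<longrightarrow> s < r \<longrightarrow> m * s\<^sup>2 \<le> y \<longrightarrow> y \<le> M * s\<^sup>2 \<longrightarrow> \<bar>ln y\<bar> \<le> 3 * \<bar>ln (s::real)\<bar>"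
proof -
  define L where "L = \<bar>ln m\<bar> + \<bar>ln M\<bar>"
  have "\<bar>ln y\<bar> \<le> 3 * \<bar>ln s\<bar>" if s: "0 < s" "s < exp (- L)" and y: "m * s\<^sup>2 \<le> y" "y \<le> M * s\<^sup>2" for s y :: real
  proof -
    have "ln s < - L" using s by (metis exp_less_cancel_iff exp_ln)
    have "0 < m * s\<^sup>2" using assms s by simp
    then have y0: "y > 0" using y by linarith
    have "ln (m * s\<^sup>2) \<le> ln y" "ln y \<le> ln (M * s\<^sup>2)" using y y0 \<open>0 < m * s\<^sup>2\<close> by auto
    then have "ln m + 2 * ln s \<le> ln y" "ln y \<le> ln M + 2 * ln s"
      using assms s by (simp_all add: ln_mult ln_realpow)
    then show ?thesis using \<open>ln s < - L\<close> unfolding L_def by linarith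
  qed
  then show ?thesis by (intro exI[of _ "exp (- L)"]) auto
qed

lemma Ck_on_2_partials:
  fixes u :: "real^'n::finite \<Rightarrow> real"
  shows "Ck_on 2 u S \<Longrightarrow> hasC2 S u (\<lambda>l. partial l u) (\<lambda>l m. partial m (partial l u))"
  using Ck_on_2_hasC2[of u S] by (simp add: partial_eq_pd)

lemma hessian_cong:
  assumes "open S" "x \<in> S" "\<And>y. y \<in> S \<Longrightarrow> f y = g y"
  shows "hessian f x = hessian g x"
proof -
  have "partial j f y = partial j g y" if "y \<in> S" for y j
    using frechet_derivative_cong_open(1)[OF assms(1) that assms(3)] by (simp add: partial_def)
  then have "partial i (partial j f) x = partial i (partial j g) x" for i j
    using frechet_derivative_cong_open(1)[OF assms(1,2), of "partial j f" "partial j g"] by (simp add: partial_def)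
  then show ?thesis by (simp add: hessian_def)
qed

text \<open>An extension on an arbitrarily small ball is enough: it agrees with \<open>v\<close> on
  the overlap, so both glue to a C^2 function on \<open>S\<close>. The operator applied to it is
  continuous and vanishes off 0, hence also at 0.\<close>

lemma removable_singularity_at_0I:
  fixes u v w :: "real^'n::finite \<Rightarrow> real"
  assumes S: "open S" "0 \<in> S" and \<delta>: "0 < \<delta>" "ball 0 \<delta> \<subseteq> S"
    and v: "solves_linearized_MA u v (S - {0})"
    and w: "Ck_on 2 w (ball 0 \<delta>)" "\<And>x. x \<in> ball 0 \<delta> - {0} \<Longrightarrow> v x = w x"
    and U: "\<And>i j. continuous_on S (\<lambda>x. cofactor_hessian u x $ i $ j)"
  shows "removable_singularity_at_0 u v S"
proof -
  define z where "z x = (if x = 0 then w 0 else v x)" for x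
  have op: "open (S - {0})" "open (ball 0 \<delta> :: (real^'n) set)" using S by (auto simp: open_delete)
  have zw: "z x = w x" if "x \<in> ball 0 \<delta>" for x using w(2)[of x] that by (auto simp: z_def)
  have zv: "z x = v x" if "x \<in> S - {0}" for x using that by (simp add: z_def)
  have "Ck_on 2 v (S - {0})" using v by (simp only: solves_linearized_MA_def)
  from Ck_on_cong[OF op(1) zv[symmetric] this] have "Ck_on 2 z (S - {0})" .
  moreover have "Ck_on 2 z (ball 0 \<delta>)" by (rule Ck_on_cong[OF op(2) zw[symmetric] w(1)])
  ultimately have "Ck_on 2 z ((S - {0}) \<union> ball 0 \<delta>)" by (intro Ck_on_Un op)
  moreover have "(S - {0}) \<union> ball 0 \<delta> = S" using S \<delta> by auto
  ultimately have z: "Ck_on 2 z S" by simp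
  define E where "E x = (\<Sum>i\<in>UNIV. \<Sum>j\<in>UNIV. cofactor_hessian u x $ i $ j * hessian z x $ i $ j)" for x
  have E0: "E x = 0" if "x \<in> S - {0}" for x
    using v that hessian_cong[OF op(1) that zv] by (simp add: E_def solves_linearized_MA_def)
  have "continuous_on S (\<lambda>x. hessian z x $ i $ j)" for i j
    using hasC2D(5)[OF Ck_on_2_partials[OF z]] by (simp add: hessian_def)
  then have "continuous_on S E" unfolding E_def[abs_def] by (intro continuous_on_sum continuous_on_mult U)
  then have "(E \<longlongrightarrow> E 0) (at 0)" using S by (simp add: continuous_on_eq_continuous_at isCont_def)
  moreover have "\<forall>\<^sub>F x in at 0. E x = 0"
    using S E0 unfolding eventually_at_topological by blast
  ultimately have "E 0 = 0"
    using tendsto_unique[OF _ _ tendsto_eventually] by (metis at_neq_bot)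
  then have "E x = 0" if "x \<in> S" for x using E0[of x] that by (cases "x = 0") auto
  then have "solves_linearized_MA u z S" using z by (simp add: solves_linearized_MA_def E_def)
  then show ?thesis using zv unfolding removable_singularity_at_0_def by (metis)
qed

theorem corollary1p4:
  fixes \<Omega> V :: "(real^'n::finite) set"
    and u v :: "real^'n \<Rightarrow> real"
    and lam Lam R :: real
  assumes dim: "CARD('n) \<ge> 2"
    and \<Omega>: "bounded \<Omega>" "smooth_domain \<Omega>" "uniformly_convex \<Omega>"
    and u: "continuous_on (closure \<Omega>) u" "smooth_on u \<Omega>" "convex_on \<Omega> u"
    and bdry: "\<forall>x\<in>frontier \<Omega>. u x = 0"
    and const: "0 < lam" "lam \<le> Lam"
    and MA: "\<forall>x\<in>\<Omega>. lam \<le> det (hessian u x) \<and> det (hessian u x) \<le> Lam"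
    and V: "compactly_contained V \<Omega>"
    and sect: "0 \<in> \<Omega>" "R > 0" "MA_section \<Omega> u 0 R - {0} \<subseteq> V"
    and v: "solves_linearized_MA u v (MA_section \<Omega> u 0 R - {0})"
    and growth: "small_o_on_boundaries v (MA_section \<Omega> u 0)
      (\<lambda>r. if CARD('n) \<ge> 3 then r powr ((2 - real CARD('n)) / 2) else \<bar>ln r\<bar>)"
  shows "removable_singularity_at_0 u v (MA_section \<Omega> u 0 R)"
proof -
  define S where "S = MA_section \<Omega> u 0 R"
  have op\<Omega>: "open \<Omega>" using \<Omega>(2) by (simp add: smooth_domain_def)
  have det_pos: "det (hessian u x) > 0" if "x \<in> \<Omega>" for x using MA const that by force
  have "V \<subseteq> \<Omega>" using V closure_subset unfolding compactly_contained_def by blast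
  then have S\<Omega>: "S \<subseteq> \<Omega>" using sect(1,3) by (auto simp: S_def)
  have u_cont: "continuous_on \<Omega> u" by (rule smooth_on_continuous[OF u(2)])
  define \<phi> where "\<phi> x = u x - u 0 - gradient u 0 \<bullet> x" for x
  \<comment> \<open>Sections are taken in \<open>closure \<Omega>\<close>. That the punctured
    section lies in \<open>V\<close>, whose closure is inside \<Omega>, rules out boundary points,
    so \<open>S\<close> is a strict sublevel set in the open set \<Omega> and therefore
    open.\<close>
  have S_eq: "S = {x \<in> \<Omega>. \<phi> x < R}"
    using S\<Omega> closure_subset[of \<Omega>] by (auto simp: S_def MA_section_def \<phi>_def)
  have opS: "open S"
  proof -
    have "continuous_on \<Omega> \<phi>" unfolding \<phi>_def[abs_def] by (intro continuous_intros u_cont)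
    from continuous_open_preimage[OF this op\<Omega> open_lessThan[of R]]
    show ?thesis unfolding S_eq by (simp add: vimage_def Int_def)
  qed
  have S0: "0 \<in> S" using sect(1,2) by (simp add: S_eq \<phi>_def)
  \<comment> \<open>The operator is U itself. At 0 it is det H times the inverse of H for H =
    D^2u(0), which is the relation between coefficients and quadratic form that
    \<open>removable_singularity\<close> asks for.\<close>
  define a where "a i j x = cofactor_hessian u x $ i $ j" for i j x
  have a_smooth: "smooth_on (a i j) \<Omega>" for i j
    unfolding a_def[abs_def] using det_pos by (intro smooth_on_cofactor_hessian op\<Omega> u(2)) force
  have uC2: "hasC2 \<Omega> u (\<lambda>l. partial l u) (\<lambda>l m. partial m (partial l u))"
    by (rule Ck_on_2_partials[OF smooth_on_Ck[OF u(2)]])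
  define H where "H = hessian u 0"
  define d where "d = det H"
  have d: "d > 0" using det_pos[OF sect(1)] by (simp add: d_def H_def)
  have Hij: "H$i$j = partial i (partial j u) 0" for i j by (simp add: H_def hessian_def)
  have Hsym: "H$i$j = H$j$i" for i j
    unfolding Hij using hasC2_symmetric[OF uC2 op\<Omega> sect(1)] .
  have quad: "x \<bullet> (H *v x) = (\<Sum>l\<in>UNIV. \<Sum>m\<in>UNIV. x$l * x$m * partial m (partial l u) 0)" for x
    by (simp add: inner_vec_def matrix_vector_mult_def sum_distrib_left Hsym[unfolded Hij] Hij mult_ac)
  have psd: "0 \<le> x \<bullet> (H *v x)" for x
    unfolding quad by (rule convex_second_derivative_nonneg[OF uC2 op\<Omega> sect(1) u(3)])
  obtain m0 where m0: "m0 > 0" "\<And>x. m0 * (norm x)\<^sup>2 \<le> x \<bullet> (H *v x)"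
    using positive_definite_bound[OF Hsym psd] d by (auto simp: d_def)
  define m where "m = min m0 1"
  have m: "0 < m" "m \<le> 1" "\<And>x. m * (norm x)\<^sup>2 \<le> x \<bullet> (H *v x)"
  proof -
    show "m * (norm x)\<^sup>2 \<le> x \<bullet> (H *v x)" for x
      by (rule order.trans[OF _ m0(2)]) (auto simp: m_def intro!: mult_right_mono)
  qed (use m0 in \<open>auto simp: m_def\<close>)
  have a0: "a i j 0 = d * matrix_inv H $ i $ j" for i j
    by (simp add: a_def cofactor_hessian_def H_def d_def)
  have dH: "det H \<noteq> 0" using d by (simp add: d_def)
  have aH: "(\<Sum>j\<in>UNIV. a i j 0 * H$j$k) = (if i = k then d else 0)" for i k
  proof -
    have "(matrix_inv H ** H) $ i $ k = (mat 1 :: real^'n^'n) $ i $ k" by (simp add: matrix_inv_left[OF dH])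
    then have "(\<Sum>j\<in>UNIV. matrix_inv H $ i $ j * H$j$k) = (if i = k then 1 else 0)"
      by (simp add: matrix_matrix_mult_def mat_def)
    then have "d * (\<Sum>j\<in>UNIV. matrix_inv H $ i $ j * H$j$k) = (if i = k then d else 0)" by simp
    then show ?thesis by (simp add: a0 sum_distrib_left mult.assoc)
  qed
  \<comment> \<open>Writing \<xi> = Hy turns the cofactor form at 0 into d times y.Hy, at least
    dm\<bar>y\<bar>^2, and \<open>norm \<xi> \<le> B * norm y\<close> gives the constant.\<close>
  obtain \<mu> where \<mu>: "\<mu> > 0" "\<And>\<xi>. \<mu> * (norm \<xi>)\<^sup>2 \<le> (\<Sum>i\<in>UNIV. \<Sum>j\<in>UNIV. a i j 0 * (\<xi>$i * \<xi>$j))"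
  proof -
    obtain B where B: "B > 0" "\<And>x. norm (H *v x) \<le> B * norm x"
      using linear_bounded_pos[OF matrix_vector_mul_linear[of H]] by blast
    have "d * m / B\<^sup>2 * (norm \<xi>)\<^sup>2 \<le> (\<Sum>i\<in>UNIV. \<Sum>j\<in>UNIV. a i j 0 * (\<xi>$i * \<xi>$j))" for \<xi>
    proof -
      define y where "y = matrix_inv H *v \<xi>"
      have \<xi>: "\<xi> = H *v y" by (simp add: y_def matrix_vector_mul_assoc matrix_inv_right[OF dH])
      have "(\<Sum>i\<in>UNIV. \<Sum>j\<in>UNIV. a i j 0 * (\<xi>$i * \<xi>$j)) = d * (\<xi> \<bullet> y)"
        by (simp add: a0 y_def inner_vec_def matrix_vector_mult_def sum_distrib_left mult_ac)
      also have "\<xi> \<bullet> y = y \<bullet> (H *v y)" by (simp add: \<xi> inner_commute)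
      finally have e: "(\<Sum>i\<in>UNIV. \<Sum>j\<in>UNIV. a i j 0 * (\<xi>$i * \<xi>$j)) = d * (y \<bullet> (H *v y))" .
      have "(norm \<xi>)\<^sup>2 \<le> (B * norm y)\<^sup>2" unfolding \<xi> using B(2) by (intro power_mono) auto
      then have "(norm \<xi>)\<^sup>2 / B\<^sup>2 \<le> (norm y)\<^sup>2" using B(1) by (simp add: power_mult_distrib divide_le_eq mult.commute)
      then have "d * (m * ((norm \<xi>)\<^sup>2 / B\<^sup>2)) \<le> d * (m * (norm y)\<^sup>2)" using d m(1) by (intro mult_left_mono) auto
      also have "\<dots> \<le> d * (y \<bullet> (H *v y))" using d m(3) by (intro mult_left_mono) auto
      finally show ?thesis unfolding e by simp
    qed
    then show ?thesis using that[of "d * m / B\<^sup>2"] d m(1) B(1) by simp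
  qed
  define n where "n = real CARD('n)"
  have n: "n > 0" by (simp add: n_def)
  have near: "\<exists>r>0. ball 0 r \<subseteq> S \<and> (\<forall>x\<in>ball 0 r. \<forall>i j. \<bar>f i j x - f i j 0\<bar> \<le> e)"
    if "\<And>i j. continuous_on \<Omega> (f i j)" and e: "e > 0" for f :: "'n \<Rightarrow> 'n \<Rightarrow> real^'n \<Rightarrow> real" and e
  proof -
    have "\<forall>\<^sub>F x in nhds 0. \<bar>f i j x - f i j 0\<bar> < e" for i j
    proof -
      have "(f i j \<longlongrightarrow> f i j 0) (nhds 0)"
        using that(1)[of i j] op\<Omega> sect(1) by (simp add: continuous_on_eq_continuous_at continuous_at tendsto_at_iff_tendsto_nhds)
      from tendstoD[OF this e] show ?thesis by (simp add: dist_real_def)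
    qed
    then have "\<forall>\<^sub>F x in nhds 0. \<forall>i j. \<bar>f i j x - f i j 0\<bar> < e"
      by (intro eventually_all_finite)
    moreover have "\<forall>\<^sub>F x in nhds 0. x \<in> S" by (rule eventually_nhds_in_open[OF opS S0])
    ultimately have "\<forall>\<^sub>F x in nhds 0. x \<in> S \<and> (\<forall>i j. \<bar>f i j x - f i j 0\<bar> < e)" by eventually_elim auto
    then obtain r where "r > 0" "\<And>x. dist x 0 < r \<Longrightarrow> x \<in> S \<and> (\<forall>i j. \<bar>f i j x - f i j 0\<bar> < e)"
      unfolding eventually_nhds_metric by blast
    then show ?thesis by (intro exI[of _ r]) (auto simp: dist_commute intro: less_imp_le)
  qed
  have form: "\<bar>\<Sum>i\<in>UNIV. \<Sum>j\<in>UNIV. g i j * (x$i * x$j)\<bar> \<le> n\<^sup>2 * e * (norm x)\<^sup>2"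
    if "\<And>i j. \<bar>g i j\<bar> \<le> e" for g :: "'n \<Rightarrow> 'n \<Rightarrow> real" and e and x :: "real^'n"
  proof -
    have "norm (\<Sum>i\<in>UNIV. \<Sum>j\<in>UNIV. g i j * (x$i * x$j)) \<le> (\<Sum>i\<in>(UNIV::'n set). \<Sum>j\<in>(UNIV::'n set). e * (norm x * norm x))"
      using that component_le_norm_cart[of x]
      by (intro sum_norm_le) (auto simp: abs_mult intro!: mult_mono order.trans[OF abs_ge_zero that])
    then show ?thesis by (simp add: n_def power2_eq_square mult_ac)
  qed
  \<comment> \<open>Tolerances per entry: summed over the n^2 entries they perturb the coefficient
    form by at most \<open>\<mu> / 2\<close> and the Hessian form by at most \<open>m / 2\<close>,
    times the squared norm.\<close>
  define ea where "ea = \<mu> / 2 / n\<^sup>2"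
  define eh where "eh = m / 2 / n\<^sup>2"
  have eah: "ea > 0" "eh > 0" using \<mu>(1) m(1) n by (auto simp: ea_def eh_def)
  obtain r1 where r1: "r1 > 0" "ball 0 r1 \<subseteq> S" "\<And>x i j. x \<in> ball 0 r1 \<Longrightarrow> \<bar>a i j x - a i j 0\<bar> \<le> ea"
    using near[of a ea, OF smooth_on_continuous[OF a_smooth] eah(1)] by blast
  obtain r2 where r2: "r2 > 0" "ball 0 r2 \<subseteq> S"
    "\<And>x i j. x \<in> ball 0 r2 \<Longrightarrow> \<bar>partial j (partial i u) x - partial j (partial i u) 0\<bar> \<le> eh"
    using near[of "\<lambda>i j. partial j (partial i u)" eh, OF hasC2D(5)[OF uC2] eah(2)] by blast
  define \<rho> where "\<rho> = min 1 (min r1 r2)"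
  have \<rho>: "0 < \<rho>" "\<rho> \<le> 1" "ball 0 \<rho> \<subseteq> S" "ball (0::real^'n) \<rho> \<subseteq> ball 0 r1" "ball (0::real^'n) \<rho> \<subseteq> ball 0 r2"
    using r1 r2 by (auto simp: \<rho>_def)
  have elliptic: "\<mu> / 2 * (norm \<xi>)\<^sup>2 \<le> (\<Sum>i\<in>UNIV. \<Sum>j\<in>UNIV. a i j x * (\<xi>$i * \<xi>$j))" if "x \<in> ball 0 \<rho>" for x \<xi>
  proof -
    have "\<bar>\<Sum>i\<in>UNIV. \<Sum>j\<in>UNIV. (a i j x - a i j 0) * (\<xi>$i * \<xi>$j)\<bar> \<le> n\<^sup>2 * ea * (norm \<xi>)\<^sup>2"
      using r1(3) \<rho>(4) that by (intro form) auto
    moreover have "(\<Sum>i\<in>UNIV. \<Sum>j\<in>UNIV. (a i j x - a i j 0) * (\<xi>$i * \<xi>$j))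
      = (\<Sum>i\<in>UNIV. \<Sum>j\<in>UNIV. a i j x * (\<xi>$i * \<xi>$j)) - (\<Sum>i\<in>UNIV. \<Sum>j\<in>UNIV. a i j 0 * (\<xi>$i * \<xi>$j))"
      by (simp add: left_diff_distrib sum_subtractf)
    moreover have "n\<^sup>2 * ea = \<mu> / 2" using n by (simp add: ea_def)
    ultimately have "\<bar>(\<Sum>i\<in>UNIV. \<Sum>j\<in>UNIV. a i j x * (\<xi>$i * \<xi>$j)) - (\<Sum>i\<in>UNIV. \<Sum>j\<in>UNIV. a i j 0 * (\<xi>$i * \<xi>$j))\<bar>
      \<le> \<mu> / 2 * (norm \<xi>)\<^sup>2" by (simp only:)
    then show ?thesis using \<mu>(2)[of \<xi>] by linarith
  qed
  \<comment> \<open>By Taylor's formula \<open>\<phi> x\<close> is half the Hessian form at an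
    intermediate point, which is at least m - m/2 times \<bar>x\<bar>^2; this explains
    \<open>m / 4\<close>.\<close>
  have phi_bounds: "m / 4 * (norm x)\<^sup>2 \<le> \<phi> x" "\<phi> x \<le> (n\<^sup>2 * (\<Sum>i\<in>UNIV. \<Sum>j\<in>UNIV. \<bar>H$i$j\<bar>) + m) * (norm x)\<^sup>2"
    if x: "norm x < \<rho>" for x
  proof -
    obtain t where t: "0 < t" "t < 1" "u x = u 0 + (\<Sum>l\<in>UNIV. x$l * partial l u 0)
      + (\<Sum>l\<in>UNIV. \<Sum>k\<in>UNIV. x$l * x$k * partial k (partial l u) (t *\<^sub>R x)) / 2"
      using hasC2_taylor[OF uC2 _ x] \<rho>(3) S\<Omega> by blast
    have "norm (t *\<^sub>R x) \<le> norm x" using t by (simp add: mult_left_le_one_le)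
    then have tx: "t *\<^sub>R x \<in> ball 0 r2" using x \<rho>(5) by auto
    define Q where "Q y = (\<Sum>l\<in>UNIV. \<Sum>k\<in>UNIV. partial k (partial l u) y * (x$l * x$k))" for y
    have \<phi>: "\<phi> x = Q (t *\<^sub>R x) / 2"
      using t(3) by (simp add: \<phi>_def Q_def gradient_def inner_vec_def mult_ac)
    have "\<bar>\<Sum>l\<in>UNIV. \<Sum>k\<in>UNIV. (partial k (partial l u) (t *\<^sub>R x) - partial k (partial l u) 0) * (x$l * x$k)\<bar> \<le> n\<^sup>2 * eh * (norm x)\<^sup>2"
      using r2(3)[OF tx] by (intro form) auto
    moreover have "(\<Sum>l\<in>UNIV. \<Sum>k\<in>UNIV. (partial k (partial l u) (t *\<^sub>R x) - partial k (partial l u) 0) * (x$l * x$k)) = Q (t *\<^sub>R x) - Q 0"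
      by (simp add: Q_def left_diff_distrib sum_subtractf)
    moreover have "n\<^sup>2 * eh = m / 2" using n by (simp add: eh_def)
    ultimately have diff: "\<bar>Q (t *\<^sub>R x) - Q 0\<bar> \<le> m / 2 * (norm x)\<^sup>2" by simp
    have Q0: "Q 0 = x \<bullet> (H *v x)" unfolding quad Q_def by (simp add: mult_ac)
    have lo: "m * (norm x)\<^sup>2 \<le> Q 0" using m(3) by (simp add: Q0)
    have hH: "\<bar>H$k$l\<bar> \<le> (\<Sum>i\<in>UNIV. \<Sum>j\<in>UNIV. \<bar>H$i$j\<bar>)" for k l
    proof -
      have "\<bar>H$k$l\<bar> \<le> (\<Sum>j\<in>UNIV. \<bar>H$k$j\<bar>)" by (intro member_le_sum) auto
      also have "\<dots> \<le> (\<Sum>i\<in>UNIV. \<Sum>j\<in>UNIV. \<bar>H$i$j\<bar>)" by (intro member_le_sum[of k UNIV "\<lambda>i. \<Sum>j\<in>UNIV. \<bar>H$i$j\<bar>"]) (auto intro!: sum_nonneg)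
      finally show ?thesis .
    qed
    have "Q 0 = (\<Sum>l\<in>UNIV. \<Sum>k\<in>UNIV. H$k$l * (x$l * x$k))" by (simp add: Q_def Hij)
    then have hi: "Q 0 \<le> n\<^sup>2 * (\<Sum>i\<in>UNIV. \<Sum>j\<in>UNIV. \<bar>H$i$j\<bar>) * (norm x)\<^sup>2"
      using form[of "\<lambda>l k. H$k$l" "\<Sum>i\<in>UNIV. \<Sum>j\<in>UNIV. \<bar>H$i$j\<bar>" x, OF hH] by (simp add: abs_le_iff)
    have xx: "0 \<le> m * (norm x)\<^sup>2" using m(1) by simp
    show "m / 4 * (norm x)\<^sup>2 \<le> \<phi> x" using diff lo unfolding \<phi> by linarith
    have "0 \<le> n\<^sup>2 * (\<Sum>i\<in>UNIV. \<Sum>j\<in>UNIV. \<bar>H$i$j\<bar>) * (norm x)\<^sup>2" by (intro mult_nonneg_nonneg sum_nonneg) auto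
    then show "\<phi> x \<le> (n\<^sup>2 * (\<Sum>i\<in>UNIV. \<Sum>j\<in>UNIV. \<bar>H$i$j\<bar>) + m) * (norm x)\<^sup>2"
      using diff hi xx unfolding \<phi> distrib_right by linarith
  qed
  define M where "M = n\<^sup>2 * (\<Sum>i\<in>UNIV. \<Sum>j\<in>UNIV. \<bar>H$i$j\<bar>) + m"
  have M: "M > 0" unfolding M_def using m(1) by (intro add_nonneg_pos mult_nonneg_nonneg sum_nonneg) auto
  define g where "g r = (if CARD('n) \<ge> 3 then r powr ((2 - real CARD('n)) / 2) else \<bar>ln r\<bar>)" for r
  have grow: "\<exists>r>0. \<forall>x. 0 < norm x \<longrightarrow> norm x < r \<longrightarrow> \<bar>v x\<bar> \<le> c * \<bar>g (\<phi> x)\<bar>" if "c > 0" for c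
    unfolding \<phi>_def
  proof (rule section_boundary_growth[OF op\<Omega> sect(1) u(3) _ \<rho>(1), of "m / 4" M])
    show "small_o_on_boundaries v (MA_section \<Omega> u 0) g" using growth by (simp add: g_def[abs_def])
  qed (use m(1) \<rho>(3) S\<Omega> phi_bounds that in \<open>auto simp: \<phi>_def M_def\<close>)
  interpret elliptic_operator "ball 0 \<rho>" "cball 0 (\<rho> / 2)" a "\<mu> / 2"
  proof
    show "cball 0 (\<rho> / 2) \<subseteq> ball (0::real^'n) \<rho>" using \<rho>(1) by auto
    show "smooth_on (a i j) (ball 0 \<rho>)" for i j
      using smooth_on_subset[OF a_smooth] \<rho>(3) S\<Omega> by blast
  qed (use \<mu>(1) elliptic in auto)
  have vC2: "hasC2 (S - {0}) v (\<lambda>l. partial l v) (\<lambda>l m. partial m (partial l v))"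
    using v by (intro Ck_on_2_partials) (simp add: solves_linearized_MA_def S_def)
  have "\<exists>w w1 w2. hasC2 (ball 0 (\<rho> / 2)) w w1 w2 \<and> (\<forall>x\<in>ball 0 (\<rho> / 2) - {0}. v x = w x)"
  proof (rule removable_singularity[OF refl refl \<rho>(1,2) dim _ _ _ _ Hsym aH m])
    show "hasC2 (ball 0 \<rho> - {0}) v (\<lambda>l. partial l v) (\<lambda>l m. partial m (partial l v))"
      by (rule hasC2_subset[OF vC2]) (use \<rho>(3) in auto)
    show "(\<Sum>i\<in>UNIV. \<Sum>j\<in>UNIV. a i j x * partial i (partial j v) x) = 0" if "x \<in> ball 0 \<rho> - {0}" for x
      using v that \<rho>(3) by (auto simp: solves_linearized_MA_def S_def a_def hessian_def)
  next
    fix c :: real assume n3: "CARD('n) \<ge> 3" and c: "c > 0"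
    \<comment> \<open>The exponent is not positive, so the lower bound for \<open>\<phi>\<close>
      bounds \<open>\<phi> x powr b\<close> from above, by \<open>(m / 4) powr b\<close> times
      \<bar>x\<bar>^(2-n); \<open>c'\<close> compensates that factor.\<close>
    define b where "b = (2 - real CARD('n)) / 2"
    have b: "b \<le> 0" using n3 by (simp add: b_def)
    define c' where "c' = c / (m / 4) powr b"
    have c': "c' > 0" using c m(1) by (simp add: c'_def)
    obtain r where r: "r > 0" "\<And>x. 0 < norm x \<Longrightarrow> norm x < r \<Longrightarrow> \<bar>v x\<bar> \<le> c' * \<bar>g (\<phi> x)\<bar>"
      using grow[OF c'] by blast
    have "\<bar>v x\<bar> \<le> c * norm x powr (2 - real CARD('n))" if x: "0 < norm x" "norm x < min r \<rho>" for x
    proof -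
      have "\<phi> x powr b \<le> (m / 4 * (norm x)\<^sup>2) powr b"
        using phi_bounds(1)[of x] x b m(1) by (intro powr_mono2') auto
      also have "\<dots> = (m / 4) powr b * ((norm x)\<^sup>2) powr b" by (rule powr_mult)
      also have "((norm x)\<^sup>2) powr b = norm x powr (2 - real CARD('n))"
      proof -
        have "((norm x)\<^sup>2) powr b = (norm x powr 2) powr b" using x by simp
        also have "\<dots> = norm x powr (2 * b)" by (rule powr_powr)
        also have "2 * b = 2 - real CARD('n)" by (simp add: b_def field_simps)
        finally show ?thesis .
      qed
      finally have "c' * \<phi> x powr b \<le> c' * ((m / 4) powr b * norm x powr (2 - real CARD('n)))"
        using c' by (intro mult_left_mono) auto
      also have "\<dots> = c * norm x powr (2 - real CARD('n))" using m(1) by (simp add: c'_def)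
      finally show ?thesis using r(2)[of x] x n3 by (simp add: g_def b_def)
    qed
    then show "\<exists>r>0. \<forall>x. 0 < norm x \<longrightarrow> norm x < r \<longrightarrow> \<bar>v x\<bar> \<le> c * norm x powr (2 - real CARD('n))"
      using r(1) \<rho>(1) by (intro exI[of _ "min r \<rho>"]) auto
  next
    fix c :: real assume n2: "CARD('n) = 2" and c: "c > 0"
    obtain r where r: "r > 0" "\<And>x. 0 < norm x \<Longrightarrow> norm x < r \<Longrightarrow> \<bar>v x\<bar> \<le> c / 3 * \<bar>g (\<phi> x)\<bar>"
      using grow[of "c / 3"] c by auto
    obtain q where q: "q > 0" "\<And>s y. 0 < s \<Longrightarrow> s < q \<Longrightarrow> m / 4 * s\<^sup>2 \<le> y \<Longrightarrow> y \<le> M * s\<^sup>2 \<Longrightarrow> \<bar>ln y\<bar> \<le> 3 * \<bar>ln s\<bar>"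
      using abs_ln_comparable[of "m / 4" M] m(1) M by auto
    have "\<bar>v x\<bar> \<le> c * \<bar>ln (norm x)\<bar>" if x: "0 < norm x" "norm x < min r (min q \<rho>)" for x
    proof -
      have "\<bar>ln (\<phi> x)\<bar> \<le> 3 * \<bar>ln (norm x)\<bar>"
        using phi_bounds[of x] x by (intro q(2)) (auto simp: M_def)
      then have "c / 3 * \<bar>ln (\<phi> x)\<bar> \<le> c / 3 * (3 * \<bar>ln (norm x)\<bar>)" using c by (intro mult_left_mono) auto
      then show ?thesis using r(2)[of x] x n2 by (simp add: g_def)
    qed
    then show "\<exists>r>0. \<forall>x. 0 < norm x \<longrightarrow> norm x < r \<longrightarrow> \<bar>v x\<bar> \<le> c * \<bar>ln (norm x)\<bar>"
      using r(1) q(1) \<rho>(1) by (intro exI[of _ "min r (min q \<rho>)"]) auto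
  qed
  then obtain w w1 w2 where w: "hasC2 (ball 0 (\<rho> / 2)) w w1 w2" "\<And>x. x \<in> ball 0 (\<rho> / 2) - {0} \<Longrightarrow> v x = w x"
    by blast
  have "removable_singularity_at_0 u v S"
  proof (rule removable_singularity_at_0I[OF opS S0 _ _ _ hasC2_Ck_on_2[OF open_ball w(1)] w(2)])
    show "0 < \<rho> / 2" using \<rho>(1) by simp
    show "ball 0 (\<rho> / 2) \<subseteq> S" using \<rho>(1,3) by auto
    show "solves_linearized_MA u v (S - {0})" using v by (simp add: S_def)
    show "continuous_on S (\<lambda>x. cofactor_hessian u x $ i $ j)" for i j
      using continuous_on_subset[OF smooth_on_continuous[OF a_smooth] S\<Omega>] by (simp add: a_def[abs_def])
  qed
  then show ?thesis by (simp add: S_def)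
qed

end
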